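(* Let $d\ge 1$ and let $\alpha\in\mathbb{R}\setminus\mathbb{N}_0$. If $f\in PW_\pi^{(d)}$, then $$\lim_{c\to\infty}\|\mathscr{I}_{\alpha,c}f-f\|_{L_2(\mathbb{R}^d)}=0,$$ and $\lim_{c\to\infty}|\mathscr{I}_{\alpha,c}f(x)-f(x)|=0$ uniformly for $x\in\mathbb{R}^d$.
   Context: $\mathbb{N}_0=\{0,1,2,\dots\}$. Fourier transform convention: $\widehat g(\xi)=\int_{\mathbb{R}^d}g(x)e^{-i\langle\xi,x\rangle}dx$. The Paley–Wiener space is $PW_\pi^{(d)}=\{f\in L_2(\mathbb{R}^d):\widehat f=0\text{ a.e. outside }[-\pi,\pi]^d\}$; its elements are identified with their continuous representatives. For $c>0$ and $\alpha\in\mathbb{R}\setminus\mathbb{N}_0$, the general multiquadric $\phi_{\alpha,c}(x)=(\|x\|^2+c^2)^\alpha$ on $\mathbb{R}^d$ ($\|\cdot\|$ Euclidean) has generalized Fourier transform $$\widehat{\phi}_{\alpha,c}(\xi)=\frac{2^{1+\alpha}}{\Gamma(-\alpha)}\Big(\frac{c}{\|\xi\|}\Big)^{\alpha+\frac d2}K_{\alpha+\frac d2}(c\|\xi\|),\quad \xi\in\mathbb{R}^d\setminus\{0\},$$ where $K_\nu$ is the modified Bessel function of the second kind. Set $$\widehat{L}_{\alpha,c}(\xi)=\frac{\widehat{\phi}_{\alpha,c}(\xi)}{\sum_{j\in\mathbb{Z}^d}\widehat{\phi}_{\alpha,c}(\xi+2\pi j)}$$ (extended by continuity to $\xi\in 2\pi\mathbb{Z}^d$).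 This is in $L_1(\mathbb{R}^d)$, and $L_{\alpha,c}(x)=\frac{1}{(2\pi)^d}\int_{\mathbb{R}^d}\widehat{L}_{\alpha,c}(\xi)e^{i\langle x,\xi\rangle}d\xi$. The cardinal interpolant of $f\in PW_\pi^{(d)}$ is $\mathscr{I}_{\alpha,c}f(x)=\sum_{k\in\mathbb{Z}^d}f(k)L_{\alpha,c}(x-k)$, i.e. the function with Fourier transform $\widehat{L}_{\alpha,c}(\xi)\sum_{k\in\mathbb{Z}^d}f(k)e^{-i\langle k,\xi\rangle}$, the last series converging in $L_2$ over $[-\pi,\pi]^d$ (and extended $2\pi$-periodically). *)

theory Defs
  imports "HOL-Analysis.Analysis"
begin

(* The dimension d is CARD('n); the lattice Z^d is indexed by the type int ^ 'n. *)

definition lattice_pt :: "int ^ 'n \<Rightarrow> real ^ 'n" where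
  "lattice_pt k = (\<chi> i. real_of_int (k $ i))"

definition in_L2 :: "(real ^ 'n \<Rightarrow> complex) \<Rightarrow> bool" where
  "in_L2 g \<longleftrightarrow> g \<in> borel_measurable lborel \<and> integrable lborel (\<lambda>x. (norm (g x))\<^sup>2)"

(* Extended-valued: a Bochner integral alone would give a function outside L2 the norm 0. *)
definition L2_norm :: "(real ^ 'n \<Rightarrow> complex) \<Rightarrow> ennreal" where
  "L2_norm g = (if in_L2 g then ennreal (sqrt (\<integral>x. (norm (g x))\<^sup>2 \<partial>lborel)) else \<infinity>)"

definition fourier_L1 :: "(real ^ 'n \<Rightarrow> complex) \<Rightarrow> real ^ 'n \<Rightarrow> complex" where
  "fourier_L1 g \<xi> = (\<integral>x. g x * exp (- \<i> * complex_of_real (\<xi> \<bullet> x)) \<partial>lborel)"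

(* The Plancherel extension to L2: F is the limit in mean, over growing balls, of the
   transforms of the cut-offs of g, which lie in both L1 and L2. This determines F only
   up to a null set, hence a relation. *)
definition is_fourier_L2 :: "(real ^ 'n \<Rightarrow> complex) \<Rightarrow> (real ^ 'n \<Rightarrow> complex) \<Rightarrow> bool" where
  "is_fourier_L2 g F \<longleftrightarrow> in_L2 g \<and> in_L2 F \<and>
     ((\<lambda>R. L2_norm (\<lambda>\<xi>. fourier_L1 (\<lambda>x. indicator (cball 0 R) x *\<^sub>R g x) \<xi> - F \<xi>)) \<longlongrightarrow> 0) at_top"

(* Elements are the continuous representatives, so that point values make sense. *)
definition paley_wiener :: "(real ^ 'n \<Rightarrow> complex) set" where
  "paley_wiener = {f. in_L2 f \<and> continuous_on UNIV f \<and>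
     (\<exists>F. is_fourier_L2 f F \<and>
          (AE \<xi> in lborel. \<xi> \<notin> cbox (\<chi> i. - pi) (\<chi> i. pi) \<longrightarrow> F \<xi> = 0))}"

(* Modified Bessel function of the second kind, by its integral representation for r > 0. *)
definition bessel_K :: "real \<Rightarrow> real \<Rightarrow> real" where
  "bessel_K \<nu> r = (LBINT t:{0..}. exp (- r * cosh t) * cosh (\<nu> * t))"

(* Generalized Fourier transform, away from the origin, of the general multiquadric
   x |-> (||x||^2 + c^2)^alpha. *)
definition multiquadric_hat :: "real \<Rightarrow> real \<Rightarrow> real ^ 'n \<Rightarrow> real" where
  "multiquadric_hat \<alpha> c \<xi> =
     2 powr (1 + \<alpha>) / Gamma (- \<alpha>)
       * (c / norm \<xi>) powr (\<alpha> + real CARD('n) / 2)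
       * bessel_K (\<alpha> + real CARD('n) / 2) (c * norm \<xi>)"

definition cardinal_quotient :: "real \<Rightarrow> real \<Rightarrow> real ^ 'n \<Rightarrow> real" where
  "cardinal_quotient \<alpha> c \<xi> =
     multiquadric_hat \<alpha> c \<xi> /
       (\<Sum>\<^sub>\<infinity>j\<in>(UNIV :: (int ^ 'n) set). multiquadric_hat \<alpha> c (\<xi> + (2 * pi) *\<^sub>R lattice_pt j))"

(* On 2 pi Z^d some term of the quotient is evaluated at the origin; there the value is
   the one given by continuity. *)
definition cardinal_hat :: "real \<Rightarrow> real \<Rightarrow> real ^ 'n \<Rightarrow> real" where
  "cardinal_hat \<alpha> c \<xi> =
     (if \<xi> \<in> range (\<lambda>j :: int ^ 'n. (2 * pi) *\<^sub>R lattice_pt j)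
      then Lim (at \<xi>) (cardinal_quotient \<alpha> c)
      else cardinal_quotient \<alpha> c \<xi>)"

definition cardinal_fun :: "real \<Rightarrow> real \<Rightarrow> real ^ 'n \<Rightarrow> complex" where
  "cardinal_fun \<alpha> c x = complex_of_real (1 / (2 * pi) ^ CARD('n)) *
     (\<integral>\<xi>. complex_of_real (cardinal_hat \<alpha> c \<xi>) * exp (\<i> * complex_of_real (x \<bullet> \<xi>)) \<partial>lborel)"

definition cardinal_interpolant ::
    "real \<Rightarrow> real \<Rightarrow> (real ^ 'n \<Rightarrow> complex) \<Rightarrow> real ^ 'n \<Rightarrow> complex" where
  "cardinal_interpolant \<alpha> c f x =
     (\<Sum>\<^sub>\<infinity>k\<in>(UNIV :: (int ^ 'n) set). f (lattice_pt k) * cardinal_fun \<alpha> c (x - lattice_pt k))"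

end

theory Submission imports Defs "HOL-Probability.Characteristic_Functions" "HOL-Real_Asymp.Real_Asymp" begin

text \<open>
  Write \<open>\<Lambda>\<^sub>c\<close> for the symbol \<open>cardinal_hat \<alpha> c\<close>. For \<open>s \<ge> r > 0\<close> the integral defining the Bessel function gives
  \<open>K\<^sub>\<nu> s \<le> exp (r - s) * K\<^sub>\<nu> r\<close>, and in the open cube \<open>(- \<pi>, \<pi>)\<^sup>d\<close> the point \<open>\<xi>\<close> is the strictly shortest
  element of its class modulo \<open>2 \<pi> \<int>\<^sup>d\<close>. Hence, without any asymptotics of \<open>K\<^sub>\<nu>\<close>, \<open>\<Lambda>\<^sub>c \<xi>\<close> tends to 1
  almost everywhere on the cube as \<open>c\<close> grows, while the translates of \<open>\<Lambda>\<^sub>c\<close> are nonnegative with sum 1.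

  By inversion \<open>f (k)\<close> is a Fourier coefficient of \<open>F\<close> on the cube, and by periodisation \<open>L\<^sub>c (x - k)\<close> is one
  of a function bounded by 1. Parseval's identity on the cube therefore sums the interpolation series:
  the error is the inverse Fourier transform of \<open>\<Lambda>\<^sub>c\<close> times the periodised \<open>F\<close>, minus \<open>F\<close>. Summing over the
  translates of the cube, the integral of the \<open>p\<close>-th power of the absolute value of this function, for
  \<open>p = 1, 2\<close>, is at most the integral of \<open>\<bar>F\<bar> ^ p * 2 * (1 - \<Lambda>\<^sub>c)\<close> over the cube, which tends to 0 by dominated
  convergence. The case \<open>p = 1\<close> bounds the error uniformly and \<open>p = 2\<close> bounds it in \<open>L\<^sup>2\<close>.
\<close>

section \<open>Gaussians on Euclidean space\<close>

text \<open>The defined notions are total: a divergent \<open>infsum\<close> or Bochner integral is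
  0, and \<open>L2_norm\<close> is infinite off L2. Convergence and membership in L2 are therefore
  part of what has to be shown, and the series is summed at every x; this is why f is recovered
  pointwise and Parseval's identity is stated with \<open>has_sum\<close>. On the faces of the cube
  two translates are equally short and \<Lambda> is at most 1/2, so \<Lambda> does not converge to 1
  uniformly on the open cube and every limit goes through dominated convergence. A single null set
  serves all c \<ge> 1: the translates of the symbol relative to the central one are dominated by a
  multiple of exp (- |\<xi> + 2 \<pi> j| / 2), whose sum over j is finite for almost every \<xi>
  because exp (- |\<xi>| / 2) is integrable. The weight 2 (1 - \<Lambda>) is the l1 distance between
  the sequence of translates of \<Lambda>, which has sum 1, and the unit vector at j = 0: the
  central entry misses 1 - \<Lambda> and the others add up to 1 - \<Lambda>. The entries of the
  difference are at most 1 in modulus, so their p-th powers are no larger, and one estimate serves p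
  = 1 and p = 2.\<close>

lemma prod_Basis_vec:
  fixes g :: "real^'n \<Rightarrow> 'a::comm_monoid_mult"
  shows "(\<Prod>b\<in>Basis. g b) = (\<Prod>i\<in>UNIV. g (axis i 1))"
proof -
  have "(Basis :: (real^'n) set) = (\<lambda>i. axis i 1) ` UNIV"
    by (auto simp: Basis_vec_def)
  moreover have "inj (\<lambda>i::'n. axis i (1::real))"
    by (auto simp: inj_def axis_eq_axis)
  ultimately show ?thesis
    by (intro prod.reindex_cong[of "\<lambda>i. axis i 1"]) auto
qed

text \<open>Lebesgue measure on \<open>real^'n\<close> is a product over \<open>Basis\<close>, so
  the factors indexed by \<open>'n\<close> are carried over along
  \<open>\<lambda>i. axis i 1\<close>. Gaussians, characters on the cube and the exponential
  majorant all factor in this way.\<close>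

lemma
  fixes f :: "'n::finite \<Rightarrow> real \<Rightarrow> 'a::{real_normed_field,banach,second_countable_topology}"
  assumes "\<And>i. integrable lborel (f i)"
  shows integrable_lborel_prod_vec: "integrable lborel (\<lambda>x::real^'n. \<Prod>i\<in>UNIV. f i (x $ i))"
    and integral_lborel_prod_vec:
      "(\<integral>x. (\<Prod>i\<in>UNIV. f i (x $ i)) \<partial>(lborel :: (real^'n) measure)) = (\<Prod>i\<in>UNIV. \<integral>t. f i t \<partial>lborel)"
proof -
  \<comment> \<open>For b outside \<open>Basis\<close> the choice is arbitrary but still returns
    some \<open>f i\<close>, so that \<open>gi\<close> holds for every b.\<close>
  define g where "g = (\<lambda>b::real^'n. f (SOME i. b = axis i 1))"
  have g: "g (axis i 1) = f i" for i
    unfolding g_def by (simp add: axis_eq_axis)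
  interpret product_sigma_finite "\<lambda>_::real^'n. lborel :: real measure" ..
  note L = lborel_eq[where 'a="real^'n"]
  have f [measurable]: "f i \<in> borel_measurable borel" for i
    using assms[of i] by auto
  have gi: "integrable lborel (g b)" for b
    unfolding g_def by (rule assms)
  have meas: "(\<lambda>x::real^'n. \<Prod>i\<in>UNIV. f i (x $ i)) \<in> borel_measurable borel"
    by measurable
  have eq: "(\<Prod>i\<in>UNIV. f i ((\<Sum>b\<in>Basis. h b *\<^sub>R b) $ i)) = (\<Prod>b\<in>Basis. g b (h b))"
    for h :: "real^'n \<Rightarrow> real"
  proof -
    have "(\<Sum>b\<in>Basis. h b *\<^sub>R b) $ i = h (axis i 1)" for i
    proof -
      have "(\<Sum>b\<in>Basis. h b *\<^sub>R b) $ i = (\<Sum>b\<in>Basis. h b *\<^sub>R b) \<bullet> axis i 1"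
        by (simp add: inner_axis)
      also have "\<dots> = h (axis i 1)"
        by (rule inner_sum_left_Basis) (auto simp: Basis_vec_def)
      finally show ?thesis .
    qed
    then show ?thesis
      by (simp add: prod_Basis_vec g)
  qed
  show "integrable lborel (\<lambda>x::real^'n. \<Prod>i\<in>UNIV. f i (x $ i))"
    unfolding L
    by (subst integrable_distr_eq; (simp only: eq)?) (auto simp: meas intro!: product_integrable_prod gi)
  have "(\<integral>x. (\<Prod>i\<in>UNIV. f i (x $ i)) \<partial>(lborel :: (real^'n) measure)) =
     (\<integral>h. (\<Prod>b\<in>Basis. g b (h b)) \<partial>(\<Pi>\<^sub>M b\<in>(Basis::(real^'n) set). lborel))"
    unfolding L
    by (subst integral_distr; (simp only: eq)?) (auto simp: meas)
  also have "\<dots> = (\<Prod>b\<in>Basis. integral\<^sup>L lborel (g b))"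
    by (rule product_integral_prod) (auto intro: gi)
  finally show "(\<integral>x. (\<Prod>i\<in>UNIV. f i (x $ i)) \<partial>(lborel :: (real^'n) measure)) = (\<Prod>i\<in>UNIV. \<integral>t. f i t \<partial>lborel)"
    by (simp add: prod_Basis_vec g)
qed

lemma borel_measurable_cis [measurable]: "cis \<in> borel_measurable borel"
  by (intro borel_measurable_continuous_onI continuous_intros)

lemma exp_minus_i_eq_cis: "exp (- \<i> * complex_of_real t) = cis (- t)"
  by (simp add: cis_conv_exp)

lemma exp_i_eq_cis: "exp (\<i> * complex_of_real t) = cis t"
  by (simp add: cis_conv_exp)

lemma cis_sum: "finite A \<Longrightarrow> cis (\<Sum>i\<in>A. f i) = (\<Prod>i\<in>A. cis (f i))"
  by (induction A rule: finite_induct) (auto simp: cis_mult[symmetric])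

lemma cis_inner_vec: "cis (x \<bullet> y) = (\<Prod>i\<in>UNIV. cis (x $ i * y $ i))" for x y :: "real^'n"
  by (simp add: inner_vec_def cis_sum)

text \<open>\<sigma> is the reciprocal of the standard deviation and there is no normalising factor:
  dilation multiplies \<sigma>, the Fourier transform inverts it, and \<sigma> tending to 0 gives
  the constant 1.\<close>

definition gauss :: "real \<Rightarrow> 'a::real_inner \<Rightarrow> real" where
  "gauss \<sigma> x = exp (- (\<sigma>\<^sup>2 * (norm x)\<^sup>2 / 2))"

lemma gauss_pos: "gauss \<sigma> x > 0"
  and gauss_le_1: "gauss \<sigma> x \<le> 1"
  and gauss_minus: "gauss \<sigma> (- x) = gauss \<sigma> x"
  and gauss_scaleR: "gauss \<sigma> (r *\<^sub>R x) = gauss (\<sigma> * r) x"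
  by (auto simp: gauss_def power_mult_distrib)

lemma gauss_minus_commute: "gauss \<sigma> (x - y) = gauss \<sigma> (y - x)"
  by (simp add: gauss_def norm_minus_commute)

lemma borel_measurable_gauss [measurable]:
  "gauss \<sigma> \<in> borel_measurable (borel :: 'a::{real_inner,second_countable_topology} measure)"
  unfolding gauss_def by measurable

lemma gauss_vec: "gauss \<sigma> x = (\<Prod>i\<in>UNIV. gauss \<sigma> (x $ i))" for x :: "real^'n"
  by (simp add: gauss_def exp_sum[symmetric] sum_negf sum_distrib_left sum_divide_distrib
      norm_vec_def L2_set_def real_sqrt_pow2 sum_nonneg)

text \<open>The characteristic function of the standard normal distribution after the substitution x
  = \<sigma> t; \<open>s\<close> = y / \<sigma> compensates the dilation in the character.\<close>

lemma
  fixes y :: real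
  assumes "\<sigma> > 0"
  shows integrable_gauss_real: "integrable lborel (\<lambda>t. cis (t * y) * of_real (gauss \<sigma> t))"
    and fourier_gauss_real:
      "(\<integral>t. cis (t * y) * of_real (gauss \<sigma> t) \<partial>lborel) = of_real (sqrt (2 * pi) / \<sigma> * gauss (1 / \<sigma>) y)"
proof -
  define s where "s = y / \<sigma>"
  have int: "integrable lborel (\<lambda>x. std_normal_density x *\<^sub>R cis (s * x))"
    by (rule Bochner_Integration.integrable_bound[OF integrable_std_normal_moment[of 0]]) auto
  have "of_real (exp (- (s\<^sup>2) / 2)) = char std_normal_distribution s"
    by (simp add: char_std_normal_distribution)
  also have "\<dots> = (\<integral>x. std_normal_density x *\<^sub>R cis (s * x) \<partial>lborel)"
    unfolding char_def by (subst integral_density) (auto simp: cis_conv_exp)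
  finally have 1: "(\<integral>x. std_normal_density x *\<^sub>R cis (s * x) \<partial>lborel) = of_real (exp (- (s\<^sup>2) / 2))" ..
  have eq: "std_normal_density (0 + \<sigma> * t) *\<^sub>R cis (s * (0 + \<sigma> * t))
      = (1 / sqrt (2 * pi)) *\<^sub>R (cis (t * y) * of_real (gauss \<sigma> t))" for t
    using assms
    by (simp add: std_normal_density_def gauss_def s_def scaleR_conv_of_real power_mult_distrib mult_ac)
  have "integrable lborel (\<lambda>t. (1 / sqrt (2 * pi)) *\<^sub>R (cis (t * y) * of_real (gauss \<sigma> t)))"
    unfolding eq[symmetric] using assms int by (intro lborel_integrable_real_affine) auto
  from integrable_scaleR_right[OF this, of "sqrt (2*pi)"]
  show "integrable lborel (\<lambda>t. cis (t * y) * of_real (gauss \<sigma> t))"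
    by simp
  have "(\<integral>x. std_normal_density x *\<^sub>R cis (s * x) \<partial>lborel) =
      \<sigma> *\<^sub>R (\<integral>t. (1 / sqrt (2 * pi)) *\<^sub>R (cis (t * y) * of_real (gauss \<sigma> t)) \<partial>lborel)"
    unfolding eq[symmetric] using assms by (subst lborel_integral_real_affine[of \<sigma> _ 0]) auto
  also have "\<dots> = (\<sigma> / sqrt (2*pi)) *\<^sub>R (\<integral>t. cis (t * y) * of_real (gauss \<sigma> t) \<partial>lborel)"
    by (simp only: integral_scaleR_right) simp
  finally have "(\<sigma> / sqrt (2*pi)) *\<^sub>R (\<integral>t. cis (t * y) * of_real (gauss \<sigma> t) \<partial>lborel)
      = of_real (exp (- (s\<^sup>2) / 2))"
    using 1 by simp
  then have "(sqrt (2*pi) / \<sigma>) *\<^sub>R (\<sigma> / sqrt (2*pi)) *\<^sub>R (\<integral>t. cis (t * y) * of_real (gauss \<sigma> t) \<partial>lborel)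
      = (sqrt (2*pi) / \<sigma>) *\<^sub>R of_real (exp (- (s\<^sup>2) / 2))"
    by (simp only:)
  then show "(\<integral>t. cis (t * y) * of_real (gauss \<sigma> t) \<partial>lborel) = of_real (sqrt (2 * pi) / \<sigma> * gauss (1 / \<sigma>) y)"
    using assms by (simp add: gauss_def s_def scaleR_conv_of_real power_divide)
qed

lemma
  fixes y :: "real^'n"
  assumes "\<sigma> > 0"
  shows integrable_cis_gauss: "integrable lborel (\<lambda>x. cis (x \<bullet> y) * of_real (gauss \<sigma> x))"
    and fourier_gauss: "(\<integral>x. cis (x \<bullet> y) * of_real (gauss \<sigma> x) \<partial>lborel) =
        of_real ((sqrt (2 * pi) / \<sigma>) ^ CARD('n) * gauss (1 / \<sigma>) y)"
proof -
  have eq: "cis (x \<bullet> y) * of_real (gauss \<sigma> x) =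
      (\<Prod>i\<in>UNIV. cis (x $ i * y $ i) * complex_of_real (gauss \<sigma> (x $ i)))" for x
    unfolding cis_inner_vec gauss_vec by (simp add: prod.distrib)
  show "integrable lborel (\<lambda>x. cis (x \<bullet> y) * of_real (gauss \<sigma> x))"
    unfolding eq by (intro integrable_lborel_prod_vec integrable_gauss_real assms)
  show "(\<integral>x. cis (x \<bullet> y) * of_real (gauss \<sigma> x) \<partial>lborel) =
        of_real ((sqrt (2 * pi) / \<sigma>) ^ CARD('n) * gauss (1 / \<sigma>) y)"
    unfolding eq
    apply (subst integral_lborel_prod_vec)
     apply (intro integrable_gauss_real assms)
    by (simp only: fourier_gauss_real[OF assms] of_real_prod[symmetric] gauss_vec[of _ y] prod.distrib prod_constant)
qed

lemma
  assumes "\<sigma> > 0"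
  shows integrable_gauss: "integrable lborel (gauss \<sigma> :: real^'n \<Rightarrow> real)"
    and integral_gauss: "(\<integral>x. gauss \<sigma> (x::real^'n) \<partial>lborel) = (sqrt (2 * pi) / \<sigma>) ^ CARD('n)"
proof -
  show "integrable lborel (gauss \<sigma> :: real^'n \<Rightarrow> real)"
    using integrable_cis_gauss[OF assms, of "0::real^'n"] by (simp add: complex_of_real_integrable_eq)
  show "(\<integral>x. gauss \<sigma> (x::real^'n) \<partial>lborel) = (sqrt (2 * pi) / \<sigma>) ^ CARD('n)"
    using fourier_gauss[OF assms, of "0::real^'n"] by (simp add: gauss_def del: of_real_mult of_real_power)
qed

section \<open>The Plancherel inequality\<close>

lemma borel_measurable_cnj [measurable]: "cnj \<in> borel_measurable borel"
  by (intro borel_measurable_continuous_onI continuous_intros)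

lemma
  fixes u v :: "'a \<Rightarrow> complex"
  assumes [measurable]: "u \<in> borel_measurable M" "v \<in> borel_measurable M"
    and u2: "integrable M (\<lambda>x. (norm (u x))\<^sup>2)" and v2: "integrable M (\<lambda>x. (norm (v x))\<^sup>2)"
  shows integrable_mult_L2: "integrable M (\<lambda>x. u x * v x)"
    and norm_integral_mult_le: "norm (\<integral>x. u x * v x \<partial>M)
      \<le> sqrt (\<integral>x. (norm (u x))\<^sup>2 \<partial>M) * sqrt (\<integral>x. (norm (v x))\<^sup>2 \<partial>M)"
proof -
  have bound: "norm (u x * v x) \<le> norm ((norm (u x))\<^sup>2 + (norm (v x))\<^sup>2)" for x
  proof -
    have "2 * norm (u x) * norm (v x) \<le> (norm (u x))\<^sup>2 + (norm (v x))\<^sup>2"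
      by (rule sum_squares_bound)
    moreover have "0 \<le> norm (u x) * norm (v x)"
      by simp
    ultimately show ?thesis
      unfolding norm_mult by (simp add: mult.assoc, linarith)
  qed
  show int: "integrable M (\<lambda>x. u x * v x)"
    by (rule Bochner_Integration.integrable_bound[OF Bochner_Integration.integrable_add[OF u2 v2]])
      (use bound in \<open>auto intro!: AE_I2\<close>)
  have "ennreal (norm (\<integral>x. u x * v x \<partial>M)) \<le> (\<integral>\<^sup>+x. ennreal (norm (u x)) * ennreal (norm (v x)) \<partial>M)"
    using integral_norm_bound_ennreal[OF int] by (simp add: norm_mult ennreal_mult)
  then have "(ennreal (norm (\<integral>x. u x * v x \<partial>M)))\<^sup>2 \<le> (\<integral>\<^sup>+x. ennreal (norm (u x)) * ennreal (norm (v x)) \<partial>M)\<^sup>2"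
    by (intro power_mono) auto
  also have "\<dots> \<le> (\<integral>\<^sup>+x. (ennreal (norm (u x)))\<^sup>2 \<partial>M) * (\<integral>\<^sup>+x. (ennreal (norm (v x)))\<^sup>2 \<partial>M)"
    by (rule Cauchy_Schwarz_nn_integral) auto
  also have "\<dots> = ennreal ((\<integral>x. (norm (u x))\<^sup>2 \<partial>M) * (\<integral>x. (norm (v x))\<^sup>2 \<partial>M))"
    by (simp add: ennreal_power nn_integral_eq_integral[OF u2] nn_integral_eq_integral[OF v2] ennreal_mult)
  finally have "(norm (\<integral>x. u x * v x \<partial>M))\<^sup>2 \<le> (\<integral>x. (norm (u x))\<^sup>2 \<partial>M) * (\<integral>x. (norm (v x))\<^sup>2 \<partial>M)"
    by (simp add: ennreal_power)
  then show "norm (\<integral>x. u x * v x \<partial>M)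
      \<le> sqrt (\<integral>x. (norm (u x))\<^sup>2 \<partial>M) * sqrt (\<integral>x. (norm (v x))\<^sup>2 \<partial>M)"
    by (simp add: real_le_rsqrt flip: real_sqrt_mult)
qed

context pair_sigma_finite
begin

text \<open>The interchanges in the Plancherel and duality arguments have this shape: two integrable
  factors coupled by a character \<open>k\<close> of modulus 1.\<close>

lemma integrable_mult_kernel:
  fixes u :: "'a \<Rightarrow> complex" and v :: "'b \<Rightarrow> complex"
  assumes u: "integrable M1 u" and v: "integrable M2 v"
    and [measurable]: "k \<in> borel_measurable (M1 \<Otimes>\<^sub>M M2)" and k: "\<And>p. norm (k p) \<le> 1"
  shows "integrable (M1 \<Otimes>\<^sub>M M2) (\<lambda>(x, y). u x * v y * k (x, y))"
proof (rule integrableI_bounded)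
  note [measurable] = borel_measurable_integrable[OF u] borel_measurable_integrable[OF v]
  show "(\<lambda>(x, y). u x * v y * k (x, y)) \<in> borel_measurable (M1 \<Otimes>\<^sub>M M2)"
    by measurable
  have "(\<integral>\<^sup>+p. ennreal (norm (case p of (x, y) \<Rightarrow> u x * v y * k (x, y))) \<partial>(M1 \<Otimes>\<^sub>M M2))
      \<le> (\<integral>\<^sup>+(x, y). ennreal (norm (u x)) * ennreal (norm (v y)) \<partial>(M1 \<Otimes>\<^sub>M M2))"
    using mult_left_mono[OF k, of "norm (u _) * norm (v _)"]
    by (intro nn_integral_mono) (auto simp: norm_mult ennreal_mult'[symmetric] intro!: ennreal_leI)
  also have "\<dots> = (\<integral>\<^sup>+x. \<integral>\<^sup>+y. ennreal (norm (u x)) * ennreal (norm (v y)) \<partial>M2 \<partial>M1)"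
    by (subst M2.nn_integral_fst[symmetric]) auto
  also have "\<dots> = (\<integral>\<^sup>+x. ennreal (norm (u x)) \<partial>M1) * (\<integral>\<^sup>+y. ennreal (norm (v y)) \<partial>M2)"
    by (simp add: nn_integral_cmult nn_integral_multc)
  also have "\<dots> < \<infinity>"
    using u v by (simp add: integrable_iff_bounded ennreal_mult_less_top)
  finally show "(\<integral>\<^sup>+p. ennreal (norm (case p of (x, y) \<Rightarrow> u x * v y * k (x, y))) \<partial>(M1 \<Otimes>\<^sub>M M2)) < \<infinity>" .
qed

lemma Fubini_mult_kernel:
  fixes u :: "'a \<Rightarrow> complex" and v :: "'b \<Rightarrow> complex"
  assumes "integrable M1 u" "integrable M2 v"
    and "k \<in> borel_measurable (M1 \<Otimes>\<^sub>M M2)" "\<And>p. norm (k p) \<le> 1"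
  shows "(\<integral>y. \<integral>x. u x * v y * k (x, y) \<partial>M1 \<partial>M2) = (\<integral>x. \<integral>y. u x * v y * k (x, y) \<partial>M2 \<partial>M1)"
  by (rule Fubini_integral[OF integrable_mult_kernel[OF assms]])

end

lemma
  fixes f :: "'a::euclidean_space \<Rightarrow> 'b::{banach,second_countable_topology}"
  assumes "c \<noteq> 0"
  shows lborel_integral_affine: "f \<in> borel_measurable borel \<Longrightarrow>
      integral\<^sup>L lborel f = \<bar>c\<bar> ^ DIM('a) *\<^sub>R (\<integral>x. f (t + c *\<^sub>R x) \<partial>lborel)"
    and lborel_integrable_affine: "integrable lborel f \<Longrightarrow> integrable lborel (\<lambda>x. f (t + c *\<^sub>R x))"
proof -
  show "integral\<^sup>L lborel f = \<bar>c\<bar> ^ DIM('a) *\<^sub>R (\<integral>x. f (t + c *\<^sub>R x) \<partial>lborel)"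
    if [measurable]: "f \<in> borel_measurable borel"
    by (subst lborel_affine[OF assms, of t]) (simp add: integral_density integral_distr)
  assume f: "integrable lborel f"
  then have [measurable]: "f \<in> borel_measurable borel"
    by auto
  from f have "integrable lborel (\<lambda>x. \<bar>c\<bar> ^ DIM('a) *\<^sub>R f (t + c *\<^sub>R x))"
    by (subst (asm) lborel_affine[OF assms, of t]) (simp add: integrable_density integrable_distr_eq)
  from integrable_scaleR_right[OF this, of "inverse (\<bar>c\<bar> ^ DIM('a))"]
  show "integrable lborel (\<lambda>x. f (t + c *\<^sub>R x))"
    using assms by simp
qed

lemma nn_integral_lborel_translate:
  fixes f :: "'a::euclidean_space \<Rightarrow> ennreal"
  assumes [measurable]: "f \<in> borel_measurable borel"
  shows "(\<integral>\<^sup>+x. f (t + x) \<partial>lborel) = integral\<^sup>N lborel f"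
    and "(\<integral>\<^sup>+x. f (t - x) \<partial>lborel) = integral\<^sup>N lborel f"
proof -
  have "integral\<^sup>N lborel f = (\<integral>\<^sup>+x. f (t + c *\<^sub>R x) \<partial>lborel)" if "\<bar>c\<bar> = 1" for c :: real
    using that by (subst lborel_affine[of c t]) (auto simp: nn_integral_density nn_integral_distr)
  from this[of 1] this[of "-1"]
  show "(\<integral>\<^sup>+x. f (t + x) \<partial>lborel) = integral\<^sup>N lborel f" "(\<integral>\<^sup>+x. f (t - x) \<partial>lborel) = integral\<^sup>N lborel f"
    by simp_all
qed

lemma integrable_gauss_translate:
  "\<sigma> > 0 \<Longrightarrow> integrable lborel (\<lambda>x::real^'n. gauss \<sigma> (y - x))"
  using lborel_integrable_affine[of "-1" "gauss \<sigma>" y] integrable_gauss[of \<sigma>] by simp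

lemma nn_integral_gauss_translate:
  assumes "\<sigma> > 0"
  shows "(\<integral>\<^sup>+x. ennreal (gauss \<sigma> (y - x :: real^'n)) \<partial>lborel) = ennreal ((sqrt (2 * pi) / \<sigma>) ^ CARD('n))"
  using assms
  by (simp add: nn_integral_lborel_translate(2)[of "\<lambda>x. ennreal (gauss \<sigma> x)"] nn_integral_eq_integral[OF integrable_gauss]
      integral_gauss gauss_pos less_imp_le)

lemma gauss_squared: "(gauss \<sigma> x)\<^sup>2 = gauss (sqrt 2 * \<sigma>) x"
  by (simp add: gauss_def power2_eq_square exp_add[symmetric])

lemma integrable_norm_gauss_squared:
  "\<sigma> > 0 \<Longrightarrow> integrable lborel (\<lambda>x::real^'n. (norm (complex_of_real (gauss \<sigma> (y - x))))\<^sup>2)"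
  by (simp add: gauss_squared integrable_gauss_translate)

text \<open>The Gaussian makes Fubini applicable. Integrating x out first turns the left-hand side
  into the quadratic form of G for the convolution kernel \<open>k\<close>, and Schur's test bounds
  it by the total mass of \<open>k\<close>, which is (2 \<pi>)^d for every \<sigma>.\<close>

lemma Plancherel_le_gauss:
  fixes G :: "real^'n \<Rightarrow> complex"
  assumes G: "integrable lborel G" and \<sigma>: "\<sigma> > 0"
  shows "(\<integral>\<^sup>+x. ennreal ((norm (\<integral>\<xi>. G \<xi> * cis (x \<bullet> \<xi>) \<partial>lborel))\<^sup>2 * gauss \<sigma> x) \<partial>lborel)
      \<le> ennreal ((2 * pi) ^ CARD('n)) * (\<integral>\<^sup>+\<xi>. ennreal ((norm (G \<xi>))\<^sup>2) \<partial>lborel)"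
proof -
  note [measurable] = borel_measurable_integrable[OF G]
  define g where "g x = (\<integral>\<xi>. G \<xi> * cis (x \<bullet> \<xi>) \<partial>lborel)" for x
  \<comment> \<open>The Fourier transform of the damping Gaussian, by
    \<open>fourier_gauss\<close>.\<close>
  define k where "k x = (sqrt (2 * pi) / \<sigma>) ^ CARD('n) * gauss (1 / \<sigma>) x" for x :: "real^'n"
  define B where "B = (\<integral>\<xi>. norm (G \<xi>) \<partial>lborel)"
  have [measurable]: "g \<in> borel_measurable borel"
    unfolding g_def by measurable
  have [measurable]: "k \<in> borel_measurable borel"
    unfolding k_def by measurable
  have k0: "0 \<le> k x" for x
    using \<sigma> by (simp add: k_def gauss_pos less_imp_le)
  have kc: "k (x - y) = k (y - x)" for x y
    by (simp add: k_def gauss_minus_commute)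
  have gB: "norm (g x) \<le> B" for x
    unfolding g_def B_def
    by (rule order_trans[OF integral_norm_bound]) (simp add: norm_mult)
  have gi: "integrable lborel (\<lambda>x. cnj (g x) * of_real (gauss \<sigma> x))"
    by (rule Bochner_Integration.integrable_bound[OF integrable_mult_right[OF integrable_gauss[OF \<sigma>], of B]])
      (use gB order_trans[OF norm_ge_zero gB] in \<open>auto simp: norm_mult abs_mult intro!: mult_mono AE_I2\<close>)
  have ig: "integrable lborel (\<lambda>x. complex_of_real (gauss \<sigma> (x :: real^'n)))"
    using integrable_gauss[OF \<sigma>] by (simp add: complex_of_real_integrable_eq)
  have inner: "(\<integral>x. cnj (g x) * of_real (gauss \<sigma> x) * cis (x \<bullet> \<xi>) \<partial>lborel)
      = (\<integral>\<eta>. cnj (G \<eta>) * of_real (k (\<xi> - \<eta>)) \<partial>lborel)" for \<xi>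
  proof -
    have "(\<integral>x. cnj (g x) * of_real (gauss \<sigma> x) * cis (x \<bullet> \<xi>) \<partial>lborel)
      = (\<integral>x. \<integral>\<eta>. cnj (G \<eta>) * of_real (gauss \<sigma> x) * cis (x \<bullet> (\<xi> - \<eta>)) \<partial>lborel \<partial>lborel)"
    proof (intro Bochner_Integration.integral_cong refl)
      fix x
      have "cnj (g x) * of_real (gauss \<sigma> x) * cis (x \<bullet> \<xi>)
        = (\<integral>\<eta>. cnj (G \<eta> * cis (x \<bullet> \<eta>)) * (of_real (gauss \<sigma> x) * cis (x \<bullet> \<xi>)) \<partial>lborel)"
        unfolding g_def by (simp del: complex_cnj_mult)
      also have "\<dots> = (\<integral>\<eta>. cnj (G \<eta>) * of_real (gauss \<sigma> x) * cis (x \<bullet> (\<xi> - \<eta>)) \<partial>lborel)"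
        by (intro Bochner_Integration.integral_cong refl) (simp add: inner_diff_right cis_cnj divide_inverse mult_ac flip: cis_divide)
      finally show "cnj (g x) * of_real (gauss \<sigma> x) * cis (x \<bullet> \<xi>)
        = (\<integral>\<eta>. cnj (G \<eta>) * of_real (gauss \<sigma> x) * cis (x \<bullet> (\<xi> - \<eta>)) \<partial>lborel)" .
    qed
    also have "\<dots> = (\<integral>\<eta>. \<integral>x. cnj (G \<eta>) * of_real (gauss \<sigma> x) * cis (x \<bullet> (\<xi> - \<eta>)) \<partial>lborel \<partial>lborel)"
      using lborel_pair.Fubini_mult_kernel[OF _ ig, of "\<lambda>\<eta>. cnj (G \<eta>)" "\<lambda>(\<eta>, x). cis (x \<bullet> (\<xi> - \<eta>))"] G
      by (simp add: split_beta)
    also have "\<dots> = (\<integral>\<eta>. cnj (G \<eta>) * of_real (k (\<xi> - \<eta>)) \<partial>lborel)"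
    proof (intro Bochner_Integration.integral_cong refl)
      fix \<eta>
      have "(\<integral>x. cnj (G \<eta>) * of_real (gauss \<sigma> x) * cis (x \<bullet> (\<xi> - \<eta>)) \<partial>lborel)
        = cnj (G \<eta>) * (\<integral>x. cis (x \<bullet> (\<xi> - \<eta>)) * of_real (gauss \<sigma> x) \<partial>lborel)"
        by (simp only: integral_mult_right_zero[symmetric] mult_ac)
      then show "(\<integral>x. cnj (G \<eta>) * of_real (gauss \<sigma> x) * cis (x \<bullet> (\<xi> - \<eta>)) \<partial>lborel)
        = cnj (G \<eta>) * of_real (k (\<xi> - \<eta>))"
        by (simp only: fourier_gauss[OF \<sigma>] k_def)
    qed
    finally show ?thesis .
  qed
  have sq: "of_real ((norm z)\<^sup>2) = z * cnj z" for z :: complex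
    by (rule complex_norm_square)
  have "(\<integral>x. complex_of_real ((norm (g x))\<^sup>2 * gauss \<sigma> x) \<partial>lborel)
     = (\<integral>x. \<integral>\<xi>. G \<xi> * (cnj (g x) * of_real (gauss \<sigma> x)) * cis (x \<bullet> \<xi>) \<partial>lborel \<partial>lborel)"
  proof (intro Bochner_Integration.integral_cong refl)
    fix x
    have "complex_of_real ((norm (g x))\<^sup>2 * gauss \<sigma> x) = g x * (cnj (g x) * of_real (gauss \<sigma> x))"
      by (simp only: of_real_mult sq mult.assoc)
    also have "\<dots> = (\<integral>\<xi>. G \<xi> * cis (x \<bullet> \<xi>) * (cnj (g x) * of_real (gauss \<sigma> x)) \<partial>lborel)"
      by (simp add: g_def)
    finally show "complex_of_real ((norm (g x))\<^sup>2 * gauss \<sigma> x)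
       = (\<integral>\<xi>. G \<xi> * (cnj (g x) * of_real (gauss \<sigma> x)) * cis (x \<bullet> \<xi>) \<partial>lborel)"
      by (simp only: mult_ac)
  qed
  also have "\<dots> = (\<integral>\<xi>. \<integral>x. G \<xi> * (cnj (g x) * of_real (gauss \<sigma> x)) * cis (x \<bullet> \<xi>) \<partial>lborel \<partial>lborel)"
    using lborel_pair.Fubini_mult_kernel[OF G gi, of "\<lambda>(\<xi>, x). cis (x \<bullet> \<xi>)"] by (simp add: split_beta)
  also have "\<dots> = (\<integral>\<xi>. G \<xi> * (\<integral>\<eta>. cnj (G \<eta>) * of_real (k (\<xi> - \<eta>)) \<partial>lborel) \<partial>lborel)"
    by (simp only: mult.assoc integral_mult_right_zero inner[unfolded mult.assoc])
  finally have "ennreal (norm (\<integral>x. complex_of_real ((norm (g x))\<^sup>2 * gauss \<sigma> x) \<partial>lborel))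
     = ennreal (norm (\<integral>\<xi>. G \<xi> * (\<integral>\<eta>. cnj (G \<eta>) * of_real (k (\<xi> - \<eta>)) \<partial>lborel) \<partial>lborel))"
    by simp
  \<comment> \<open>If the integrand fails to be integrable, its Bochner integral is 0 and the bound
    is trivial; hence the case distinction.\<close>
  also have "\<dots> \<le> (\<integral>\<^sup>+\<xi>. norm (G \<xi> * (\<integral>\<eta>. cnj (G \<eta>) * of_real (k (\<xi> - \<eta>)) \<partial>lborel)) \<partial>lborel)"
    by (cases "integrable lborel (\<lambda>\<xi>. G \<xi> * (\<integral>\<eta>. cnj (G \<eta>) * of_real (k (\<xi> - \<eta>)) \<partial>lborel))")
      (auto simp: not_integrable_integral_eq intro!: integral_norm_bound_ennreal)
  also have "\<dots> \<le> (\<integral>\<^sup>+\<xi>. \<integral>\<^sup>+\<eta>. ennreal (norm (G \<xi>)) * (norm (G \<eta>) * k (\<xi> - \<eta>)) \<partial>lborel \<partial>lborel)"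
  proof (rule nn_integral_mono)
    fix \<xi>
    have "ennreal (norm (\<integral>\<eta>. cnj (G \<eta>) * of_real (k (\<xi> - \<eta>)) \<partial>lborel))
        \<le> (\<integral>\<^sup>+\<eta>. norm (cnj (G \<eta>) * of_real (k (\<xi> - \<eta>))) \<partial>lborel)"
      by (cases "integrable lborel (\<lambda>\<eta>. cnj (G \<eta>) * of_real (k (\<xi> - \<eta>)))")
        (auto simp: not_integrable_integral_eq intro!: integral_norm_bound_ennreal)
    also have "\<dots> = (\<integral>\<^sup>+\<eta>. norm (G \<eta>) * k (\<xi> - \<eta>) \<partial>lborel)"
      using k0 by (simp add: norm_mult)
    finally have *: "ennreal (norm (\<integral>\<eta>. cnj (G \<eta>) * of_real (k (\<xi> - \<eta>)) \<partial>lborel)) \<le> \<dots>" .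
    have "ennreal (norm (G \<xi> * (\<integral>\<eta>. cnj (G \<eta>) * of_real (k (\<xi> - \<eta>)) \<partial>lborel)))
        = ennreal (norm (G \<xi>)) * ennreal (norm (\<integral>\<eta>. cnj (G \<eta>) * of_real (k (\<xi> - \<eta>)) \<partial>lborel))"
      by (simp add: norm_mult ennreal_mult)
    also have "\<dots> \<le> ennreal (norm (G \<xi>)) * (\<integral>\<^sup>+\<eta>. norm (G \<eta>) * k (\<xi> - \<eta>) \<partial>lborel)"
      by (intro mult_left_mono *) auto
    also have "\<dots> = (\<integral>\<^sup>+\<eta>. ennreal (norm (G \<xi>)) * (norm (G \<eta>) * k (\<xi> - \<eta>)) \<partial>lborel)"
      by (subst nn_integral_cmult) auto
    finally show "ennreal (norm (G \<xi> * (\<integral>\<eta>. cnj (G \<eta>) * of_real (k (\<xi> - \<eta>)) \<partial>lborel))) \<le> \<dots>" .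
  qed
  \<comment> \<open>Schur's test: the arithmetic-geometric mean inequality separates the two
    factors, and the symmetry of \<open>k\<close> makes the two halves equal.\<close>
  also have "\<dots> \<le> (\<integral>\<^sup>+\<xi>. \<integral>\<^sup>+\<eta>. ennreal ((norm (G \<xi>))\<^sup>2 / 2) * k (\<xi> - \<eta>) + ennreal ((norm (G \<eta>))\<^sup>2 / 2) * k (\<xi> - \<eta>) \<partial>lborel \<partial>lborel)"
  proof (intro nn_integral_mono)
    fix \<xi> \<eta>
    have "norm (G \<xi>) * norm (G \<eta>) \<le> (norm (G \<xi>))\<^sup>2 / 2 + (norm (G \<eta>))\<^sup>2 / 2"
      using sum_squares_bound[of "norm (G \<xi>)" "norm (G \<eta>)"] by simp
    from mult_right_mono[OF this k0[of "\<xi> - \<eta>"]]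
    show "ennreal (norm (G \<xi>)) * (norm (G \<eta>) * k (\<xi> - \<eta>)) \<le>
        ennreal ((norm (G \<xi>))\<^sup>2 / 2) * k (\<xi> - \<eta>) + ennreal ((norm (G \<eta>))\<^sup>2 / 2) * k (\<xi> - \<eta>)"
      using k0 by (simp add: ennreal_mult'[symmetric] ennreal_plus[symmetric] algebra_simps del: ennreal_plus)
  qed
  also have "\<dots> = (\<integral>\<^sup>+\<xi>. \<integral>\<^sup>+\<eta>. ennreal ((norm (G \<xi>))\<^sup>2 / 2) * k (\<xi> - \<eta>) \<partial>lborel \<partial>lborel)
      + (\<integral>\<^sup>+\<xi>. \<integral>\<^sup>+\<eta>. ennreal ((norm (G \<eta>))\<^sup>2 / 2) * k (\<xi> - \<eta>) \<partial>lborel \<partial>lborel)"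
    by (subst nn_integral_add[symmetric]) (auto intro!: nn_integral_cong nn_integral_add)
  also have "(\<integral>\<^sup>+\<xi>. \<integral>\<^sup>+\<eta>. ennreal ((norm (G \<eta>))\<^sup>2 / 2) * k (\<xi> - \<eta>) \<partial>lborel \<partial>lborel)
     = (\<integral>\<^sup>+\<eta>. \<integral>\<^sup>+\<xi>. ennreal ((norm (G \<eta>))\<^sup>2 / 2) * k (\<eta> - \<xi>) \<partial>lborel \<partial>lborel)"
    by (subst lborel_pair.Fubini') (auto simp: kc)
  also have "(\<integral>\<^sup>+\<xi>. \<integral>\<^sup>+\<eta>. ennreal ((norm (G \<xi>))\<^sup>2 / 2) * k (\<xi> - \<eta>) \<partial>lborel \<partial>lborel)
      + (\<integral>\<^sup>+\<eta>. \<integral>\<^sup>+\<xi>. ennreal ((norm (G \<eta>))\<^sup>2 / 2) * k (\<eta> - \<xi>) \<partial>lborel \<partial>lborel) =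
      (\<integral>\<^sup>+\<xi>. ennreal ((norm (G \<xi>))\<^sup>2 / 2) * ennreal ((2 * pi) ^ CARD('n)) \<partial>lborel)
      + (\<integral>\<^sup>+\<xi>. ennreal ((norm (G \<xi>))\<^sup>2 / 2) * ennreal ((2 * pi) ^ CARD('n)) \<partial>lborel)"
  proof -
    \<comment> \<open>The powers of \<sigma> in \<open>k\<close> and in the integral of
      \<open>gauss (1 / \<sigma>)\<close> cancel.\<close>
    have "(\<integral>\<^sup>+\<eta>. k (\<xi> - \<eta>) \<partial>lborel) = ennreal ((2 * pi) ^ CARD('n))" for \<xi>
    proof -
      have "(\<integral>\<^sup>+\<eta>. k (\<xi> - \<eta>) \<partial>lborel)
        = ennreal ((sqrt (2 * pi) / \<sigma>) ^ CARD('n)) * (\<integral>\<^sup>+\<eta>. gauss (1 / \<sigma>) (\<xi> - \<eta>) \<partial>lborel)"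
        unfolding k_def using \<sigma> by (subst nn_integral_cmult[symmetric]) (auto simp: ennreal_mult gauss_pos less_imp_le)
      also have "\<dots> = ennreal ((sqrt (2 * pi) / \<sigma>) ^ CARD('n) * (sqrt (2 * pi) / (1 / \<sigma>)) ^ CARD('n))"
        using \<sigma> by (subst nn_integral_gauss_translate) (auto simp: ennreal_mult)
      also have "\<dots> = ennreal ((2 * pi) ^ CARD('n))"
        using \<sigma> unfolding power_mult_distrib[symmetric] by simp
      finally show ?thesis .
    qed
    then show ?thesis
      by (subst (1 2) nn_integral_cmult) auto
  qed
  also have "\<dots> = (\<integral>\<^sup>+\<xi>. ennreal ((2 * pi) ^ CARD('n)) * ennreal ((norm (G \<xi>))\<^sup>2) \<partial>lborel)"
    by (subst nn_integral_add[symmetric])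
      (auto intro!: nn_integral_cong simp: ennreal_mult'[symmetric] ennreal_plus[symmetric] simp del: ennreal_plus)
  also have "\<dots> = ennreal ((2 * pi) ^ CARD('n)) * (\<integral>\<^sup>+\<xi>. ennreal ((norm (G \<xi>))\<^sup>2) \<partial>lborel)"
    by (rule nn_integral_cmult) auto
  finally have main: "ennreal (norm (\<integral>x. complex_of_real ((norm (g x))\<^sup>2 * gauss \<sigma> x) \<partial>lborel)) \<le> \<dots>" .
  have int: "integrable lborel (\<lambda>x. (norm (g x))\<^sup>2 * gauss \<sigma> x)"
    by (rule Bochner_Integration.integrable_bound[OF integrable_mult_right[OF integrable_gauss[OF \<sigma>], of "B\<^sup>2"]])
      (auto simp: norm_mult abs_mult intro!: mult_mono AE_I2 power_mono gB)
  have "(\<integral>\<^sup>+x. ennreal ((norm (g x))\<^sup>2 * gauss \<sigma> x) \<partial>lborel) = ennreal (\<integral>x. (norm (g x))\<^sup>2 * gauss \<sigma> x \<partial>lborel)"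
    by (rule nn_integral_eq_integral[OF int]) (auto simp: gauss_pos less_imp_le)
  also have "\<dots> = ennreal (norm (\<integral>x. complex_of_real ((norm (g x))\<^sup>2 * gauss \<sigma> x) \<partial>lborel))"
    by (simp only: integral_complex_of_real norm_of_real)
      (simp add: abs_of_nonneg integral_nonneg_AE gauss_pos less_imp_le)
  finally show ?thesis
    using main by (simp add: g_def)
qed

text \<open>Fatou's lemma as the damping parameter 1 / (n + 1) tends to 0. An error bound asks for
  this inequality alone, and it holds for integrable G even if the right-hand side is
  infinite.\<close>

lemma nn_integral_Plancherel_le:
  fixes G :: "real^'n \<Rightarrow> complex"
  assumes G: "integrable lborel G"
  shows "(\<integral>\<^sup>+x. ennreal ((norm (\<integral>\<xi>. G \<xi> * cis (x \<bullet> \<xi>) \<partial>lborel))\<^sup>2) \<partial>lborel)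
      \<le> ennreal ((2 * pi) ^ CARD('n)) * (\<integral>\<^sup>+\<xi>. ennreal ((norm (G \<xi>))\<^sup>2) \<partial>lborel)"
proof -
  note [measurable] = borel_measurable_integrable[OF G]
  define g where "g x = (\<integral>\<xi>. G \<xi> * cis (x \<bullet> \<xi>) \<partial>lborel)" for x
  have [measurable]: "g \<in> borel_measurable borel"
    unfolding g_def by measurable
  define h where "h n x = ennreal ((norm (g x))\<^sup>2 * gauss (1 / Suc n) x)" for n and x :: "real^'n"
  have lim: "(\<lambda>n. h n x) \<longlonglongrightarrow> ennreal ((norm (g x))\<^sup>2)" for x
  proof -
    have "(\<lambda>n. - ((1 / real (Suc n))\<^sup>2 * (norm x)\<^sup>2 / 2)) \<longlonglongrightarrow> - (0\<^sup>2 * (norm x)\<^sup>2 / 2)"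
      by (intro tendsto_intros LIMSEQ_Suc[OF lim_1_over_n]) auto
    then have "(\<lambda>n. (norm (g x))\<^sup>2 * gauss (1 / Suc n) x) \<longlonglongrightarrow> (norm (g x))\<^sup>2 * exp (- (0\<^sup>2 * (norm x)\<^sup>2 / 2))"
      unfolding gauss_def by (intro tendsto_mult tendsto_const tendsto_exp)
    then show ?thesis
      unfolding h_def by (intro tendsto_ennrealI) simp
  qed
  have "(\<integral>\<^sup>+x. ennreal ((norm (g x))\<^sup>2) \<partial>lborel) = (\<integral>\<^sup>+x. liminf (\<lambda>n. h n x) \<partial>lborel)"
    using lim by (intro nn_integral_cong lim_imp_Liminf[symmetric]) auto
  also have "\<dots> \<le> liminf (\<lambda>n. \<integral>\<^sup>+x. h n x \<partial>lborel)"
    by (rule nn_integral_liminf) (simp add: h_def)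
  also have "\<dots> \<le> limsup (\<lambda>n. \<integral>\<^sup>+x. h n x \<partial>lborel)"
    by (rule Liminf_le_Limsup) simp
  also have "\<dots> \<le> ennreal ((2 * pi) ^ CARD('n)) * (\<integral>\<^sup>+\<xi>. ennreal ((norm (G \<xi>))\<^sup>2) \<partial>lborel)"
    unfolding h_def g_def using Plancherel_le_gauss[OF G]
    by (intro Limsup_bounded always_eventually) auto
  finally show ?thesis
    unfolding g_def .
qed

section \<open>Fourier inversion\<close>

lemma in_L2_iff_nn_integral:
  "in_L2 g \<longleftrightarrow> g \<in> borel_measurable borel \<and> (\<integral>\<^sup>+x. ennreal ((norm (g x))\<^sup>2) \<partial>lborel) < \<infinity>"
  unfolding in_L2_def by (auto simp: integrable_iff_bounded)

text \<open>Convergence in mean gives weak convergence: by Cauchy-Schwarz the difference of the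
  pairings is at most \<open>L2_norm (D R)\<close> times the norm of w. The limit in the definition
  of \<open>is_fourier_L2\<close> enters the proof only here.\<close>

lemma tendsto_fourier_cutoff:
  fixes f F w :: "real^'n \<Rightarrow> complex"
  assumes F: "is_fourier_L2 f F" and w: "in_L2 w"
  shows "((\<lambda>R. \<integral>\<xi>. fourier_L1 (\<lambda>x. indicator (cball 0 R) x *\<^sub>R f x) \<xi> * w \<xi> \<partial>lborel)
          \<longlongrightarrow> (\<integral>\<xi>. F \<xi> * w \<xi> \<partial>lborel)) at_top"
proof -
  define D where "D R \<xi> = fourier_L1 (\<lambda>x. indicator (cball 0 R) x *\<^sub>R f x) \<xi> - F \<xi>" for R \<xi>
  have "in_L2 F" and lim: "((\<lambda>R. L2_norm (D R)) \<longlongrightarrow> 0) at_top"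
    using F unfolding is_fourier_L2_def D_def[abs_def] by auto
  \<comment> \<open>\<open>L2_norm\<close> is infinite off L2, so once it is below 1 the difference
    lies in L2; for small R nothing is known.\<close>
  have ev: "\<forall>\<^sub>F R in at_top. in_L2 (D R)"
    using order_tendstoD(2)[OF lim, of 1] by (auto elim!: eventually_mono simp: L2_norm_def split: if_splits)
  have wF: "integrable lborel (\<lambda>\<xi>. F \<xi> * w \<xi>)"
    using \<open>in_L2 F\<close> w by (intro integrable_mult_L2) (auto simp: in_L2_def)
  define C where "C = sqrt (\<integral>x. (norm (w x))\<^sup>2 \<partial>lborel)"
  have "((\<lambda>R. enn2real (L2_norm (D R)) * C) \<longlongrightarrow> 0) at_top"
    using tendsto_enn2real[of "\<lambda>R. L2_norm (D R)" 0 at_top] lim by (intro tendsto_mult_left_zero) auto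
  moreover have "\<forall>\<^sub>F R in at_top. norm ((\<integral>\<xi>. fourier_L1 (\<lambda>x. indicator (cball 0 R) x *\<^sub>R f x) \<xi> * w \<xi> \<partial>lborel)
      - (\<integral>\<xi>. F \<xi> * w \<xi> \<partial>lborel)) \<le> enn2real (L2_norm (D R)) * C"
      using ev
    proof eventually_elim
      case (elim R)
      have Dw: "integrable lborel (\<lambda>\<xi>. D R \<xi> * w \<xi>)"
        using elim w by (intro integrable_mult_L2) (auto simp: in_L2_def)
      have "(\<integral>\<xi>. fourier_L1 (\<lambda>x. indicator (cball 0 R) x *\<^sub>R f x) \<xi> * w \<xi> \<partial>lborel)
        = (\<integral>\<xi>. D R \<xi> * w \<xi> + F \<xi> * w \<xi> \<partial>lborel)"
        by (simp add: D_def algebra_simps)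
      also have "\<dots> = (\<integral>\<xi>. D R \<xi> * w \<xi> \<partial>lborel) + (\<integral>\<xi>. F \<xi> * w \<xi> \<partial>lborel)"
        by (rule Bochner_Integration.integral_add[OF Dw wF])
      finally have "(\<integral>\<xi>. fourier_L1 (\<lambda>x. indicator (cball 0 R) x *\<^sub>R f x) \<xi> * w \<xi> \<partial>lborel)
        - (\<integral>\<xi>. F \<xi> * w \<xi> \<partial>lborel) = (\<integral>\<xi>. D R \<xi> * w \<xi> \<partial>lborel)"
        by simp
      also have "norm \<dots> \<le> sqrt (\<integral>x. (norm (D R x))\<^sup>2 \<partial>lborel) * C"
        unfolding C_def using elim w by (intro norm_integral_mult_le) (auto simp: in_L2_def)
      also have "sqrt (\<integral>x. (norm (D R x))\<^sup>2 \<partial>lborel) = enn2real (L2_norm (D R))"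
        using elim by (simp add: L2_norm_def)
      finally show ?case .
    qed
  ultimately have "((\<lambda>R. (\<integral>\<xi>. fourier_L1 (\<lambda>x. indicator (cball 0 R) x *\<^sub>R f x) \<xi> * w \<xi> \<partial>lborel)
      - (\<integral>\<xi>. F \<xi> * w \<xi> \<partial>lborel)) \<longlongrightarrow> 0) at_top"
    by (rule Lim_null_comparison[rotated])
  then show ?thesis
    by (simp add: LIM_zero_iff)
qed

text \<open>The multiplication formula, by which the transform may be moved from one factor of a
  pairing to the other, for a modulated Gaussian. For the cut-offs \<open>fR\<close> it is Fubini;
  both sides then converge as R grows.\<close>

lemma fourier_gauss_duality:
  fixes f F :: "real^'n \<Rightarrow> complex"
  assumes F: "is_fourier_L2 f F" and \<sigma>: "\<sigma> > 0"
  shows "(\<integral>\<xi>. F \<xi> * (of_real (gauss \<sigma> \<xi>) * cis (y \<bullet> \<xi>)) \<partial>lborel)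
    = of_real ((sqrt (2 * pi) / \<sigma>) ^ CARD('n)) * (\<integral>x. f x * of_real (gauss (1 / \<sigma>) (y - x)) \<partial>lborel)"
proof -
  define C where "C = complex_of_real ((sqrt (2 * pi) / \<sigma>) ^ CARD('n))"
  define fR where "fR R x = indicator (cball 0 R) x *\<^sub>R f x" for R x
  have [measurable]: "cball (0::real^'n) R \<in> sets borel" for R
    by simp
  have L2f: "in_L2 f" "in_L2 F"
    using F by (auto simp: is_fourier_L2_def)
  have [measurable]: "f \<in> borel_measurable borel"
    using L2f by (simp add: in_L2_def)
  have w: "in_L2 (\<lambda>\<xi>::real^'n. of_real (gauss \<sigma> \<xi>) * cis (y \<bullet> \<xi>))"
    using integrable_norm_gauss_squared[OF \<sigma>, of "0::real^'n"]
    by (auto simp: in_L2_def norm_mult gauss_minus)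
  have g: "in_L2 (\<lambda>x. complex_of_real (gauss (1 / \<sigma>) (y - x)))"
    using integrable_norm_gauss_squared[of "1 / \<sigma>" y] \<sigma> by (auto simp: in_L2_def)
  have fg: "integrable lborel (\<lambda>x. f x * complex_of_real (gauss (1 / \<sigma>) (y - x)))"
    using L2f g by (intro integrable_mult_L2) (auto simp: in_L2_def)
  have ig: "integrable lborel (\<lambda>x. complex_of_real (gauss \<sigma> (x :: real^'n)))"
    using integrable_gauss[OF \<sigma>] by (simp add: complex_of_real_integrable_eq)
  have eq: "(\<integral>\<xi>. fourier_L1 (fR R) \<xi> * (of_real (gauss \<sigma> \<xi>) * cis (y \<bullet> \<xi>)) \<partial>lborel)
      = C * (\<integral>x. fR R x * of_real (gauss (1 / \<sigma>) (y - x)) \<partial>lborel)" for R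
  proof -
    \<comment> \<open>The indicator of a ball is in L2, so the cut-off of f is a product of two L2
      functions and hence integrable.\<close>
    have ind: "in_L2 (\<lambda>x. indicator (cball (0::real^'n) R) x :: complex)"
      unfolding in_L2_iff_nn_integral
    proof
      have "(\<integral>\<^sup>+x. ennreal ((norm (indicator (cball 0 R :: (real^'n) set) x :: complex))\<^sup>2) \<partial>lborel) = (\<integral>\<^sup>+x. indicator (cball 0 R :: (real^'n) set) x \<partial>lborel)"
        by (intro nn_integral_cong) (auto split: split_indicator)
      then show "(\<integral>\<^sup>+x. ennreal ((norm (indicator (cball 0 R :: (real^'n) set) x :: complex))\<^sup>2) \<partial>lborel) < \<infinity>"
        using emeasure_bounded_finite[of "cball (0::real^'n) R"] by simp
    qed simp
    have "fR R = (\<lambda>x. indicator (cball 0 R) x * f x)"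
      by (auto simp: fR_def fun_eq_iff split: split_indicator)
    with ind L2f(1) have fRi: "integrable lborel (fR R)"
      by (auto simp: in_L2_def simp del: mem_cball intro!: integrable_mult_L2)
    have "(\<integral>\<xi>. fourier_L1 (fR R) \<xi> * (of_real (gauss \<sigma> \<xi>) * cis (y \<bullet> \<xi>)) \<partial>lborel)
       = (\<integral>\<xi>. \<integral>x. fR R x * of_real (gauss \<sigma> \<xi>) * cis (\<xi> \<bullet> (y - x)) \<partial>lborel \<partial>lborel)"
    proof (intro Bochner_Integration.integral_cong refl)
      fix \<xi>
      have "fourier_L1 (fR R) \<xi> * (of_real (gauss \<sigma> \<xi>) * cis (y \<bullet> \<xi>)) =
        (\<integral>x. fR R x * cis (- (\<xi> \<bullet> x)) * (of_real (gauss \<sigma> \<xi>) * cis (y \<bullet> \<xi>)) \<partial>lborel)"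
        by (simp only: fourier_L1_def exp_minus_i_eq_cis integral_mult_left_zero)
      then show "fourier_L1 (fR R) \<xi> * (of_real (gauss \<sigma> \<xi>) * cis (y \<bullet> \<xi>)) =
         (\<integral>x. fR R x * of_real (gauss \<sigma> \<xi>) * cis (\<xi> \<bullet> (y - x)) \<partial>lborel)"
        by (simp add: inner_diff_right divide_inverse mult_ac inner_commute flip: cis_divide)
    qed
    also have "\<dots> = (\<integral>x. \<integral>\<xi>. fR R x * of_real (gauss \<sigma> \<xi>) * cis (\<xi> \<bullet> (y - x)) \<partial>lborel \<partial>lborel)"
      using lborel_pair.Fubini_mult_kernel[OF fRi ig, of "\<lambda>(x, \<xi>). cis (\<xi> \<bullet> (y - x))"] by (simp add: split_beta)
    also have "\<dots> = (\<integral>x. C * (fR R x * of_real (gauss (1 / \<sigma>) (y - x))) \<partial>lborel)"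
    proof (intro Bochner_Integration.integral_cong refl)
      fix x
      have "(\<integral>\<xi>. fR R x * of_real (gauss \<sigma> \<xi>) * cis (\<xi> \<bullet> (y - x)) \<partial>lborel)
        = fR R x * (\<integral>\<xi>. cis (\<xi> \<bullet> (y - x)) * of_real (gauss \<sigma> \<xi>) \<partial>lborel)"
        by (simp only: integral_mult_right_zero[symmetric] mult_ac)
      then show "(\<integral>\<xi>. fR R x * of_real (gauss \<sigma> \<xi>) * cis (\<xi> \<bullet> (y - x)) \<partial>lborel)
        = C * (fR R x * of_real (gauss (1 / \<sigma>) (y - x)))"
        unfolding fourier_gauss[OF \<sigma>] C_def by (simp only: of_real_mult mult_ac)
    qed
    finally show ?thesis
      by simp
  qed
  have "((\<lambda>R. \<integral>x. fR R x * of_real (gauss (1 / \<sigma>) (y - x)) \<partial>lborel)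
      \<longlongrightarrow> (\<integral>x. f x * of_real (gauss (1 / \<sigma>) (y - x)) \<partial>lborel)) at_top"
  proof (rule integral_dominated_convergence_at_top[where w="\<lambda>x. norm (f x * complex_of_real (gauss (1 / \<sigma>) (y - x)))"])
    show "AE x in lborel. ((\<lambda>R. fR R x * of_real (gauss (1 / \<sigma>) (y - x)))
       \<longlongrightarrow> f x * of_real (gauss (1 / \<sigma>) (y - x))) at_top"
    proof (rule AE_I2, rule tendsto_eventually)
      fix x :: "real^'n"
      show "\<forall>\<^sub>F R in at_top. fR R x * of_real (gauss (1 / \<sigma>) (y - x)) = f x * of_real (gauss (1 / \<sigma>) (y - x))"
        using eventually_ge_at_top[of "norm x"] by eventually_elim (simp add: fR_def)
    qed
  qed (use fg in \<open>auto simp: fR_def intro!: always_eventually AE_I2 split: split_indicator\<close>)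
  then have "((\<lambda>R. \<integral>\<xi>. fourier_L1 (fR R) \<xi> * (of_real (gauss \<sigma> \<xi>) * cis (y \<bullet> \<xi>)) \<partial>lborel)
      \<longlongrightarrow> C * (\<integral>x. f x * of_real (gauss (1 / \<sigma>) (y - x)) \<partial>lborel)) at_top"
    unfolding eq by (intro tendsto_intros)
  from tendsto_unique[OF _ this tendsto_fourier_cutoff[OF F w, folded fR_def]]
  show ?thesis
    unfolding C_def by simp
qed

text \<open>One term of the exponential series. It absorbs polynomial factors: the Gaussian
  normalisation in the next lemma, and later the power in the ratio of two profiles.\<close>

lemma power_le_fact_exp:
  fixes x :: real
  assumes "0 \<le> x"
  shows "x ^ n \<le> fact n * exp x"
proof -
  have "x ^ n /\<^sub>R fact n \<le> exp x"
    unfolding exp_def using sum_le_suminf[OF summable_exp_generic[of x], of "{n}"] assms by simp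
  then show ?thesis
    by (simp add: field_simps)
qed

text \<open>The tail is controlled by splitting the Gaussian into two equal factors; one of them is at most
  \<open>exp (- 1 / (4 * \<sigma>\<^sup>2))\<close> at distance at least 1 from the centre and beats the normalisation.\<close>
lemma gauss_approximate_identity:
  fixes f :: "real^'n \<Rightarrow> complex"
  assumes f: "in_L2 f" and cont: "continuous_on UNIV f"
  shows "(\<lambda>n. of_real ((sqrt (2 * pi) * Suc n) ^ CARD('n)) * (\<integral>x. f x * of_real (gauss (Suc n) (y - x)) \<partial>lborel))
      \<longlonglongrightarrow> of_real ((2 * pi) ^ CARD('n)) * f y"
proof -
  let ?d = "CARD('n)"
  have [measurable]: "f \<in> borel_measurable borel"
    using f by (simp add: in_L2_def)
  \<comment> \<open>Continuity bounds f on compact sets only. The near part \<open>f1\<close> is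
    therefore bounded, while the far part \<open>f2\<close> is controlled through L2.\<close>
  define B where "B = cball y 1"
  have [measurable]: "B \<in> sets borel"
    by (simp add: B_def)
  define f1 where "f1 x = (if x \<in> B then f x else 0)" for x
  define f2 where "f2 x = (if x \<in> B then 0 else f x)" for x
  have [measurable]: "f1 \<in> borel_measurable borel" "f2 \<in> borel_measurable borel"
    unfolding f1_def f2_def by measurable
  have f12: "f x = f1 x + f2 x" for x
    by (simp add: f1_def f2_def)
  obtain K where K: "norm (f1 x) \<le> K" for x
  proof -
    have "compact (f ` B)"
      unfolding B_def by (intro compact_continuous_image continuous_on_subset[OF cont]) auto
    then have "bounded (f ` B)"
      by (rule compact_imp_bounded)
    then obtain K where K: "\<And>z. z \<in> f ` B \<Longrightarrow> norm z \<le> K"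
      by (auto simp: bounded_iff)
    have "norm (f1 x) \<le> max K 0" for x
      using K[of "f x"] by (cases "x \<in> B") (auto simp: f1_def le_max_iff_disj)
    then show ?thesis by (rule that)
  qed
  have 1: "(\<lambda>n. of_real ((sqrt (2 * pi) * Suc n) ^ ?d) * (\<integral>x. f1 x * of_real (gauss (Suc n) (y - x)) \<partial>lborel))
      \<longlonglongrightarrow> of_real ((2 * pi) ^ ?d) * f y"
  proof -
    \<comment> \<open>The substitution x \<mapsto> y + x / (n + 1) absorbs the growing factor and
      leaves a fixed Gaussian.\<close>
    have eq: "of_real ((sqrt (2 * pi) * Suc n) ^ ?d) * (\<integral>x. f1 x * of_real (gauss (Suc n) (y - x)) \<partial>lborel)
       = of_real (sqrt (2 * pi) ^ ?d) * (\<integral>x. f1 (y + (1 / Suc n) *\<^sub>R x) * of_real (gauss 1 x) \<partial>lborel)" for n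
      by (subst lborel_integral_affine[of "1 / Suc n" _ y])
        (auto simp: gauss_minus gauss_scaleR scaleR_conv_of_real[where 'a=complex] power_mult_distrib power_divide simp del: of_nat_Suc)
    have "(\<lambda>n. \<integral>x. f1 (y + (1 / Suc n) *\<^sub>R x) * of_real (gauss 1 x) \<partial>lborel)
       \<longlonglongrightarrow> (\<integral>x. f y * of_real (gauss 1 (x::real^'n)) \<partial>lborel)"
    proof (rule integral_dominated_convergence[where w="\<lambda>x. K * gauss 1 x"])
      show "integrable lborel (\<lambda>x::real^'n. K * gauss 1 x)"
        by (intro integrable_mult_right integrable_gauss) simp
      show "AE x in lborel. norm (f1 (y + (1 / Suc n) *\<^sub>R x) * of_real (gauss 1 x)) \<le> K * gauss 1 x" for n
        using K by (auto intro!: AE_I2 mult_mono simp: norm_mult gauss_pos less_imp_le order_trans[OF norm_ge_zero K])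
      show "AE x in lborel. (\<lambda>n. f1 (y + (1 / Suc n) *\<^sub>R x) * of_real (gauss 1 x)) \<longlonglongrightarrow> f y * of_real (gauss 1 x)"
      proof (rule AE_I2)
        fix x :: "real^'n"
        have lim: "(\<lambda>n. y + (1 / real (Suc n)) *\<^sub>R x) \<longlonglongrightarrow> y"
        proof -
          have "(\<lambda>n. y + (1 / real (Suc n)) *\<^sub>R x) \<longlonglongrightarrow> y + 0 *\<^sub>R x"
            by (intro tendsto_intros LIMSEQ_Suc[OF lim_1_over_n])
          then show ?thesis by simp
        qed
        have ev: "\<forall>\<^sub>F n in sequentially. y + (1 / real (Suc n)) *\<^sub>R x \<in> ball y 1"
          using lim by (rule topological_tendstoD) auto
        have "(\<lambda>n. f (y + (1 / Suc n) *\<^sub>R x)) \<longlonglongrightarrow> f y"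
          using continuous_on_tendsto_compose[OF cont lim] by auto
        then have "(\<lambda>n. f1 (y + (1 / Suc n) *\<^sub>R x)) \<longlonglongrightarrow> f y"
        proof (rule Lim_transform_eventually)
          show "\<forall>\<^sub>F n in sequentially. f (y + (1 / Suc n) *\<^sub>R x) = f1 (y + (1 / Suc n) *\<^sub>R x)"
            using ev by eventually_elim (auto simp: f1_def B_def)
        qed
        then show "(\<lambda>n. f1 (y + (1 / Suc n) *\<^sub>R x) * of_real (gauss 1 x)) \<longlonglongrightarrow> f y * of_real (gauss 1 x)"
          by (intro tendsto_intros)
      qed
    qed auto
    also have "(\<integral>x. f y * of_real (gauss 1 (x::real^'n)) \<partial>lborel) = f y * of_real (sqrt (2 * pi) ^ ?d)"
      by (simp add: integral_gauss)
    finally have "(\<lambda>n. of_real (sqrt (2 * pi) ^ ?d) * (\<integral>x. f1 (y + (1 / Suc n) *\<^sub>R x) * of_real (gauss 1 x) \<partial>lborel))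
       \<longlonglongrightarrow> of_real (sqrt (2 * pi) ^ ?d) * (f y * of_real (sqrt (2 * pi) ^ ?d))"
      by (intro tendsto_intros)
    moreover have "of_real (sqrt (2 * pi) ^ ?d) * (f y * of_real (sqrt (2 * pi) ^ ?d)) = of_real ((2 * pi) ^ ?d) * f y"
    proof -
      have "of_real (sqrt (2 * pi) ^ ?d) * (f y * of_real (sqrt (2 * pi) ^ ?d))
         = of_real ((sqrt (2 * pi) * sqrt (2 * pi)) ^ ?d) * f y"
        by (simp only: power_mult_distrib of_real_mult mult_ac)
      then show ?thesis by simp
    qed
    ultimately show ?thesis
      unfolding eq by (simp only:)
  qed
  have 2: "(\<lambda>n. of_real ((sqrt (2 * pi) * Suc n) ^ ?d) * (\<integral>x. f2 x * of_real (gauss (Suc n) (y - x)) \<partial>lborel)) \<longlonglongrightarrow> 0"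
  proof -
    \<comment> \<open>The value is dictated by s^2 / 2 = 1 / 4: one half of the exponent m^2 r / 2
      is at least m^2 / 4 because r \<ge> 1, the other at least r / 4 because m \<ge> 1.\<close>
    define s where "s = 1 / sqrt (2::real)"
    have s: "s > 0" "s\<^sup>2 = 1 / 2"
      by (auto simp: s_def power_divide)
    have fs: "integrable lborel (\<lambda>x. f x * of_real (gauss s (y - x)))"
      using f integrable_norm_gauss_squared[of s y] s by (intro integrable_mult_L2) (auto simp: in_L2_def)
    define I where "I = (\<integral>x. norm (f x * of_real (gauss s (y - x))) \<partial>lborel)"
    have bound: "norm (f2 x * of_real (gauss (Suc n) (y - x))) \<le> exp (- ((Suc n)\<^sup>2 / 4)) * norm (f x * of_real (gauss s (y - x)))" for n x
    proof (cases "x \<in> B")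
      case False
      define m where "m = real (Suc n)"
      define r where "r = (norm (y - x))\<^sup>2"
      have "1 \<le> m\<^sup>2"
        by (simp add: m_def)
      have "1 < norm (y - x)"
        using False by (simp add: B_def dist_norm)
      then have "1 \<le> r"
        by (simp add: r_def)
      have "m\<^sup>2 * 1 \<le> m\<^sup>2 * r" "1 * r \<le> m\<^sup>2 * r"
        using \<open>1 \<le> r\<close> \<open>1 \<le> m\<^sup>2\<close> by (intro mult_left_mono mult_right_mono; simp)+
      then have "- (m\<^sup>2 * r / 2) \<le> - (m\<^sup>2 / 4) + - (s\<^sup>2 * r / 2)"
        unfolding s(2) by simp
      then have "gauss (Suc n) (y - x) \<le> exp (- ((Suc n)\<^sup>2 / 4)) * gauss s (y - x)"
        by (simp add: gauss_def exp_add[symmetric] m_def r_def)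
      from mult_left_mono[OF this, of "norm (f x)"] False show ?thesis
        by (simp add: f2_def norm_mult gauss_pos less_imp_le mult_ac)
    qed (simp add: f2_def)
    have *: "norm (of_real ((sqrt (2 * pi) * Suc n) ^ ?d) * (\<integral>x. f2 x * of_real (gauss (Suc n) (y - x)) \<partial>lborel))
      \<le> sqrt (2 * pi) ^ ?d * fact ?d * I * exp (real (Suc n) - (Suc n)\<^sup>2 / 4)" for n
    proof -
      have "norm (\<integral>x. f2 x * of_real (gauss (Suc n) (y - x)) \<partial>lborel) \<le> (\<integral>x. norm (f2 x * of_real (gauss (Suc n) (y - x))) \<partial>lborel)"
        by (rule integral_norm_bound)
      also have "\<dots> \<le> (\<integral>x. exp (- ((Suc n)\<^sup>2 / 4)) * norm (f x * of_real (gauss s (y - x))) \<partial>lborel)"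
        using bound fs by (intro integral_mono' integrable_mult_right integrable_norm) auto
      also have "\<dots> = exp (- ((Suc n)\<^sup>2 / 4)) * I"
        by (simp add: I_def)
      finally have A: "norm (\<integral>x. f2 x * of_real (gauss (Suc n) (y - x)) \<partial>lborel) \<le> exp (- ((Suc n)\<^sup>2 / 4)) * I" .
      have "real (Suc n) ^ ?d \<le> fact ?d * exp (real (Suc n))"
        by (rule power_le_fact_exp) simp
      then have B: "(sqrt (2 * pi) * Suc n) ^ ?d \<le> sqrt (2 * pi) ^ ?d * (fact ?d * exp (real (Suc n)))"
        by (simp add: power_mult_distrib)
      have "0 \<le> I" by (simp add: I_def)
      have "norm (of_real ((sqrt (2 * pi) * Suc n) ^ ?d) * (\<integral>x. f2 x * of_real (gauss (Suc n) (y - x)) \<partial>lborel))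
         = (sqrt (2 * pi) * Suc n) ^ ?d * norm (\<integral>x. f2 x * of_real (gauss (Suc n) (y - x)) \<partial>lborel)"
        by (simp add: norm_mult norm_power del: of_nat_Suc)
      also have "\<dots> \<le> (sqrt (2 * pi) ^ ?d * (fact ?d * exp (real (Suc n)))) * (exp (- ((Suc n)\<^sup>2 / 4)) * I)"
        by (intro mult_mono A B) auto
      also have "\<dots> = sqrt (2 * pi) ^ ?d * fact ?d * I * exp (real (Suc n) - (Suc n)\<^sup>2 / 4)"
        by (simp add: diff_conv_add_uminus exp_add del: of_nat_Suc add_uminus_conv_diff)
      finally show ?thesis .
    qed
    have "(\<lambda>n. exp (real (Suc n) - (real (Suc n))\<^sup>2 / 4)) \<longlonglongrightarrow> 0"
      by real_asymp
    then have "(\<lambda>n. sqrt (2 * pi) ^ ?d * fact ?d * I * exp (real (Suc n) - (real (Suc n))\<^sup>2 / 4)) \<longlonglongrightarrow> 0"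
      by (rule tendsto_mult_right_zero)
    then show ?thesis
      by (rule Lim_null_comparison[OF always_eventually, rotated]) (use * in simp)
  qed
  have eq: "(\<integral>x. f x * of_real (gauss (Suc n) (y - x)) \<partial>lborel)
     = (\<integral>x. f1 x * of_real (gauss (Suc n) (y - x)) \<partial>lborel) + (\<integral>x. f2 x * of_real (gauss (Suc n) (y - x)) \<partial>lborel)" for n
  proof -
    have fs: "integrable lborel (\<lambda>x. f x * of_real (gauss (Suc n) (y - x)))"
      using f integrable_norm_gauss_squared[of "Suc n" y] by (intro integrable_mult_L2) (auto simp: in_L2_def)
    have "integrable lborel (\<lambda>x. f1 x * of_real (gauss (Suc n) (y - x)))"
      "integrable lborel (\<lambda>x. f2 x * of_real (gauss (Suc n) (y - x)))"
      by (auto intro!: Bochner_Integration.integrable_bound[OF fs] simp: f1_def f2_def)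
    then show ?thesis
      by (subst Bochner_Integration.integral_add[symmetric]) (auto simp: f12 ring_distribs)
  qed
  from tendsto_add[OF 1 2] show ?thesis
    unfolding eq ring_distribs(1) by simp
qed

text \<open>Both sides of \<open>fourier_gauss_duality\<close> with \<sigma> = 1 / (n + 1) have a
  limit: the frequency side by dominated convergence, as F is integrable, the space side by the
  approximate identity. Continuity of f makes the identity valid at every y, in particular at
  lattice points.\<close>

theorem fourier_inversion_L2:
  fixes f F :: "real^'n \<Rightarrow> complex"
  assumes F: "is_fourier_L2 f F" and cont: "continuous_on UNIV f" and int: "integrable lborel F"
  shows "(\<integral>\<xi>. F \<xi> * cis (y \<bullet> \<xi>) \<partial>lborel) = of_real ((2 * pi) ^ CARD('n)) * f y"
proof -
  note [measurable] = borel_measurable_integrable[OF int]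
  have f: "in_L2 f"
    using F by (simp add: is_fourier_L2_def)
  have eq: "(\<integral>\<xi>. F \<xi> * (of_real (gauss (1 / Suc n) \<xi>) * cis (y \<bullet> \<xi>)) \<partial>lborel)
    = of_real ((sqrt (2 * pi) * Suc n) ^ CARD('n)) * (\<integral>x. f x * of_real (gauss (Suc n) (y - x)) \<partial>lborel)" for n
    using fourier_gauss_duality[OF F, of "1 / Suc n" y] by (simp del: of_nat_Suc)
  have "(\<lambda>n. \<integral>\<xi>. F \<xi> * (of_real (gauss (1 / Suc n) \<xi>) * cis (y \<bullet> \<xi>)) \<partial>lborel)
     \<longlonglongrightarrow> (\<integral>\<xi>. F \<xi> * cis (y \<bullet> \<xi>) \<partial>lborel)"
  proof (rule integral_dominated_convergence[where w="\<lambda>\<xi>. norm (F \<xi>)"])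
    show "AE \<xi> in lborel. (\<lambda>n. F \<xi> * (of_real (gauss (1 / Suc n) \<xi>) * cis (y \<bullet> \<xi>))) \<longlonglongrightarrow> F \<xi> * cis (y \<bullet> \<xi>)"
    proof (rule AE_I2)
      fix \<xi> :: "real^'n"
      have "(\<lambda>n. - ((1 / real (Suc n))\<^sup>2 * (norm \<xi>)\<^sup>2 / 2)) \<longlonglongrightarrow> - (0\<^sup>2 * (norm \<xi>)\<^sup>2 / 2)"
        by (intro tendsto_intros LIMSEQ_Suc[OF lim_1_over_n]) auto
      then have "(\<lambda>n. gauss (1 / Suc n) \<xi>) \<longlonglongrightarrow> exp (- (0\<^sup>2 * (norm \<xi>)\<^sup>2 / 2))"
        unfolding gauss_def by (rule tendsto_exp)
      then have "(\<lambda>n. F \<xi> * (of_real (gauss (1 / Suc n) \<xi>) * cis (y \<bullet> \<xi>)))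
         \<longlonglongrightarrow> F \<xi> * (of_real (exp (- (0\<^sup>2 * (norm \<xi>)\<^sup>2 / 2))) * cis (y \<bullet> \<xi>))"
        by (intro tendsto_mult tendsto_of_real tendsto_const)
      then show "(\<lambda>n. F \<xi> * (of_real (gauss (1 / Suc n) \<xi>) * cis (y \<bullet> \<xi>))) \<longlonglongrightarrow> F \<xi> * cis (y \<bullet> \<xi>)"
        by simp
    qed
    show "AE \<xi> in lborel. norm (F \<xi> * (of_real (gauss (1 / Suc n) \<xi>) * cis (y \<bullet> \<xi>))) \<le> norm (F \<xi>)" for n
      by (auto intro!: AE_I2 mult_left_le simp: norm_mult gauss_pos less_imp_le gauss_le_1)
  qed (use int in auto)
  from LIMSEQ_unique[OF this gauss_approximate_identity[OF f cont, of y, folded eq]]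
  show ?thesis .
qed

section \<open>Periodisation over the cube\<close>

text \<open>Half-open, so that the translates by \<open>per_shift\<close> tile the space exactly and
  not merely up to null sets.\<close>

definition per_cube :: "(real^'n) set" where
  "per_cube = {\<xi>. \<forall>i. - pi \<le> \<xi> $ i \<and> \<xi> $ i < pi}"

abbreviation cube_measure :: "(real^'n) measure" where
  "cube_measure \<equiv> restrict_space lborel per_cube"

definition per_shift :: "int^'n \<Rightarrow> real^'n" where
  "per_shift j = (2 * pi) *\<^sub>R lattice_pt j"

definition per_index :: "real^'n \<Rightarrow> int^'n" where
  "per_index \<xi> = (\<chi> i. \<lfloor>(\<xi> $ i + pi) / (2 * pi)\<rfloor>)"

lemma lattice_pt_nth [simp]: "lattice_pt k $ i = real_of_int (k $ i)"
  by (simp add: lattice_pt_def)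

lemma lattice_pt_uminus: "lattice_pt (- k) = - lattice_pt k"
  and lattice_pt_add: "lattice_pt (k + l) = lattice_pt k + lattice_pt l"
  and lattice_pt_0 [simp]: "lattice_pt 0 = 0"
  by (simp_all add: vec_eq_iff)

lemma per_shift_nth [simp]: "per_shift j $ i = 2 * pi * real_of_int (j $ i)"
  by (simp add: per_shift_def)

lemma per_shift_0 [simp]: "per_shift 0 = 0"
  and per_shift_add: "per_shift (j + k) = per_shift j + per_shift k"
  by (simp_all add: vec_eq_iff algebra_simps)

lemma per_cube_borel [measurable]: "per_cube \<in> sets borel"
proof -
  have "Measurable.pred borel (\<lambda>\<xi>::real^'n. \<forall>i. - pi \<le> \<xi> $ i \<and> \<xi> $ i < pi)"
    by measurable
  then show ?thesis
    by (simp add: per_cube_def pred_def)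
qed

lemma diff_per_shift_in_cube_iff: "\<xi> - per_shift j \<in> per_cube \<longleftrightarrow> j = per_index \<xi>"
proof -
  have "- pi \<le> t - 2 * pi * real_of_int k \<and> t - 2 * pi * real_of_int k < pi \<longleftrightarrow> k = \<lfloor>(t + pi) / (2 * pi)\<rfloor>" for t k
    unfolding eq_commute[of k] floor_eq_iff by (auto simp: field_simps)
  then show ?thesis
    by (auto simp: per_cube_def per_index_def vec_eq_iff)
qed

lemma per_index_add_shift: "\<xi> \<in> per_cube \<Longrightarrow> per_index (\<xi> + per_shift j) = j"
  using diff_per_shift_in_cube_iff[of "\<xi> + per_shift j" j] by simp

lemma space_cube_measure [simp]: "space cube_measure = per_cube"
  by (simp add: space_restrict_space)

lemma measurable_per_shift_pair:
  "(\<lambda>(\<xi>, j). \<xi> + per_shift j) \<in> cube_measure \<Otimes>\<^sub>M count_space UNIV \<rightarrow>\<^sub>M borel"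
proof -
  have [measurable]: "per_shift \<in> count_space UNIV \<rightarrow>\<^sub>M borel"
    by simp
  have [measurable]: "(\<lambda>\<xi>::real^'n. \<xi>) \<in> cube_measure \<rightarrow>\<^sub>M borel"
    by (intro measurable_restrict_space1) simp
  show ?thesis
    by measurable
qed

lemma nn_integral_cube: "(\<integral>\<^sup>+\<xi>. g \<xi> \<partial>cube_measure) = (\<integral>\<^sup>+\<xi>. g \<xi> * indicator per_cube \<xi> \<partial>lborel)"
  by (simp add: nn_integral_restrict_space)

text \<open>Tonelli and a translation move the shift from g to the indicator of the cube; each point
  then lies in exactly one translate.\<close>

lemma nn_integral_periodize:
  assumes [measurable]: "g \<in> borel_measurable borel"
  shows "(\<integral>\<^sup>+\<xi>. g \<xi> \<partial>lborel) =
    (\<integral>\<^sup>+\<xi>. \<integral>\<^sup>+j. g (\<xi> + per_shift j) \<partial>count_space UNIV \<partial>(cube_measure :: (real^'n) measure))"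
proof -
  have [measurable]: "{x. x \<in> (per_cube :: (real^'n) set)} \<in> sets borel"
    by simp
  have "(\<integral>\<^sup>+\<xi>. \<integral>\<^sup>+j. g (\<xi> + per_shift j) \<partial>count_space UNIV \<partial>(cube_measure :: (real^'n) measure))
     = (\<integral>\<^sup>+\<xi>. \<integral>\<^sup>+j. g (\<xi> + per_shift j) * indicator per_cube \<xi> \<partial>count_space UNIV \<partial>lborel)"
    by (subst nn_integral_cube) (simp add: nn_integral_multc)
  also have "\<dots> = (\<integral>\<^sup>+j. \<integral>\<^sup>+\<xi>. g (\<xi> + per_shift j) * indicator per_cube \<xi> \<partial>lborel \<partial>count_space UNIV)"
    by (rule nn_integral_count_space_nn_integral) auto
  also have "\<dots> = (\<integral>\<^sup>+j. \<integral>\<^sup>+\<xi>. g \<xi> * indicator per_cube (\<xi> - per_shift j) \<partial>lborel \<partial>count_space UNIV)"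
  proof (rule nn_integral_cong)
    fix j
    show "(\<integral>\<^sup>+\<xi>. g (\<xi> + per_shift j) * indicator per_cube \<xi> \<partial>lborel)
      = (\<integral>\<^sup>+\<xi>. g \<xi> * indicator per_cube (\<xi> - per_shift j) \<partial>lborel)"
      using nn_integral_lborel_translate(1)[of "\<lambda>\<xi>. g \<xi> * indicator per_cube (\<xi> - per_shift j)" "per_shift j"]
      by (simp add: add.commute)
  qed
  also have "\<dots> = (\<integral>\<^sup>+\<xi>. \<integral>\<^sup>+j. g \<xi> * indicator per_cube (\<xi> - per_shift j) \<partial>count_space UNIV \<partial>lborel)"
    by (rule nn_integral_count_space_nn_integral[symmetric]) auto
  also have "\<dots> = (\<integral>\<^sup>+\<xi>. g \<xi> \<partial>lborel)"
  proof (rule nn_integral_cong)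
    fix \<xi> :: "real^'n"
    have "(\<integral>\<^sup>+j. g \<xi> * indicator per_cube (\<xi> - per_shift j) \<partial>count_space UNIV)
       = (\<integral>\<^sup>+j. g \<xi> * indicator {per_index \<xi>} j \<partial>count_space UNIV)"
      by (intro nn_integral_cong) (simp add: indicator_def diff_per_shift_in_cube_iff)
    also have "\<dots> = g \<xi>"
      by (subst nn_integral_cmult_indicator) (auto simp: one_ennreal_def[symmetric])
    finally show "(\<integral>\<^sup>+j. g \<xi> * indicator per_cube (\<xi> - per_shift j) \<partial>count_space UNIV) = g \<xi>" .
  qed
  finally show ?thesis ..
qed

text \<open>Written as an identity of measures, periodisation makes Fubini for Bochner integrals
  available in the lattice variable.\<close>

lemma lborel_periodize:
  "(lborel :: (real^'n) measure) =
    distr (cube_measure \<Otimes>\<^sub>M count_space UNIV) borel (\<lambda>(\<xi>, j). \<xi> + per_shift j)"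
proof (rule measure_eqI)
  interpret sigma_finite_measure "count_space (UNIV :: (int^'n) set)"
    by (rule sigma_finite_measure_count_space)
  fix A :: "(real^'n) set" assume "A \<in> sets lborel"
  then have [measurable]: "A \<in> sets borel"
    by simp
  note [measurable] = measurable_per_shift_pair
  have "emeasure (distr (cube_measure \<Otimes>\<^sub>M count_space UNIV) borel (\<lambda>(\<xi>, j). \<xi> + per_shift j)) A
    = (\<integral>\<^sup>+p. indicator A p \<partial>distr (cube_measure \<Otimes>\<^sub>M count_space UNIV) borel (\<lambda>(\<xi>, j). \<xi> + per_shift j))"
    by simp
  also have "\<dots> = (\<integral>\<^sup>+p. indicator A (case p of (\<xi>, j) \<Rightarrow> \<xi> + per_shift j) \<partial>(cube_measure \<Otimes>\<^sub>M count_space UNIV))"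
    by (subst nn_integral_distr) auto
  also have "\<dots> = (\<integral>\<^sup>+\<xi>. \<integral>\<^sup>+j. indicator A (\<xi> + per_shift j) \<partial>count_space UNIV \<partial>cube_measure)"
    by (subst nn_integral_fst[symmetric]) auto
  also have "\<dots> = (\<integral>\<^sup>+\<xi>. indicator A \<xi> \<partial>lborel)"
    by (rule nn_integral_periodize[symmetric]) simp
  finally show "emeasure lborel A
     = emeasure (distr (cube_measure \<Otimes>\<^sub>M count_space UNIV) borel (\<lambda>(\<xi>, j). \<xi> + per_shift j)) A"
    by simp
qed simp

lemma integral_cis_period:
  "(\<integral>t. indicator {-pi..<pi} t *\<^sub>R cis (real_of_int k * t) \<partial>lborel) = (if k = 0 then 2 * pi else 0)"
    (is "?I = _")
  and integrable_cis_period: "integrable lborel (\<lambda>t. indicator {-pi..<pi} t *\<^sub>R cis (real_of_int k * t))"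
proof -
  show int: "integrable lborel (\<lambda>t. indicator {-pi..<pi} t *\<^sub>R cis (real_of_int k * t))"
    by (rule Bochner_Integration.integrable_bound[of lborel "indicator {-pi..<pi} :: real \<Rightarrow> real"])
      (auto intro!: AE_I2 split: split_indicator)
  show "?I = (if k = 0 then 2 * pi else 0)"
  proof (cases "k = 0")
    case False
    \<comment> \<open>Adding the endpoint changes a null set and prepares for the fundamental
      theorem of calculus, whose boundary terms agree by periodicity.\<close>
    have "?I = (\<integral>t. indicator {-pi..pi} t *\<^sub>R cis (real_of_int k * t) \<partial>lborel)"
      using AE_lborel_singleton[of pi]
      by (intro integral_cong_AE) (auto split: split_indicator)
    also have "\<dots> = cis (real_of_int k * pi) / (\<i> * k) - cis (real_of_int k * - pi) / (\<i> * k)"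
    proof (rule integral_FTC_atLeastAtMost)
      fix x :: real
      show "((\<lambda>t. cis (real_of_int k * t) / (\<i> * k)) has_vector_derivative cis (real_of_int k * x)) (at x within {-pi..pi})"
      proof -
        have "((\<lambda>z. exp (\<i> * k * z) / (\<i> * k)) has_field_derivative exp (\<i> * k * of_real x)) (at (of_real x))"
          using False by (auto intro!: derivative_eq_intros)
        from has_vector_derivative_real_field[OF this, of "{-pi..pi}"] show ?thesis
          by (simp add: cis_conv_exp mult_ac)
      qed
    qed (auto intro!: continuous_intros)
    also have "cis (real_of_int k * pi) = cis (real_of_int k * - pi)"
    proof -
      have "real_of_int k * pi = real_of_int k * - pi + 2 * pi * real_of_int k"
        by simp
      then have "cis (real_of_int k * pi) = cis (real_of_int k * - pi + 2 * pi * real_of_int k)"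
        by (rule arg_cong)
      also have "\<dots> = cis (real_of_int k * - pi)"
        unfolding cis_mult[symmetric] by (subst cis_multiple_2pi) auto
      finally show ?thesis .
    qed
    finally show ?thesis
      using False by simp
  qed (simp add: scaleR_conv_of_real)
qed

lemma
  shows integrable_cube_cis: "integrable cube_measure (\<lambda>\<xi>. cis (lattice_pt k \<bullet> \<xi>))"
    and integral_cube_cis:
      "(\<integral>\<xi>. cis (lattice_pt k \<bullet> \<xi>) \<partial>(cube_measure :: (real^'n) measure)) = (if k = 0 then (2 * pi) ^ CARD('n) else 0)"
proof -
  have eq: "indicator per_cube \<xi> *\<^sub>R cis (lattice_pt k \<bullet> \<xi>)
    = (\<Prod>i\<in>UNIV. indicator {-pi..<pi} (\<xi> $ i) *\<^sub>R cis (real_of_int (k $ i) * \<xi> $ i))" for \<xi> :: "real^'n"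
  proof -
    have "(indicator per_cube \<xi> :: real) = (\<Prod>i\<in>UNIV. indicator {-pi..<pi} (\<xi> $ i))"
      by (auto simp: indicator_def per_cube_def)
    then show ?thesis
      by (simp add: cis_inner_vec scaleR_conv_of_real prod.distrib)
  qed
  show "integrable cube_measure (\<lambda>\<xi>::real^'n. cis (lattice_pt k \<bullet> \<xi>))"
    by (subst integrable_restrict_space) (auto simp: eq intro!: integrable_lborel_prod_vec integrable_cis_period)
  show "(\<integral>\<xi>. cis (lattice_pt k \<bullet> \<xi>) \<partial>(cube_measure :: (real^'n) measure)) = (if k = 0 then (2 * pi) ^ CARD('n) else 0)"
  proof -
    have "(\<integral>\<xi>. cis (lattice_pt k \<bullet> \<xi>) \<partial>(cube_measure :: (real^'n) measure))
      = (\<Prod>i\<in>UNIV. \<integral>t. indicator {-pi..<pi} t *\<^sub>R cis (real_of_int (k $ i) * t) \<partial>lborel)"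
      by (subst integral_restrict_space)
        (simp_all add: eq integral_lborel_prod_vec[OF integrable_cis_period])
    also have "\<dots> = (\<Prod>i\<in>UNIV. (if k $ i = 0 then 2 * pi else 0))"
      by (simp only: integral_cis_period of_real_prod)
    also have "\<dots> = (if k = 0 then (2 * pi) ^ CARD('n) else 0)"
      by (auto simp: vec_eq_iff)
    finally show ?thesis .
  qed
qed

interpretation cube: finite_measure "cube_measure :: (real^'n) measure"
proof (rule finite_measureI)
  have "integrable cube_measure (\<lambda>\<xi>::real^'n. 1 :: complex)"
    using integrable_cube_cis[of "0 :: int^'n"] by simp
  then show "emeasure cube_measure (space cube_measure :: (real^'n) set) \<noteq> \<infinity>"
    by (simp add: integrable_iff_bounded)
qed

interpretation cube_lattice: pair_sigma_finite "cube_measure :: (real^'n) measure" "count_space (UNIV :: (int^'n) set)"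
  by (intro pair_sigma_finite.intro sigma_finite_measure_count_space cube.sigma_finite_measure_axioms)

lemma
  fixes g :: "real^'n \<Rightarrow> 'b::{banach,second_countable_topology}"
  assumes g: "integrable lborel g"
  shows AE_cube_integrable_periodize: "AE \<xi> in cube_measure. integrable (count_space UNIV) (\<lambda>j. g (\<xi> + per_shift j))"
    and integral_periodize: "(\<integral>\<xi>. g \<xi> \<partial>lborel) = (\<integral>\<xi>. \<integral>j. g (\<xi> + per_shift j) \<partial>count_space UNIV \<partial>cube_measure)"
proof -
  have [measurable]: "g \<in> borel_measurable borel"
    using g by auto
  have int: "integrable (cube_measure \<Otimes>\<^sub>M count_space UNIV) (\<lambda>p. g (case p of (\<xi>, j) \<Rightarrow> \<xi> + per_shift j))"
    using g by (subst (asm) lborel_periodize) (auto simp: integrable_distr_eq[OF measurable_per_shift_pair])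
  show "AE \<xi> in cube_measure. integrable (count_space UNIV) (\<lambda>j. g (\<xi> + per_shift j))"
    using cube_lattice.AE_integrable_fst'[OF int] by simp
  show "(\<integral>\<xi>. g \<xi> \<partial>lborel) = (\<integral>\<xi>. \<integral>j. g (\<xi> + per_shift j) \<partial>count_space UNIV \<partial>cube_measure)"
    using cube_lattice.integral_fst'[OF int]
    by (subst lborel_periodize) (simp add: integral_distr[OF measurable_per_shift_pair])
qed

lemma AE_lborel_nth_neq: "AE \<xi> in lborel. (\<xi> :: real^'n) $ i \<noteq> a"
proof (rule AE_I')
  have "closed {x::real^'n. x $ i = a}"
    by (intro closed_Collect_eq continuous_intros)
  then have "{x::real^'n. x $ i = a} \<in> sets lborel"
    by simp
  moreover have "negligible {x::real^'n. x $ i = a}"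
    using negligible_standard_hyperplane[of "axis i 1 :: real^'n" a] by (simp add: inner_axis)
  ultimately show "{x::real^'n. x $ i = a} \<in> null_sets lborel"
    by (simp add: negligible_iff_null_sets null_sets_completion_iff)
qed auto

text \<open>The faces are removed because there a second translate is as short as \<xi>
  itself.\<close>

lemma AE_cube_interior: "AE \<xi> in cube_measure. \<xi> \<in> box (\<chi> i. - pi) (\<chi> i. pi)"
proof -
  have "AE \<xi> in lborel. \<forall>i. (\<xi> :: real^'n) $ i \<noteq> - pi"
    by (intro AE_all_countable[THEN iffD2] allI AE_lborel_nth_neq)
  then have "AE \<xi> in lborel. (\<xi> :: real^'n) \<in> per_cube \<longrightarrow> \<xi> \<in> box (\<chi> i. - pi) (\<chi> i. pi)"
    by eventually_elim (simp add: per_cube_def mem_box_cart, metis less_le)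
  then show ?thesis
    by (subst AE_restrict_space_iff) auto
qed

section \<open>Fourier series on the cube: Bessel and Parseval\<close>

text \<open>The exponent has the positive sign, so the coefficient is an inverse Fourier transform:
  for a band-limited f with transform F it is the sample f(k).\<close>

definition fourier_coeff :: "(real^'n \<Rightarrow> complex) \<Rightarrow> int^'n \<Rightarrow> complex" where
  "fourier_coeff u k = of_real (1 / (2 * pi) ^ CARD('n)) * (\<integral>\<xi>. u \<xi> * cis (lattice_pt k \<bullet> \<xi>) \<partial>cube_measure)"

text \<open>A bilinear Parseval identity, which accounts for the index - k; \<open>has_sum\<close>
  makes unconditional convergence part of the claim. For fixed F the admissible H are closed under
  linear combinations and bounded pointwise limits, and this is how all bounded measurable H are
  reached.\<close>

definition parseval_pair :: "(real^'n \<Rightarrow> complex) \<Rightarrow> (real^'n \<Rightarrow> complex) \<Rightarrow> bool" where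
  "parseval_pair F H \<longleftrightarrow> ((\<lambda>k. fourier_coeff F k * fourier_coeff H (- k))
     has_sum of_real (1 / (2 * pi) ^ CARD('n)) * (\<integral>\<xi>. F \<xi> * H \<xi> \<partial>cube_measure)) UNIV"

abbreviation cube_L2 :: "(real^'n \<Rightarrow> complex) \<Rightarrow> bool" where
  "cube_L2 u \<equiv> u \<in> borel_measurable cube_measure \<and> integrable cube_measure (\<lambda>\<xi>. (norm (u \<xi>))\<^sup>2)"

definition bounded_meas :: "(real^'n \<Rightarrow> complex) \<Rightarrow> bool" where
  "bounded_meas H \<longleftrightarrow> H \<in> borel_measurable borel \<and> (\<exists>B. \<forall>\<xi>. norm (H \<xi>) \<le> B)"

lemma borel_measurable_cube: "u \<in> borel_measurable borel \<Longrightarrow> u \<in> borel_measurable cube_measure"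
  by (intro measurable_restrict_space1) simp

lemma cube_L2_bounded_meas:
  assumes "bounded_meas H"
  shows "cube_L2 H"
proof -
  from assms obtain B where [measurable]: "H \<in> borel_measurable borel" and B: "\<And>\<xi>. norm (H \<xi>) \<le> B"
    by (auto simp: bounded_meas_def)
  have [measurable]: "H \<in> borel_measurable cube_measure"
    by (rule borel_measurable_cube) simp
  moreover have "integrable cube_measure (\<lambda>\<xi>. (norm (H \<xi>))\<^sup>2)"
    using B by (intro cube.integrable_const_bound[where B="B\<^sup>2"]) (auto intro!: AE_I2 power_mono)
  ultimately show ?thesis
    by simp
qed

lemma integrable_cube_L2_mult:
  "cube_L2 u \<Longrightarrow> cube_L2 v \<Longrightarrow> integrable cube_measure (\<lambda>\<xi>. u \<xi> * v \<xi>)"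
  by (rule integrable_mult_L2) auto

lemma bounded_meas_cis: "bounded_meas (\<lambda>\<xi>. c * cis (x \<bullet> \<xi>))"
  unfolding bounded_meas_def by (auto simp: norm_mult)

lemma integrable_cube_L2_cis:
  "cube_L2 u \<Longrightarrow> integrable cube_measure (\<lambda>\<xi>. u \<xi> * cis (x \<bullet> \<xi>))"
  using cube_L2_bounded_meas[OF bounded_meas_cis[of 1 x]] by (intro integrable_cube_L2_mult) auto

lemma bounded_meas_add:
  assumes "bounded_meas u" "bounded_meas v"
  shows "bounded_meas (\<lambda>\<xi>. u \<xi> + v \<xi>)"
proof -
  from assms obtain B C where "u \<in> borel_measurable borel" "v \<in> borel_measurable borel"
    "\<And>\<xi>. norm (u \<xi>) \<le> B" "\<And>\<xi>. norm (v \<xi>) \<le> C"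
    by (auto simp: bounded_meas_def)
  then show ?thesis
    unfolding bounded_meas_def by (auto intro!: exI[of _ "B + C"] norm_triangle_le add_mono)
qed

lemma bounded_meas_cmult:
  assumes "bounded_meas u"
  shows "bounded_meas (\<lambda>\<xi>. c * u \<xi>)"
proof -
  from assms obtain B where "u \<in> borel_measurable borel" "\<And>\<xi>. norm (u \<xi>) \<le> B"
    by (auto simp: bounded_meas_def)
  then show ?thesis
    unfolding bounded_meas_def by (auto intro!: exI[of _ "norm c * B"] mult_left_mono simp: norm_mult)
qed

lemma bounded_meas_indicator: "A \<in> sets borel \<Longrightarrow> bounded_meas (indicator A)"
  unfolding bounded_meas_def by (auto intro!: exI[of _ 1] split: split_indicator)

lemma fourier_coeff_add:
  "cube_L2 u \<Longrightarrow> cube_L2 v \<Longrightarrow> fourier_coeff (\<lambda>\<xi>. u \<xi> + v \<xi>) k = fourier_coeff u k + fourier_coeff v k"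
  unfolding fourier_coeff_def by (simp add: ring_distribs integrable_cube_L2_cis)

lemma fourier_coeff_diff:
  "cube_L2 u \<Longrightarrow> cube_L2 v \<Longrightarrow> fourier_coeff (\<lambda>\<xi>. u \<xi> - v \<xi>) k = fourier_coeff u k - fourier_coeff v k"
  unfolding fourier_coeff_def by (simp add: ring_distribs integrable_cube_L2_cis)

lemma fourier_coeff_cmult: "fourier_coeff (\<lambda>\<xi>. c * u \<xi>) k = c * fourier_coeff u k"
  unfolding fourier_coeff_def by (simp add: mult.assoc)

lemma fourier_coeff_cis: "fourier_coeff (\<lambda>\<xi>. cis (lattice_pt l \<bullet> \<xi>)) k = (if k = - l then 1 else 0)"
proof -
  have "fourier_coeff (\<lambda>\<xi>. cis (lattice_pt l \<bullet> \<xi>)) k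
    = of_real (1 / (2 * pi) ^ CARD('a)) * (\<integral>\<xi>. cis (lattice_pt (l + k) \<bullet> \<xi>) \<partial>cube_measure)"
    unfolding fourier_coeff_def by (simp add: lattice_pt_add inner_add_left cis_mult)
  then show ?thesis
    by (auto simp: integral_cube_cis add_eq_0_iff)
qed

text \<open>Nonnegativity of the mean square distance from a partial Fourier sum; the cross term and
  the square of the sum have the same mean \<open>A\<close>.\<close>

lemma Bessel:
  fixes u :: "real^'n \<Rightarrow> complex"
  assumes u: "cube_L2 u" and S: "finite S"
  shows "(\<Sum>k\<in>S. (norm (fourier_coeff u k))\<^sup>2) \<le> 1 / (2 * pi) ^ CARD('n) * (\<integral>\<xi>. (norm (u \<xi>))\<^sup>2 \<partial>cube_measure)"
proof -
  define \<omega> where "\<omega> = 1 / (2 * pi) ^ CARD('n)"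
  have \<omega>: "\<omega> > 0"
    by (simp add: \<omega>_def)
  define A where "A = (\<Sum>k\<in>S. (norm (fourier_coeff u k))\<^sup>2)"
  \<comment> \<open>The conjugate of the partial Fourier sum of u over S: with the sign of
    \<open>fourier_coeff\<close>, the series of u itself has the characters with exponent - k.
    Accordingly \<open>T\<close> is compared with \<open>cnj (u \<xi>)\<close> below.\<close>
  define T where "T \<xi> = (\<Sum>k\<in>S. cnj (fourier_coeff u k) * cis (lattice_pt k \<bullet> \<xi>))" for \<xi>
  have Tbm: "bounded_meas T"
    unfolding bounded_meas_def T_def[abs_def]
    by (auto intro!: exI[of _ "\<Sum>k\<in>S. norm (fourier_coeff u k)"] order_trans[OF norm_sum] simp: norm_mult)
  then have T: "cube_L2 T"
    by (rule cube_L2_bounded_meas)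
  have cT: "cube_L2 (\<lambda>\<xi>. cnj (T \<xi>))"
    using T by auto
  have uT: "integrable cube_measure (\<lambda>\<xi>. u \<xi> * T \<xi>)"
    using u T by (rule integrable_cube_L2_mult)
  have 1: "of_real \<omega> * (\<integral>\<xi>. u \<xi> * T \<xi> \<partial>cube_measure) = of_real A"
  proof -
    have "(\<integral>\<xi>. u \<xi> * T \<xi> \<partial>cube_measure)
       = (\<integral>\<xi>. (\<Sum>k\<in>S. cnj (fourier_coeff u k) * (u \<xi> * cis (lattice_pt k \<bullet> \<xi>))) \<partial>cube_measure)"
      by (simp add: T_def sum_distrib_left mult_ac)
    also have "\<dots> = (\<Sum>k\<in>S. cnj (fourier_coeff u k) * (\<integral>\<xi>. u \<xi> * cis (lattice_pt k \<bullet> \<xi>) \<partial>cube_measure))"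
      by (subst Bochner_Integration.integral_sum) (auto intro!: integrable_mult_right integrable_cube_L2_cis u)
    finally have "of_real \<omega> * (\<integral>\<xi>. u \<xi> * T \<xi> \<partial>cube_measure) = (\<Sum>k\<in>S. cnj (fourier_coeff u k) * fourier_coeff u k)"
      by (simp add: sum_distrib_left fourier_coeff_def \<omega>_def mult_ac)
    also have "\<dots> = of_real A"
      unfolding A_def of_real_sum complex_norm_square by (simp add: mult.commute)
    finally show ?thesis .
  qed
  have 2: "of_real \<omega> * (\<integral>\<xi>. T \<xi> * cnj (T \<xi>) \<partial>cube_measure) = of_real A"
  proof -
    have coef: "of_real \<omega> * (\<integral>\<xi>. T \<xi> * cis (lattice_pt (- k) \<bullet> \<xi>) \<partial>cube_measure) = cnj (fourier_coeff u k)"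
      if "k \<in> S" for k
    proof -
      have "of_real \<omega> * (\<integral>\<xi>. T \<xi> * cis (lattice_pt (- k) \<bullet> \<xi>) \<partial>cube_measure)
        = of_real \<omega> * (\<integral>\<xi>. (\<Sum>l\<in>S. cnj (fourier_coeff u l) * cis (lattice_pt (l - k) \<bullet> \<xi>)) \<partial>cube_measure)"
        using lattice_pt_add[of _ "- k"]
        by (simp add: T_def sum_distrib_right mult.assoc cis_mult inner_add_left)
      also have "\<dots> = of_real \<omega> * (\<Sum>l\<in>S. cnj (fourier_coeff u l) * (if l = k then (2 * pi) ^ CARD('n) else 0))"
        by (subst Bochner_Integration.integral_sum)
          (auto intro!: integrable_mult_right integrable_cube_cis sum.cong simp: integral_cube_cis)
      also have "\<dots> = cnj (fourier_coeff u k)"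
        using S that by (simp add: if_distrib \<omega>_def cong: if_cong)
      finally show ?thesis .
    qed
    have "(\<integral>\<xi>. T \<xi> * cnj (T \<xi>) \<partial>cube_measure)
       = (\<integral>\<xi>. (\<Sum>k\<in>S. fourier_coeff u k * (T \<xi> * cis (lattice_pt (- k) \<bullet> \<xi>))) \<partial>cube_measure)"
      by (intro Bochner_Integration.integral_cong refl, subst (2) T_def)
        (simp add: sum_distrib_left mult_ac cis_cnj lattice_pt_uminus)
    also have "\<dots> = (\<Sum>k\<in>S. fourier_coeff u k * (\<integral>\<xi>. T \<xi> * cis (lattice_pt (- k) \<bullet> \<xi>) \<partial>cube_measure))"
      by (subst Bochner_Integration.integral_sum) (auto intro!: integrable_mult_right integrable_cube_L2_cis T)
    finally have "of_real \<omega> * (\<integral>\<xi>. T \<xi> * cnj (T \<xi>) \<partial>cube_measure)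
      = (\<Sum>k\<in>S. fourier_coeff u k * (of_real \<omega> * (\<integral>\<xi>. T \<xi> * cis (lattice_pt (- k) \<bullet> \<xi>) \<partial>cube_measure)))"
      by (simp add: sum_distrib_left mult_ac)
    also have "\<dots> = (\<Sum>k\<in>S. fourier_coeff u k * cnj (fourier_coeff u k))"
      by (intro sum.cong refl) (simp add: coef)
    also have "\<dots> = of_real A"
      unfolding A_def of_real_sum complex_norm_square ..
    finally show ?thesis .
  qed
  have sq: "(norm (cnj a - b))\<^sup>2 = (norm a)\<^sup>2 - 2 * Re (a * b) + (norm b)\<^sup>2" for a b :: complex
    unfolding cmod_power2 by (simp add: power2_eq_square algebra_simps)
  have T2: "(\<integral>\<xi>. (norm (T \<xi>))\<^sup>2 \<partial>cube_measure) = Re (\<integral>\<xi>. T \<xi> * cnj (T \<xi>) \<partial>cube_measure)"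
    by (subst integral_Re[symmetric], rule integrable_cube_L2_mult[OF T cT])
      (simp only: complex_norm_square[symmetric] Re_complex_of_real)
  have "0 \<le> \<omega> * (\<integral>\<xi>. (norm (cnj (u \<xi>) - T \<xi>))\<^sup>2 \<partial>cube_measure)"
    using \<omega> by (intro mult_nonneg_nonneg integral_nonneg_AE) auto
  also have "(\<integral>\<xi>. (norm (cnj (u \<xi>) - T \<xi>))\<^sup>2 \<partial>cube_measure)
      = (\<integral>\<xi>. (norm (u \<xi>))\<^sup>2 \<partial>cube_measure) - 2 * Re (\<integral>\<xi>. u \<xi> * T \<xi> \<partial>cube_measure) + (\<integral>\<xi>. (norm (T \<xi>))\<^sup>2 \<partial>cube_measure)"
    unfolding sq using u T uT by (simp del: times_complex.sel)
  also have "\<omega> * \<dots> = \<omega> * (\<integral>\<xi>. (norm (u \<xi>))\<^sup>2 \<partial>cube_measure)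
      - 2 * Re (of_real \<omega> * (\<integral>\<xi>. u \<xi> * T \<xi> \<partial>cube_measure)) + Re (of_real \<omega> * (\<integral>\<xi>. T \<xi> * cnj (T \<xi>) \<partial>cube_measure))"
    unfolding T2 by (simp add: algebra_simps)
  also have "\<dots> = \<omega> * (\<integral>\<xi>. (norm (u \<xi>))\<^sup>2 \<partial>cube_measure) - A"
    unfolding 1 2 by simp
  finally show ?thesis
    by (simp add: A_def \<omega>_def)
qed

text \<open>Used to ignore the faces of the cube and the exceptional frequencies at which the
  periodised symbol is not controlled.\<close>

lemma parseval_pair_cong_AE:
  assumes "parseval_pair F G" "AE \<xi> in cube_measure. G \<xi> = H \<xi>"
    and [measurable]: "F \<in> borel_measurable cube_measure" "G \<in> borel_measurable cube_measure" "H \<in> borel_measurable cube_measure"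
  shows "parseval_pair F H"
proof -
  have [measurable]: "(\<lambda>\<xi>. cis (lattice_pt k \<bullet> \<xi>)) \<in> borel_measurable cube_measure" for k
    by (rule borel_measurable_cube) simp
  have "(\<integral>\<xi>. G \<xi> * cis (lattice_pt k \<bullet> \<xi>) \<partial>cube_measure) = (\<integral>\<xi>. H \<xi> * cis (lattice_pt k \<bullet> \<xi>) \<partial>cube_measure)" for k
    using assms(2) by (intro integral_cong_AE) auto
  moreover have "(\<integral>\<xi>. F \<xi> * G \<xi> \<partial>cube_measure) = (\<integral>\<xi>. F \<xi> * H \<xi> \<partial>cube_measure)"
    using assms(2) by (intro integral_cong_AE) auto
  ultimately show ?thesis
    using assms(1) by (simp add: parseval_pair_def fourier_coeff_def)
qed

lemma parseval_pair_add:
  assumes "cube_L2 F" "cube_L2 G" "cube_L2 H" "parseval_pair F G" "parseval_pair F H"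
  shows "parseval_pair F (\<lambda>\<xi>. G \<xi> + H \<xi>)"
  using has_sum_add[OF assms(4,5)[unfolded parseval_pair_def]] assms(1-3)
  unfolding parseval_pair_def by (simp add: fourier_coeff_add ring_distribs integrable_cube_L2_mult)

lemma parseval_pair_cmult:
  assumes "parseval_pair F G"
  shows "parseval_pair F (\<lambda>\<xi>. c * G \<xi>)"
  using has_sum_cmult_right[OF assms[unfolded parseval_pair_def], of c]
  unfolding parseval_pair_def by (simp add: fourier_coeff_cmult mult_ac)

lemma parseval_pair_cis: "parseval_pair F (\<lambda>\<xi>. cis (lattice_pt l \<bullet> \<xi>))"
proof -
  have "((\<lambda>k. fourier_coeff F k * fourier_coeff (\<lambda>\<xi>. cis (lattice_pt l \<bullet> \<xi>)) (- k)) has_sum fourier_coeff F l) UNIV"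
    by (rule has_sum_finite_neutralI[of "{l}"]) (auto simp: fourier_coeff_cis)
  then show ?thesis
    by (simp add: parseval_pair_def fourier_coeff_def)
qed

text \<open>Bessel's inequality makes the partial sums equicontinuous in the second argument with respect to
  the \<open>L\<^sup>2\<close> norm on the cube, which allows the two limits to be interchanged.\<close>
lemma parseval_pair_limit:
  fixes F H :: "real^'n \<Rightarrow> complex" and G :: "nat \<Rightarrow> real^'n \<Rightarrow> complex"
  assumes F: "cube_L2 F" and G: "\<And>n. parseval_pair F (G n)"
    and Gm: "\<And>n. G n \<in> borel_measurable borel" and bound: "\<And>n \<xi>. norm (G n \<xi>) \<le> B"
    and H: "bounded_meas H" and lim: "AE \<xi> in cube_measure. (\<lambda>n. G n \<xi>) \<longlonglongrightarrow> H \<xi>"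
  shows "parseval_pair F H"
proof -
  define \<omega> where "\<omega> = 1 / (2 * pi) ^ CARD('n)"
  have \<omega>: "\<omega> > 0"
    by (simp add: \<omega>_def)
  have Gb: "bounded_meas (G n)" for n
    using Gm bound by (auto simp: bounded_meas_def)
  have G2: "cube_L2 (G n)" and H2: "cube_L2 H" for n
    using cube_L2_bounded_meas[OF Gb] cube_L2_bounded_meas[OF H] by auto
  obtain C where C: "\<And>\<xi>. norm (H \<xi>) \<le> C"
    using H by (auto simp: bounded_meas_def)
  have [measurable]: "F \<in> borel_measurable cube_measure" "\<And>n. G n \<in> borel_measurable cube_measure"
      "H \<in> borel_measurable cube_measure"
    using F G2 H2 by auto
  have GHb: "bounded_meas (\<lambda>\<xi>. G n \<xi> - H \<xi>)" for n
    using bounded_meas_add[OF Gb[of n] bounded_meas_cmult[OF H, of "-1"]] by simp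
  have GH2: "cube_L2 (\<lambda>\<xi>. G n \<xi> - H \<xi>)" for n
    by (rule cube_L2_bounded_meas[OF GHb])
  \<comment> \<open>The Bessel bound for the difference of two partial sums; the finite set S does
    not occur in it.\<close>
  define \<epsilon> where "\<epsilon> n = sqrt (\<omega> * (\<integral>\<xi>. (norm (F \<xi>))\<^sup>2 \<partial>cube_measure)) * sqrt (\<omega> * (\<integral>\<xi>. (norm (G n \<xi> - H \<xi>))\<^sup>2 \<partial>cube_measure))" for n
  have "(\<lambda>n. \<integral>\<xi>. (norm (G n \<xi> - H \<xi>))\<^sup>2 \<partial>cube_measure) \<longlonglongrightarrow> (\<integral>\<xi>. 0 \<partial>(cube_measure :: (real^'n) measure))"
  proof (rule integral_dominated_convergence[where w="\<lambda>_. (B + C)\<^sup>2"])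
    show "AE \<xi> in cube_measure. (\<lambda>n. (norm (G n \<xi> - H \<xi>))\<^sup>2) \<longlonglongrightarrow> 0"
      using lim
    proof eventually_elim
      case (elim \<xi>)
      have "(\<lambda>n. (norm (G n \<xi> - H \<xi>))\<^sup>2) \<longlonglongrightarrow> (norm (H \<xi> - H \<xi>))\<^sup>2"
        by (intro tendsto_intros elim)
      then show ?case by simp
    qed
    show "AE \<xi> in cube_measure. norm ((norm (G n \<xi> - H \<xi>))\<^sup>2) \<le> (B + C)\<^sup>2" for n
      using bound C by (auto intro!: AE_I2 power_mono order_trans[OF norm_triangle_ineq4] add_mono)
  qed auto
  then have "\<epsilon> \<longlonglongrightarrow> sqrt (\<omega> * (\<integral>\<xi>. (norm (F \<xi>))\<^sup>2 \<partial>cube_measure)) * sqrt (\<omega> * (\<integral>\<xi>. 0 \<partial>(cube_measure :: (real^'n) measure)))"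
    unfolding \<epsilon>_def by (intro tendsto_intros)
  then have \<epsilon>: "\<epsilon> \<longlonglongrightarrow> 0"
    by simp
  have est: "norm ((\<Sum>k\<in>S. fourier_coeff F k * fourier_coeff (G n) (- k)) - (\<Sum>k\<in>S. fourier_coeff F k * fourier_coeff H (- k))) \<le> \<epsilon> n"
    if S: "finite S" for S n
  proof -
    let ?d = "\<lambda>k. fourier_coeff (\<lambda>\<xi>. G n \<xi> - H \<xi>) (- k)"
    have "norm ((\<Sum>k\<in>S. fourier_coeff F k * fourier_coeff (G n) (- k)) - (\<Sum>k\<in>S. fourier_coeff F k * fourier_coeff H (- k)))
       = norm (\<Sum>k\<in>S. fourier_coeff F k * ?d k)"
      using G2[of n] H2 by (simp add: fourier_coeff_diff sum_subtractf[symmetric] ring_distribs)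
    also have "\<dots> \<le> (\<Sum>k\<in>S. norm (fourier_coeff F k * ?d k))"
      by (rule norm_sum)
    also have "\<dots> = (\<Sum>k\<in>S. \<bar>norm (fourier_coeff F k)\<bar> * \<bar>norm (?d k)\<bar>)"
      by (simp add: norm_mult)
    also have "\<dots> \<le> L2_set (\<lambda>k. norm (fourier_coeff F k)) S * L2_set (\<lambda>k. norm (?d k)) S"
      by (rule L2_set_mult_ineq)
    also have "\<dots> \<le> \<epsilon> n"
      unfolding \<epsilon>_def L2_set_def
    proof (intro mult_mono real_sqrt_le_mono)
      show "(\<Sum>k\<in>S. (norm (fourier_coeff F k))\<^sup>2) \<le> \<omega> * (\<integral>\<xi>. (norm (F \<xi>))\<^sup>2 \<partial>cube_measure)"
        unfolding \<omega>_def by (rule Bessel[OF F S])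
      \<comment> \<open>Bessel's inequality is applied to the reflected index set, as the second
        coefficients are taken at - k.\<close>
      have "(\<Sum>k\<in>S. (norm (?d k))\<^sup>2) = (\<Sum>k\<in>uminus ` S. (norm (fourier_coeff (\<lambda>\<xi>. G n \<xi> - H \<xi>) k))\<^sup>2)"
        by (subst sum.reindex) auto
      also have "\<dots> \<le> \<omega> * (\<integral>\<xi>. (norm (G n \<xi> - H \<xi>))\<^sup>2 \<partial>cube_measure)"
        unfolding \<omega>_def by (rule Bessel[OF GH2]) (use S in simp)
      finally show "(\<Sum>k\<in>S. (norm (?d k))\<^sup>2) \<le> \<omega> * (\<integral>\<xi>. (norm (G n \<xi> - H \<xi>))\<^sup>2 \<partial>cube_measure)" .
    qed (use \<omega> in \<open>auto intro!: sum_nonneg mult_nonneg_nonneg\<close>)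
    finally show ?thesis .
  qed
  have "((\<lambda>S. \<Sum>k\<in>S. fourier_coeff F k * fourier_coeff H (- k))
      \<longlongrightarrow> of_real \<omega> * (\<integral>\<xi>. F \<xi> * H \<xi> \<partial>cube_measure)) (finite_subsets_at_top UNIV)"
  proof (rule swap_uniform_limit')
    show "\<forall>\<^sub>F n in sequentially. ((\<lambda>S. \<Sum>k\<in>S. fourier_coeff F k * fourier_coeff (G n) (- k))
       \<longlongrightarrow> of_real \<omega> * (\<integral>\<xi>. F \<xi> * G n \<xi> \<partial>cube_measure)) (finite_subsets_at_top UNIV)"
      using G by (auto simp: parseval_pair_def has_sum_def \<omega>_def)
    show "(\<lambda>n. of_real \<omega> * (\<integral>\<xi>. F \<xi> * G n \<xi> \<partial>cube_measure)) \<longlonglongrightarrow> of_real \<omega> * (\<integral>\<xi>. F \<xi> * H \<xi> \<partial>cube_measure)"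
    proof (intro tendsto_intros integral_dominated_convergence[where w="\<lambda>\<xi>. B * norm (F \<xi>)"])
      show "integrable cube_measure (\<lambda>\<xi>. B * norm (F \<xi>))"
        using integrable_cube_L2_cis[OF F, of 0] by (intro integrable_mult_right integrable_norm) simp
      show "AE \<xi> in cube_measure. (\<lambda>n. F \<xi> * G n \<xi>) \<longlonglongrightarrow> F \<xi> * H \<xi>"
        using lim by eventually_elim (intro tendsto_intros)
      show "AE \<xi> in cube_measure. norm (F \<xi> * G n \<xi>) \<le> B * norm (F \<xi>)" for n
        using bound by (auto intro!: AE_I2 mult_left_mono simp: norm_mult mult.commute[of B])
    qed auto
    show "uniform_limit {S. finite S} (\<lambda>n S. \<Sum>k\<in>S. fourier_coeff F k * fourier_coeff (G n) (- k))
      (\<lambda>S. \<Sum>k\<in>S. fourier_coeff F k * fourier_coeff H (- k)) sequentially"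
    proof (rule uniform_limitI)
      fix e :: real assume "e > 0"
      from order_tendstoD(2)[OF \<epsilon> this]
      show "\<forall>\<^sub>F n in sequentially. \<forall>S\<in>{S. finite S}.
        dist (\<Sum>k\<in>S. fourier_coeff F k * fourier_coeff (G n) (- k)) (\<Sum>k\<in>S. fourier_coeff F k * fourier_coeff H (- k)) < e"
        by eventually_elim (auto simp: dist_norm intro: le_less_trans[OF est])
    qed
    show "\<forall>\<^sub>F S in finite_subsets_at_top UNIV. S \<in> {S. finite S}"
      by (auto simp: eventually_finite_subsets_at_top)
  qed auto
  then show ?thesis
    by (simp add: parseval_pair_def has_sum_def \<omega>_def)
qed

section \<open>Trigonometric polynomials, and Parseval's identity for boxes, Borel sets and bounded
  functions\<close>

inductive trig_poly :: "(real^'n \<Rightarrow> complex) \<Rightarrow> bool" where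
  monom: "trig_poly (\<lambda>\<xi>. c * cis (lattice_pt k \<bullet> \<xi>))"
| add: "trig_poly p \<Longrightarrow> trig_poly q \<Longrightarrow> trig_poly (\<lambda>\<xi>. p \<xi> + q \<xi>)"

lemma trig_poly_const: "trig_poly (\<lambda>\<xi>. c)"
  using trig_poly.monom[of c 0] by simp

lemma trig_poly_mult:
  assumes "trig_poly p" "trig_poly q"
  shows "trig_poly (\<lambda>\<xi>. p \<xi> * q \<xi>)"
  using assms(1)
proof induction
  case (monom c k)
  show ?case
    using assms(2)
  proof induction
    case (monom d l)
    have "trig_poly (\<lambda>\<xi>. (c * d) * cis (lattice_pt (k + l) \<bullet> \<xi>))"
      by (rule trig_poly.monom)
    then show ?case
      by (simp add: lattice_pt_add inner_add_left cis_mult[symmetric] mult_ac)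
  next
    case (add p q)
    then show ?case
      by (simp add: ring_distribs trig_poly.add)
  qed
next
  case (add p q)
  then show ?case
    by (simp add: ring_distribs trig_poly.add)
qed

lemma trig_poly_prod:
  "finite A \<Longrightarrow> (\<And>i. i \<in> A \<Longrightarrow> trig_poly (p i)) \<Longrightarrow> trig_poly (\<lambda>\<xi>. \<Prod>i\<in>A. p i \<xi>)"
  by (induction A rule: finite_induct) (auto intro: trig_poly_const trig_poly_mult)

lemma trig_poly_cos: "trig_poly (\<lambda>\<xi>. of_real (cos (\<xi> $ i - m)))"
proof -
  have lp: "lattice_pt (axis i r) \<bullet> \<xi> = r * \<xi> $ i" for r :: int and \<xi>
  proof -
    have "lattice_pt (axis i r) = axis i (real_of_int r)"
      by (simp add: vec_eq_iff axis_def)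
    then show ?thesis
      by (simp add: inner_axis')
  qed
  have "trig_poly (\<lambda>\<xi>. (cis (- m) / 2) * cis (lattice_pt (axis i 1) \<bullet> \<xi>) + (cis m / 2) * cis (lattice_pt (axis i (-1)) \<bullet> \<xi>))"
    by (intro trig_poly.intros)
  moreover have "(cis (- m) / 2) * cis (lattice_pt (axis i 1) \<bullet> \<xi>) + (cis m / 2) * cis (lattice_pt (axis i (-1)) \<bullet> \<xi>)
     = of_real (cos (\<xi> $ i - m))" for \<xi>
    by (simp add: lp complex_eq_iff cos_diff sin_diff field_simps)
  ultimately show ?thesis
    by simp
qed

text \<open>In one coordinate the approximants of an arc are polynomials in the cosine of the
  difference to its midpoint.\<close>

lemma trig_poly_polynomial_cos:
  assumes "real_polynomial_function (p :: real \<Rightarrow> real)"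
  shows "trig_poly (\<lambda>\<xi>. of_real (p (cos (\<xi> $ i - m))))"
  using assms
proof induction
  case (linear f)
  then have "f t = f 1 * t" for t
    using linear_simps(5)[of f t 1] by (simp add: mult.commute)
  then have "(\<lambda>\<xi>. complex_of_real (f (cos (\<xi> $ i - m)))) = (\<lambda>\<xi>. of_real (f 1) * of_real (cos (\<xi> $ i - m)))"
    by (metis of_real_mult)
  then show ?case
    by (simp only: trig_poly_mult trig_poly_const trig_poly_cos)
qed (auto intro: trig_poly_const trig_poly.add trig_poly_mult)

lemma bounded_meas_trig_poly: "trig_poly p \<Longrightarrow> bounded_meas p"
  by (induction rule: trig_poly.induct) (auto intro: bounded_meas_cis bounded_meas_add)

lemma parseval_pair_trig_poly: "trig_poly p \<Longrightarrow> cube_L2 F \<Longrightarrow> parseval_pair F p"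
  by (induction rule: trig_poly.induct)
    (auto intro: parseval_pair_cmult parseval_pair_cis
      intro!: parseval_pair_add dest!: bounded_meas_trig_poly cube_L2_bounded_meas)

text \<open>On the circle an arc is a superlevel set of the cosine centred at its midpoint. The
  indicator of an arc thus becomes a step function of a cosine, and polynomial approximation of the
  step on [-1, 1] yields trigonometric polynomials.\<close>

lemma arc_iff_cos_gt:
  assumes ab: "- pi \<le> a" "a < b" "b \<le> pi" and t: "- pi \<le> t" "t < pi"
  shows "a < t \<and> t < b \<longleftrightarrow> cos ((b - a) / 2) < cos (t - (a + b) / 2)"
proof -
  define h where "h = (b - a) / 2"
  define m where "m = (a + b) / 2"
  define s where "s = \<bar>t - m\<bar>"
  have h: "0 < h" "h \<le> pi" and a: "a = m - h" "b = m + h"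
    using ab by (auto simp: h_def m_def field_simps)
  have s: "cos (t - m) = cos s"
    by (simp add: s_def)
  have "(a < t \<and> t < b) \<longleftrightarrow> s < h"
    using a by (auto simp: s_def)
  also have "\<dots> \<longleftrightarrow> cos h < cos s"
  proof (cases "s \<le> pi")
    case True
    then show ?thesis
      using cos_mono_less_eq[of h s] h by (auto simp: s_def)
  next
    \<comment> \<open>The distance to the midpoint may exceed \<pi>; the way round the circle, 2
      \<pi> - s, is then the shorter one, and it is at least h because the arc stays within one
      period.\<close>
    case False
    have le: "h \<le> 2 * pi - s"
      using ab t a by (auto simp: s_def abs_if)
    have "cos s = cos (2 * pi - s)"
      by simp
    also have "\<dots> \<le> cos h"
      using le False h by (subst cos_mono_le_eq) auto
    finally show ?thesis
      using False h by auto
  qed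
  finally show ?thesis
    by (simp add: s[symmetric] m_def h_def)
qed

text \<open>Ramps of slope n starting at \<open>s0\<close> converge to the strict step, with value 0
  at \<open>s0\<close> itself, and Weierstrass polynomials follow the n-th ramp within 1 / (n + 1).
  The bound 2 is the bound 1 of the ramp plus this error.\<close>

lemma polynomial_approx_step:
  fixes s0 :: real
  obtains p :: "nat \<Rightarrow> real \<Rightarrow> real" where "\<And>n. real_polynomial_function (p n)"
    "\<And>n s. \<bar>s\<bar> \<le> 1 \<Longrightarrow> \<bar>p n s\<bar> \<le> 2" "\<And>s. \<bar>s\<bar> \<le> 1 \<Longrightarrow> (\<lambda>n. p n s) \<longlonglongrightarrow> (if s0 < s then 1 else 0)"
proof -
  define \<phi> where "\<phi> n s = min 1 (max 0 (real n * (s - s0)))" for n s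
  have "\<exists>p. real_polynomial_function p \<and> (\<forall>s\<in>{-1..1}. \<bar>\<phi> n s - p s\<bar> < 1 / Suc n)" for n
  proof -
    have "continuous_on {-1..1} (\<phi> n)"
      unfolding \<phi>_def by (intro continuous_intros)
    from Stone_Weierstrass_real_polynomial_function[OF compact_Icc this, of "1 / Suc n"]
    show ?thesis by (metis of_nat_0_less_iff zero_less_Suc zero_less_divide_1_iff)
  qed
  then obtain p where p: "\<And>n. real_polynomial_function (p n)"
    "\<And>n s. s \<in> {-1..1} \<Longrightarrow> \<bar>\<phi> n s - p n s\<bar> < 1 / Suc n"
    by metis
  show ?thesis
  proof (rule that[OF p(1)])
    fix s :: real assume s: "\<bar>s\<bar> \<le> 1"
    then have s': "s \<in> {-1..1}"
      by auto
    show "\<bar>p n s\<bar> \<le> 2" for n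
    proof -
      have "1 / real (Suc n) \<le> 1"
        by simp
      moreover have "0 \<le> \<phi> n s" "\<phi> n s \<le> 1"
        by (auto simp: \<phi>_def)
      ultimately show ?thesis
        using p(2)[OF s', of n] by linarith
    qed
    have "(\<lambda>n. \<phi> n s) \<longlonglongrightarrow> (if s0 < s then 1 else 0)"
    proof (cases "s0 < s")
      case True
      have "\<forall>\<^sub>F n in sequentially. 1 / (s - s0) \<le> real n"
        by real_asymp
      then have "\<forall>\<^sub>F n in sequentially. \<phi> n s = 1"
        by eventually_elim (use True in \<open>simp add: \<phi>_def field_simps\<close>)
      then show ?thesis
        using True by (simp add: tendsto_eventually)
    next
      case False
      then have "real n * (s - s0) \<le> 0" for n
        by (simp add: mult_le_0_iff)
      then have "\<phi> n s = 0" for n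
        by (simp add: \<phi>_def max_absorb1)
      then show ?thesis
        using False by simp
    qed
    moreover have "(\<lambda>n. p n s - \<phi> n s) \<longlonglongrightarrow> 0"
    proof (rule Lim_null_comparison[OF always_eventually])
      show "\<forall>n. norm (p n s - \<phi> n s) \<le> 1 / Suc n"
        using p(2)[OF s'] by (metis abs_minus_commute less_imp_le real_norm_def)
      show "(\<lambda>n. 1 / real (Suc n)) \<longlonglongrightarrow> 0"
        by (rule LIMSEQ_Suc[OF lim_1_over_n])
    qed
    ultimately have "(\<lambda>n. \<phi> n s + (p n s - \<phi> n s)) \<longlonglongrightarrow> (if s0 < s then 1 else 0) + 0"
      by (rule tendsto_add)
    then show "(\<lambda>n. p n s) \<longlonglongrightarrow> (if s0 < s then 1 else 0)"
      by simp
  qed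
qed

text \<open>By \<open>arc_iff_cos_gt\<close> the indicator is a product of step functions of
  cosines, one for each coordinate; the products of the approximating polynomials are trigonometric
  polynomials bounded by 2^d.\<close>

lemma parseval_pair_box_inside:
  fixes F :: "real^'n \<Rightarrow> complex" and a b :: "real^'n"
  assumes F: "cube_L2 F" and ab: "\<And>i. - pi \<le> a $ i" "\<And>i. a $ i < b $ i" "\<And>i. b $ i \<le> pi"
  shows "parseval_pair F (indicator (box a b))"
proof -
  have "\<exists>p. (\<forall>n. real_polynomial_function (p n)) \<and> (\<forall>n s. \<bar>s\<bar> \<le> 1 \<longrightarrow> \<bar>p n s\<bar> \<le> (2::real)) \<and>
    (\<forall>s. \<bar>s\<bar> \<le> 1 \<longrightarrow> (\<lambda>n. p n s) \<longlonglongrightarrow> (if cos ((b $ i - a $ i) / 2) < s then 1 else 0))" for i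
    using polynomial_approx_step[of "cos ((b $ i - a $ i) / 2)"] by metis
  then obtain p where p: "\<And>i n. real_polynomial_function (p i n)"
    "\<And>i n s. \<bar>s\<bar> \<le> 1 \<Longrightarrow> \<bar>p i n s\<bar> \<le> (2::real)"
    "\<And>i s. \<bar>s\<bar> \<le> 1 \<Longrightarrow> (\<lambda>n. p i n s) \<longlonglongrightarrow> (if cos ((b $ i - a $ i) / 2) < s then 1 else 0)"
    by metis
  define G where "G n \<xi> = (\<Prod>i\<in>UNIV. complex_of_real (p i n (cos (\<xi> $ i - (a $ i + b $ i) / 2))))" for n and \<xi> :: "real^'n"
  have trig: "trig_poly (G n)" for n
    unfolding G_def[abs_def] by (intro trig_poly_prod trig_poly_polynomial_cos p) auto
  show ?thesis
  proof (rule parseval_pair_limit[OF F, where G=G and B="2 ^ CARD('n)"])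
    show "parseval_pair F (G n)" for n
      by (rule parseval_pair_trig_poly[OF trig F])
    show "G n \<in> borel_measurable borel" for n
      using bounded_meas_trig_poly[OF trig] by (auto simp: bounded_meas_def)
    show "norm (G n \<xi>) \<le> 2 ^ CARD('n)" for n \<xi>
    proof -
      have "norm (G n \<xi>) = (\<Prod>i\<in>UNIV. \<bar>p i n (cos (\<xi> $ i - (a $ i + b $ i) / 2))\<bar>)"
        by (simp add: G_def prod_norm[symmetric])
      also have "\<dots> \<le> (\<Prod>i\<in>(UNIV :: 'n set). 2)"
        by (intro prod_mono) (auto intro: p)
      finally show ?thesis by simp
    qed
    show "bounded_meas (indicator (box a b))"
      by (rule bounded_meas_indicator) simp
    show "AE \<xi> in cube_measure. (\<lambda>n. G n \<xi>) \<longlonglongrightarrow> indicator (box a b) \<xi>"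
    proof (rule AE_I2)
      fix \<xi> :: "real^'n" assume "\<xi> \<in> space cube_measure"
      then have \<xi>: "- pi \<le> \<xi> $ i" "\<xi> $ i < pi" for i
        by (auto simp: per_cube_def)
      have "(\<lambda>n. G n \<xi>) \<longlonglongrightarrow>
        (\<Prod>i\<in>UNIV. complex_of_real (if cos ((b $ i - a $ i) / 2) < cos (\<xi> $ i - (a $ i + b $ i) / 2) then 1 else 0))"
        unfolding G_def by (intro tendsto_prod tendsto_of_real p(3)) auto
      also have "(\<Prod>i\<in>UNIV. complex_of_real (if cos ((b $ i - a $ i) / 2) < cos (\<xi> $ i - (a $ i + b $ i) / 2) then 1 else 0))
         = indicator (box a b) \<xi>"
        using arc_iff_cos_gt[OF ab \<xi>] by (auto simp: indicator_def mem_box_cart)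
      finally show "(\<lambda>n. G n \<xi>) \<longlonglongrightarrow> indicator (box a b) \<xi>" .
    qed
  qed
qed

lemma parseval_pair_0: "parseval_pair F (\<lambda>\<xi>. 0)"
  using parseval_pair_cmult[OF parseval_pair_cis, of F 0] by simp

text \<open>Clipping the box to the cube changes its indicator, within the cube, only on the
  faces.\<close>

lemma parseval_pair_box:
  fixes F :: "real^'n \<Rightarrow> complex" and a b :: "real^'n"
  assumes F: "cube_L2 F"
  shows "parseval_pair F (indicator (box a b))"
proof -
  define a' b' :: "real^'n" where "a' = (\<chi> i. max (a $ i) (- pi))" and "b' = (\<chi> i. min (b $ i) pi)"
  have m: "indicator (box u v) \<in> borel_measurable (cube_measure :: (real^'n) measure)" for u v
    by (rule borel_measurable_cube) simp
  have ae: "AE \<xi> in cube_measure. indicator (box a' b') \<xi> = (indicator (box a b) \<xi> :: complex)"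
    using AE_cube_interior by eventually_elim (auto simp: indicator_def mem_box_cart a'_def b'_def)
  have "parseval_pair F (indicator (box a' b'))"
  proof (cases "\<forall>i. a' $ i < b' $ i")
    case True
    then show ?thesis
      by (intro parseval_pair_box_inside F) (auto simp: a'_def b'_def)
  next
    case False
    then have "box a' b' = {}"
      by (auto simp: mem_box_cart set_eq_iff) (meson less_trans)
    then show ?thesis
      using parseval_pair_0[of F] by (simp add: indicator_def[abs_def])
  qed
  then show ?thesis
    using parseval_pair_cong_AE[OF _ ae] F m by blast
qed

text \<open>Dynkin's theorem: open boxes form an intersection-stable generator, and the sets with
  Parseval's identity are closed under complements and countable disjoint unions, the latter by
  \<open>parseval_pair_limit\<close>.\<close>

lemma parseval_pair_borel:
  fixes F :: "real^'n \<Rightarrow> complex"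
  assumes F: "cube_L2 F" and A: "A \<in> sets borel"
  shows "parseval_pair F (indicator A)"
proof -
  have L2: "cube_L2 (indicator A)" if "A \<in> sets borel" for A :: "(real^'n) set"
    using that by (intro cube_L2_bounded_meas bounded_meas_indicator)
  have sets: "sets borel = sigma_sets UNIV (range (\<lambda>(a, b). box a b :: (real^'n) set))"
    by (subst borel_eq_box) (simp add: sets_measure_of)
  let ?G = "range (\<lambda>(a, b). box a b :: (real^'n) set)"
  have "Int_stable ?G"
    by (auto simp: Int_stable_def box_Int_box)
  moreover have "?G \<subseteq> Pow UNIV"
    by simp
  moreover have "A \<in> sigma_sets UNIV ?G"
    using A sets by simp
  ultimately show ?thesis
  proof (induction rule: sigma_sets_induct_disjoint)
    case (basic A)
    then show ?case
      using parseval_pair_box[OF F] by auto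
  next
    case empty
    then show ?case
      using parseval_pair_0[of F] by (simp add: indicator_def[abs_def])
  next
    case (compl A)
    then have A: "A \<in> sets borel"
      using sets by simp
    have one: "parseval_pair F (\<lambda>\<xi>. 1)"
      using parseval_pair_trig_poly[OF trig_poly_const F] .
    have "parseval_pair F (\<lambda>\<xi>. 1 + (-1) * indicator A \<xi>)"
    proof (rule parseval_pair_add[OF F _ _ one parseval_pair_cmult[OF compl.IH]])
      show "cube_L2 (\<lambda>\<xi>. 1)"
        using cube_L2_bounded_meas[OF bounded_meas_trig_poly[OF trig_poly_const]] .
      show "cube_L2 (\<lambda>\<xi>. - 1 * indicator A \<xi>)"
        by (intro cube_L2_bounded_meas bounded_meas_cmult bounded_meas_indicator A)
    qed
    moreover have "(\<lambda>\<xi>. 1 + (-1) * indicator A \<xi>) = (indicator (UNIV - A) :: real^'n \<Rightarrow> complex)"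
      by (auto simp: fun_eq_iff indicator_def)
    ultimately show ?case
      by simp
  next
    case (union A)
    have A: "A i \<in> sets borel" for i
      using union sets by auto
    define G where "G n = (indicator (\<Union>i<n. A i) :: real^'n \<Rightarrow> complex)" for n
    have G: "parseval_pair F (G n)" for n
    proof (induction n)
      case 0
      then show ?case
        using parseval_pair_0[of F] by (simp add: G_def indicator_def[abs_def])
    next
      case (Suc n)
      have "parseval_pair F (\<lambda>\<xi>. G n \<xi> + indicator (A n) \<xi>)"
        using A by (intro parseval_pair_add F L2 Suc union.IH) (auto simp: G_def intro!: L2)
      moreover have "(\<lambda>\<xi>. G n \<xi> + indicator (A n) \<xi>) = G (Suc n)"
      proof -
        have "\<xi> \<notin> A i" if "\<xi> \<in> A n" "i < n" for \<xi> i
          using union.hyps(1) that unfolding disjoint_family_on_def by (metis IntI UNIV_I empty_iff less_not_refl)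
        then show ?thesis
          by (auto simp: fun_eq_iff G_def indicator_def lessThan_Suc)
      qed
      ultimately show ?case
        by simp
    qed
    show ?case
    proof (rule parseval_pair_limit[OF F G, where B=1])
      show "G n \<in> borel_measurable borel" for n
        using A by (auto simp: G_def)
      show "norm (G n \<xi>) \<le> 1" for n \<xi>
        by (simp add: G_def indicator_def)
      show "bounded_meas (indicator (\<Union>i. A i))"
        using A by (intro bounded_meas_indicator) auto
      show "AE \<xi> in cube_measure. (\<lambda>n. G n \<xi>) \<longlonglongrightarrow> indicator (\<Union>i. A i) \<xi>"
        unfolding G_def by (intro AE_I2 LIMSEQ_indicator_UN)
    qed
  qed
qed

text \<open>The function to be inserted, a periodisation of the symbol times a character, is known
  only to be measurable and almost everywhere bounded; hence the passage through simple
  functions.\<close>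

theorem parseval_pair_bounded:
  fixes F :: "real^'n \<Rightarrow> complex"
  assumes F: "cube_L2 F" and H: "bounded_meas H"
  shows "parseval_pair F H"
proof -
  obtain B where [measurable]: "H \<in> borel_measurable borel" and B: "\<And>\<xi>. norm (H \<xi>) \<le> B"
    using H by (auto simp: bounded_meas_def)
  obtain G where G: "\<And>n. simple_function borel (G n)" "\<And>\<xi>. (\<lambda>n. G n \<xi>) \<longlonglongrightarrow> H \<xi>"
    "\<And>n \<xi>. dist (G n \<xi>) 0 \<le> 2 * dist (H \<xi>) 0"
    using borel_measurable_implies_sequence_metric[of H borel 0] by auto
  show ?thesis
  proof (rule parseval_pair_limit[OF F, where G=G and B="2 * B"])
    show "parseval_pair F (G n)" for n
    proof -
      have fin: "finite (range (G n))" and m: "G n -` {y} \<in> sets borel" for y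
        using simple_functionD[OF G(1)[of n]] by simp_all
      have "parseval_pair F (\<lambda>\<xi>. \<Sum>y\<in>Y. y * indicator (G n -` {y}) \<xi>) \<and> bounded_meas (\<lambda>\<xi>. \<Sum>y\<in>Y. y * indicator (G n -` {y}) \<xi>)"
        if "finite Y" for Y
        using that
      proof induction
        case empty
        then show ?case
          using parseval_pair_0[of F] bounded_meas_trig_poly[OF trig_poly_const, of 0] by simp
      next
        case (insert y Y)
        have b: "bounded_meas (\<lambda>\<xi>. y * indicator (G n -` {y}) \<xi>)"
          by (intro bounded_meas_cmult bounded_meas_indicator m)
        show ?case
          unfolding sum.insert[OF insert.hyps] using insert.IH
          by (intro conjI bounded_meas_add b parseval_pair_add[OF F] cube_L2_bounded_meas parseval_pair_cmult
              parseval_pair_borel[OF F] m) blast+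
      qed
      from this[OF fin] have "parseval_pair F (\<lambda>\<xi>. \<Sum>y\<in>range (G n). y * indicator (G n -` {y}) \<xi>)"
        by simp
      moreover have "(\<Sum>y\<in>range (G n). y * indicator (G n -` {y}) \<xi>) = G n \<xi>" for \<xi>
      proof -
        have "(\<Sum>y\<in>range (G n). y * indicator (G n -` {y}) \<xi>) = (\<Sum>y\<in>range (G n). if y = G n \<xi> then y else 0)"
          by (intro sum.cong) (auto simp: indicator_def)
        then show ?thesis
          using fin by simp
      qed
      ultimately show ?thesis
        by simp
    qed
    show "G n \<in> borel_measurable borel" for n
      by (rule borel_measurable_simple_function[OF G(1)])
    show "norm (G n \<xi>) \<le> 2 * B" for n \<xi>
      using G(3)[of n \<xi>] B[of \<xi>] by simp
    show "AE \<xi> in cube_measure. (\<lambda>n. G n \<xi>) \<longlonglongrightarrow> H \<xi>"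
      using G(2) by simp
  qed (rule H)
qed

section \<open>The symbol of the cardinal function\<close>

lemma cosh_ge_quadratic: "t\<^sup>2 / 4 \<le> cosh t" for t :: real
proof -
  have "\<bar>t\<bar>\<^sup>2 / 2 \<le> exp \<bar>t\<bar>"
    using exp_lower_Taylor_quadratic[of "\<bar>t\<bar>"] by simp
  moreover have "exp \<bar>t\<bar> \<le> 2 * cosh t"
    by (cases "t \<ge> 0") (auto simp: cosh_def)
  ultimately show ?thesis
    by simp
qed

lemma cosh_le_exp_abs: "cosh t \<le> exp \<bar>t\<bar>" for t :: real
proof (cases "t \<ge> 0")
  case True
  then have "exp (- t) \<le> exp t" by simp
  with True show ?thesis by (simp add: cosh_def)
next
  case False
  then have "exp t \<le> exp (- t)" by simp
  with False show ?thesis by (simp add: cosh_def)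
qed

lemma borel_measurable_cosh [measurable]: "(cosh :: real \<Rightarrow> real) \<in> borel_measurable borel"
  by (intro borel_measurable_continuous_onI continuous_intros)

definition bessel_integrand :: "real \<Rightarrow> real \<Rightarrow> real \<Rightarrow> real" where
  "bessel_integrand \<nu> r t = indicator {0..} t *\<^sub>R (exp (- r * cosh t) * cosh (\<nu> * t))"

lemma bessel_K_eq: "bessel_K \<nu> r = (\<integral>t. bessel_integrand \<nu> r t \<partial>lborel)"
  by (simp add: bessel_K_def set_lebesgue_integral_def bessel_integrand_def)

lemma bessel_integrand_nonneg: "0 \<le> bessel_integrand \<nu> r t"
  by (simp add: bessel_integrand_def)

text \<open>A Gaussian majorant: cosh t \<ge> t^2 / 4 in the exponent beats the factor cosh (\<nu>
  t) \<le> exp |\<nu> t|.\<close>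

lemma integrable_bessel_integrand:
  assumes r: "r > 0"
  shows "integrable lborel (bessel_integrand \<nu> r)"
proof -
  have "integrable lborel (\<lambda>t::real. exp (2 * \<nu>\<^sup>2 / r) * gauss (sqrt r / 2) t)"
    using integrable_gauss_real[of "sqrt r / 2" 0] r
    by (intro integrable_mult_right) (simp add: complex_of_real_integrable_eq)
  then show ?thesis
  proof (rule Bochner_Integration.integrable_bound)
    show "bessel_integrand \<nu> r \<in> borel_measurable lborel"
      unfolding bessel_integrand_def[abs_def] by measurable
    show "AE t in lborel. norm (bessel_integrand \<nu> r t) \<le> norm (exp (2 * \<nu>\<^sup>2 / r) * gauss (sqrt r / 2) t)"
    proof (rule AE_I2)
      fix t :: real
      have "exp (- r * cosh t) * cosh (\<nu> * t) \<le> exp (2 * \<nu>\<^sup>2 / r) * gauss (sqrt r / 2) t"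
      proof -
        have "exp (- r * cosh t) * cosh (\<nu> * t) \<le> exp (- r * (t\<^sup>2 / 4)) * exp \<bar>\<nu> * t\<bar>"
          using r cosh_ge_quadratic[of t] by (intro mult_mono cosh_le_exp_abs) auto
        also have "\<dots> = exp (- r * (t\<^sup>2 / 4) + \<bar>\<nu> * t\<bar>)"
          by (rule exp_add[symmetric])
        also have "- r * (t\<^sup>2 / 4) + \<bar>\<nu> * t\<bar> \<le> 2 * \<nu>\<^sup>2 / r - r * t\<^sup>2 / 8"
        proof -
          \<comment> \<open>Completing the square: half of the quadratic term r t^2 / 4 absorbs
            |\<nu> t| up to a constant.\<close>
          have "0 \<le> (4 * \<bar>\<nu>\<bar> - r * \<bar>t\<bar>)\<^sup>2 / (8 * r)"
            using r by simp
          also have "\<dots> = 2 * \<bar>\<nu>\<bar>\<^sup>2 / r + r * \<bar>t\<bar>\<^sup>2 / 8 - \<bar>\<nu>\<bar> * \<bar>t\<bar>"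
          proof -
            have "(4 * x - r * y)\<^sup>2 / (8 * r) = 2 * x\<^sup>2 / r + r * y\<^sup>2 / 8 - x * y" for x y
              using r by (simp add: power2_eq_square field_simps)
            then show ?thesis .
          qed
          finally show ?thesis
            by (simp add: abs_mult)
        qed
        also have "exp (2 * \<nu>\<^sup>2 / r - r * t\<^sup>2 / 8) = exp (2 * \<nu>\<^sup>2 / r) * gauss (sqrt r / 2) t"
          using r by (simp add: gauss_def exp_add[symmetric] power_divide)
        finally show ?thesis by simp
      qed
      then show "norm (bessel_integrand \<nu> r t) \<le> norm (exp (2 * \<nu>\<^sup>2 / r) * gauss (sqrt r / 2) t)"
        by (simp add: bessel_integrand_def abs_mult gauss_pos less_imp_le split: split_indicator)
    qed
  qed
qed

text \<open>A nonnegative function with integral 0 vanishes almost everywhere, but the integrand is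
  positive on the unit interval.\<close>

lemma bessel_K_pos:
  assumes "r > 0"
  shows "bessel_K \<nu> r > 0"
proof -
  have "bessel_K \<nu> r \<noteq> 0"
  proof
    assume "bessel_K \<nu> r = 0"
    then have "AE t in lborel. bessel_integrand \<nu> r t = 0"
      unfolding bessel_K_eq
      by (subst (asm) integral_nonneg_eq_0_iff_AE[OF integrable_bessel_integrand[OF assms]])
        (auto simp: bessel_integrand_nonneg)
    then have "AE t in lborel. (t::real) \<notin> {0..1}"
    proof eventually_elim
      case (elim t)
      then show ?case
        by (auto simp: bessel_integrand_def cosh_real_pos)
    qed
    then have "emeasure lborel {0..1::real} = 0"
      by (subst (asm) AE_iff_measurable[of "{0..1}"]) auto
    then show False
      by simp
  qed
  moreover have "bessel_K \<nu> r \<ge> 0"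
    unfolding bessel_K_eq by (intro integral_nonneg_AE) (simp add: bessel_integrand_nonneg)
  ultimately show ?thesis
    by simp
qed

text \<open>Since cosh t \<ge> 1, passing from r to s multiplies the integrand at every t by at most
  exp (- (s - r)).\<close>

lemma bessel_K_decay:
  assumes "0 < r" "r \<le> s"
  shows "bessel_K \<nu> s \<le> exp (- (s - r)) * bessel_K \<nu> r"
proof -
  have "bessel_K \<nu> s \<le> (\<integral>t. exp (- (s - r)) * bessel_integrand \<nu> r t \<partial>lborel)"
    unfolding bessel_K_eq
  proof (rule integral_mono)
    fix t :: real
    have "(s - r) * 1 \<le> (s - r) * cosh t"
      using assms by (intro mult_left_mono cosh_real_ge_1) auto
    then have "exp (- s * cosh t) \<le> exp (- (s - r)) * exp (- r * cosh t)"
      by (simp add: exp_add[symmetric] algebra_simps)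
    from mult_right_mono[OF this, of "cosh (\<nu> * t)"]
    show "bessel_integrand \<nu> s t \<le> exp (- (s - r)) * bessel_integrand \<nu> r t"
      by (simp add: bessel_integrand_def mult.assoc split: split_indicator)
  qed (use assms in \<open>auto intro!: integrable_bessel_integrand\<close>)
  then show ?thesis
    by (simp add: bessel_K_eq)
qed

lemma borel_measurable_bessel_K [measurable]: "bessel_K \<nu> \<in> borel_measurable borel"
  unfolding bessel_K_eq[abs_def] bessel_integrand_def by measurable

text \<open>\<open>multiquadric_hat\<close> without its constant factor. That factor may be negative
  and cancels in the quotient, whereas the profile is positive.\<close>

definition radial_profile :: "real \<Rightarrow> real \<Rightarrow> real \<Rightarrow> real" where
  "radial_profile \<nu> c r = (c / r) powr \<nu> * bessel_K \<nu> (c * r)"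

lemma multiquadric_hat_eq:
  "multiquadric_hat \<alpha> c (\<xi> :: real^'n) =
    2 powr (1 + \<alpha>) / Gamma (- \<alpha>) * radial_profile (\<alpha> + real CARD('n) / 2) c (norm \<xi>)"
  by (simp add: multiquadric_hat_def radial_profile_def)

lemma radial_profile_pos: "c > 0 \<Longrightarrow> r > 0 \<Longrightarrow> radial_profile \<nu> c r > 0"
  by (simp add: radial_profile_def bessel_K_pos)

lemma radial_profile_ratio_le:
  assumes c: "c > 0" and rs: "0 < r" "r \<le> s"
  shows "radial_profile \<nu> c s / radial_profile \<nu> c r \<le> (r / s) powr \<nu> * exp (- c * (s - r))"
proof -
  have "(c / s) powr \<nu> = (c / r) powr \<nu> * (r / s) powr \<nu>"
    using c rs by (simp add: powr_mult[symmetric])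
  moreover have "bessel_K \<nu> (c * s) \<le> exp (- c * (s - r)) * bessel_K \<nu> (c * r)"
    using bessel_K_decay[of "c * r" "c * s" \<nu>] c rs by (simp add: algebra_simps)
  ultimately have "radial_profile \<nu> c s \<le> (c / r) powr \<nu> * (r / s) powr \<nu> * (exp (- c * (s - r)) * bessel_K \<nu> (c * r))"
    unfolding radial_profile_def by (auto intro!: mult_left_mono)
  also have "\<dots> = (r / s) powr \<nu> * exp (- c * (s - r)) * radial_profile \<nu> c r"
    by (simp add: radial_profile_def mult_ac)
  finally show ?thesis
    using radial_profile_pos[OF c rs(1), of \<nu>] by (simp add: pos_divide_le_eq)
qed

text \<open>The order \<nu> can be negative, and then the ratio grows like a power of s. Bounding it
  by a multiple of exp (s / 2) gives away only half of a decay exp (- s).\<close>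

lemma powr_le_exp:
  fixes r :: real
  assumes r: "r > 0"
  shows "\<exists>K>0. \<forall>s\<ge>r. (r / s) powr \<nu> \<le> K * exp (s / 2)"
proof -
  define n where "n = nat \<lceil>\<bar>\<nu>\<bar>\<rceil>"
  have n: "\<bar>\<nu>\<bar> \<le> real n"
    unfolding n_def by linarith
  show ?thesis
  proof (intro exI conjI allI impI)
    show "(2 / r) ^ n * fact n > 0"
      using r by simp
    fix s assume s: "r \<le> s"
    have "(r / s) powr \<nu> = (s / r) powr (- \<nu>)"
    proof -
      have "inverse (s / r) powr \<nu> = inverse ((s / r) powr \<nu>)"
        by (rule inverse_powr)
      then show ?thesis
        by (simp only: powr_minus inverse_divide)
    qed
    also have "\<dots> \<le> (s / r) powr real n"
      using r s n by (intro powr_mono) auto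
    also have "\<dots> = (2 / r) ^ n * (s / 2) ^ n"
      using r s unfolding power_mult_distrib[symmetric] by (simp add: powr_realpow)
    also have "\<dots> \<le> (2 / r) ^ n * (fact n * exp (s / 2))"
      using r s by (intro mult_left_mono power_le_fact_exp) auto
    finally show "(r / s) powr \<nu> \<le> (2 / r) ^ n * fact n * exp (s / 2)"
      by (simp add: mult_ac)
  qed
qed

lemma integrable_exp_abs:
  assumes "a > 0"
  shows "integrable lborel (\<lambda>t::real. exp (- a * \<bar>t\<bar>))"
proof -
  have 1: "integrable lborel (\<lambda>t::real. indicator {0..} t * exp (- t))"
    by (rule integrableI_bounded)
      (use nn_intergal_power_times_exp_Ici[of 0] in \<open>auto simp: ennreal_mult ennreal_indicator mult.commute\<close>)
  have 2: "integrable lborel (\<lambda>t::real. indicator {0..} (c * t) * exp (- (c * t)))" if "c \<noteq> 0" for c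
    using lborel_integrable_real_affine[OF 1 that, of 0] by simp
  have "integrable lborel (\<lambda>t::real. indicator {0..} (a * t) * exp (- (a * t)) + indicator {0..} (- a * t) * exp (- (- a * t)))"
    using assms by (intro Bochner_Integration.integrable_add 2) auto
  then show ?thesis
    by (rule Bochner_Integration.integrable_bound)
      (use assms in \<open>auto intro!: AE_I2 simp: indicator_def abs_if zero_le_mult_iff mult_le_0_iff\<close>)
qed

text \<open>The sum of the coordinate moduli is at most d times the Euclidean norm, which gives a
  majorant that factors over the coordinates. The purpose is to periodise this function: its lattice
  sums are finite almost everywhere.\<close>

lemma integrable_exp_norm: "integrable lborel (\<lambda>\<xi>::real^'n. exp (- norm \<xi> / 2))"
proof -
  define a where "a = 1 / (2 * real CARD('n))"
  have a: "a > 0"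
    by (simp add: a_def)
  have "integrable lborel (\<lambda>\<xi>::real^'n. \<Prod>i\<in>UNIV. exp (- a * \<bar>\<xi> $ i\<bar>))"
    by (intro integrable_lborel_prod_vec integrable_exp_abs a)
  then show ?thesis
  proof (rule Bochner_Integration.integrable_bound)
    show "AE \<xi>::real^'n in lborel. norm (exp (- norm \<xi> / 2)) \<le> norm (\<Prod>i\<in>UNIV. exp (- a * \<bar>\<xi> $ i\<bar>))"
    proof (rule AE_I2)
      fix \<xi> :: "real^'n"
      have "(\<Sum>i\<in>UNIV. \<bar>\<xi> $ i\<bar>) \<le> real CARD('n) * norm \<xi>"
        using sum_bounded_above[of UNIV "\<lambda>i. \<bar>\<xi> $ i\<bar>" "norm \<xi>"] component_le_norm_cart[of \<xi>] by simp
      then have "a * (\<Sum>i\<in>UNIV. \<bar>\<xi> $ i\<bar>) \<le> norm \<xi> / 2"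
        by (simp add: a_def field_simps)
      then show "norm (exp (- norm \<xi> / 2)) \<le> norm (\<Prod>i\<in>UNIV. exp (- a * \<bar>\<xi> $ i\<bar>))"
        by (simp add: exp_sum[symmetric] sum_negf sum_distrib_left[symmetric])
    qed
  qed simp
qed

text \<open>A shifted coordinate moves by at least 2 \<pi> from a place of modulus below \<pi>, so
  its modulus grows strictly; the other coordinates stay.\<close>

lemma norm_less_norm_add_per_shift:
  fixes \<xi> :: "real^'n"
  assumes \<xi>: "\<xi> \<in> box (\<chi> i. - pi) (\<chi> i. pi)" and j: "j \<noteq> 0"
  shows "norm \<xi> < norm (\<xi> + per_shift j)"
proof -
  have comp: "\<bar>\<xi> $ i\<bar> < \<bar>(\<xi> + per_shift j) $ i\<bar>" if "j $ i \<noteq> 0" for i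
  proof -
    have "1 \<le> \<bar>real_of_int (j $ i)\<bar>"
      using that by linarith
    then have "2 * pi * 1 \<le> 2 * pi * \<bar>real_of_int (j $ i)\<bar>"
      by (intro mult_left_mono) auto
    moreover have "\<bar>\<xi> $ i\<bar> < pi"
      using \<xi> by (auto simp: mem_box_cart abs_less_iff) (smt (verit))
    moreover have "\<bar>2 * pi * real_of_int (j $ i)\<bar> = 2 * pi * \<bar>real_of_int (j $ i)\<bar>"
      by (simp add: abs_mult)
    ultimately show ?thesis
      by (simp, linarith)
  qed
  obtain i where i: "j $ i \<noteq> 0"
    using j by (auto simp: vec_eq_iff)
  have "(\<Sum>i\<in>UNIV. (\<xi> $ i)\<^sup>2) < (\<Sum>i\<in>UNIV. ((\<xi> + per_shift j) $ i)\<^sup>2)"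
  proof (rule sum_strict_mono_ex1)
    show "\<forall>i\<in>UNIV. (\<xi> $ i)\<^sup>2 \<le> ((\<xi> + per_shift j) $ i)\<^sup>2"
    proof
      fix i
      show "(\<xi> $ i)\<^sup>2 \<le> ((\<xi> + per_shift j) $ i)\<^sup>2"
        using comp[of i] by (cases "j $ i = 0") (auto simp: abs_le_square_iff[symmetric])
    qed
    show "\<exists>i\<in>UNIV. (\<xi> $ i)\<^sup>2 < ((\<xi> + per_shift j) $ i)\<^sup>2"
      using comp[OF i] abs_le_square_iff[of "(\<xi> + per_shift j) $ i" "\<xi> $ i"] by (auto simp: not_le[symmetric])
  qed simp
  then show ?thesis
    by (simp add: norm_vec_def L2_set_def)
qed

text \<open>Independent of c and \<alpha>, so that a single null set is discarded for all c. The
  integrability condition supplies the summable majorant of the lattice sums.\<close>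

definition good_freq :: "(real^'n) set" where
  "good_freq = {\<xi>. \<xi> \<in> box (\<chi> i. - pi) (\<chi> i. pi) \<and> \<xi> \<noteq> 0
     \<and> integrable (count_space UNIV) (\<lambda>j. exp (- norm (\<xi> + per_shift j) / 2))}"

lemma AE_good_freq: "AE \<xi> in cube_measure. \<xi> \<in> good_freq"
proof -
  have "AE \<xi> in cube_measure. (\<xi> :: real^'n) \<noteq> 0"
    using AE_lborel_singleton[of "0 :: real^'n"] by (subst AE_restrict_space_iff) auto
  with AE_cube_interior AE_cube_integrable_periodize[OF integrable_exp_norm] show ?thesis
    by eventually_elim (auto simp: good_freq_def)
qed

section \<open>Lattice sums at a fixed good frequency\<close>

locale good_frequency =
  fixes \<alpha> :: real and \<xi> :: "real^'n"
  assumes alpha: "\<alpha> \<notin> \<nat>" and good: "\<xi> \<in> good_freq"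
begin

definition "\<nu> = \<alpha> + real CARD('n) / 2"

definition "dist_at j = norm (\<xi> + per_shift j)"

definition "prof c j = radial_profile \<nu> c (dist_at j)"

lemma norm_pos: "norm \<xi> > 0"
  using good by (simp add: good_freq_def)

lemma dist_at_0: "dist_at 0 = norm \<xi>"
  by (simp add: dist_at_def)

lemma dist_at_less: "j \<noteq> 0 \<Longrightarrow> dist_at 0 < dist_at j"
  unfolding dist_at_0 using norm_less_norm_add_per_shift[of \<xi> j] good
  by (simp add: good_freq_def dist_at_def)

lemma dist_at_le: "dist_at 0 \<le> dist_at j"
  using dist_at_less[of j] by (cases "j = 0") auto

lemma dist_at_pos: "dist_at j > 0"
  using dist_at_le[of j] norm_pos dist_at_0 by linarith

lemma prof_pos: "c > 0 \<Longrightarrow> prof c j > 0"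
  by (simp add: prof_def radial_profile_pos dist_at_pos)

text \<open>For c \<ge> 1 the decay factor is at most the one for c = 1, so K depends neither on c
  nor on j. Half of the decay pays for the power factor.\<close>

lemma ratio_bound:
  "\<exists>K\<ge>0. \<forall>c\<ge>1. \<forall>j. prof c j / prof c 0 \<le> K * exp (- dist_at j / 2)"
proof -
  obtain K where K: "K > 0" "\<And>s. s \<ge> dist_at 0 \<Longrightarrow> (dist_at 0 / s) powr \<nu> \<le> K * exp (s / 2)"
    using powr_le_exp[OF dist_at_pos[of 0], of \<nu>] by blast
  have "prof c j / prof c 0 \<le> (K * exp (dist_at 0)) * exp (- dist_at j / 2)" if c: "c \<ge> 1" for c j
  proof -
    have "prof c j / prof c 0 \<le> (dist_at 0 / dist_at j) powr \<nu> * exp (- c * (dist_at j - dist_at 0))"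
      unfolding prof_def using c by (intro radial_profile_ratio_le dist_at_pos dist_at_le) auto
    also have "\<dots> \<le> (K * exp (dist_at j / 2)) * exp (- (dist_at j - dist_at 0))"
    proof (intro mult_mono K(2) dist_at_le)
      have "1 * (dist_at j - dist_at 0) \<le> c * (dist_at j - dist_at 0)"
        using c dist_at_le[of j] by (intro mult_right_mono) auto
      then show "exp (- c * (dist_at j - dist_at 0)) \<le> exp (- (dist_at j - dist_at 0))"
        by simp
    qed (use K(1) in auto)
    also have "\<dots> = K * (exp (dist_at j / 2) * exp (- (dist_at j - dist_at 0)))"
      by simp
    also have "exp (dist_at j / 2) * exp (- (dist_at j - dist_at 0)) = exp (dist_at 0) * exp (- dist_at j / 2)"
      unfolding exp_add[symmetric] by (simp add: field_simps)
    finally show ?thesis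
      by (simp add: mult.assoc)
  qed
  moreover have "K * exp (dist_at 0) \<ge> 0"
    using K(1) by simp
  ultimately show ?thesis
    by blast
qed

lemma integrable_exp_dist: "integrable (count_space UNIV) (\<lambda>j. exp (- dist_at j / 2))"
  using good by (simp add: good_freq_def dist_at_def)

lemma integrable_ratio:
  assumes "c \<ge> 1"
  shows "integrable (count_space UNIV) (\<lambda>j. prof c j / prof c 0)"
proof -
  obtain K where K: "K \<ge> 0" "\<And>j. prof c j / prof c 0 \<le> K * exp (- dist_at j / 2)"
    using ratio_bound assms by blast
  have K: "norm (prof c j / prof c 0) \<le> norm (K * exp (- dist_at j / 2))" for j
    using K prof_pos[of c] assms by (simp add: abs_of_pos)
  show ?thesis
    by (rule Bochner_Integration.integrable_bound[OF integrable_mult_right[OF integrable_exp_dist, of K]])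
      (use K in auto)
qed

lemma integrable_prof:
  assumes "c \<ge> 1"
  shows "integrable (count_space UNIV) (prof c)"
proof -
  have "integrable (count_space UNIV) (\<lambda>j. prof c 0 * (prof c j / prof c 0))"
    by (intro integrable_mult_right integrable_ratio assms)
  then show ?thesis
    using prof_pos[of c 0] assms by simp
qed

lemma summable_prof: "c \<ge> 1 \<Longrightarrow> prof c summable_on UNIV"
  using integrable_prof[of c] abs_summable_equivalent[of "prof c" UNIV] abs_summable_summable[of "prof c" UNIV]
  by (simp add: abs_summable_on_def)

text \<open>A shift by a period merely reindexes the sum in the denominator, and the constant factor
  cancels; it is nonzero because - \<alpha> is not a pole of Gamma. A good frequency is never
  congruent to 0, so the branch of \<open>cardinal_hat\<close> without \<open>Lim\<close>
  applies.\<close>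

lemma cardinal_hat_eq:
  assumes c: "c \<ge> 1"
  shows "cardinal_hat \<alpha> c (\<xi> + per_shift j) = prof c j / infsum (prof c) UNIV"
proof -
  define C where "C = 2 powr (1 + \<alpha>) / Gamma (- \<alpha>)"
  have "- \<alpha> \<notin> \<int>\<^sub>\<le>\<^sub>0"
  proof
    assume "- \<alpha> \<in> \<int>\<^sub>\<le>\<^sub>0"
    then obtain n where "- \<alpha> = of_int n" "n \<le> 0"
      by (rule nonpos_Ints_cases)
    then have "\<alpha> = real (nat (- n))"
      by simp
    then show False
      using alpha by simp
  qed
  then have C: "C \<noteq> 0"
    by (simp add: C_def Gamma_eq_zero_iff)
  have hat: "multiquadric_hat \<alpha> c (\<xi> + per_shift k) = C * prof c k" for k
    by (simp add: multiquadric_hat_eq C_def prof_def dist_at_def \<nu>_def)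
  have "(\<Sum>\<^sub>\<infinity>k\<in>UNIV. multiquadric_hat \<alpha> c (\<xi> + per_shift j + per_shift k)) = (\<Sum>\<^sub>\<infinity>k\<in>UNIV. C * prof c (j + k))"
    by (simp add: hat per_shift_add[symmetric] add.assoc)
  also have "\<dots> = (\<Sum>\<^sub>\<infinity>k\<in>UNIV. C * prof c k)"
    by (intro infsum_reindex_bij_betw bij_betwI[where g="\<lambda>k. k - j"]) auto
  also have "\<dots> = C * infsum (prof c) UNIV"
    by (rule infsum_cmult_right) (use summable_prof[OF c] in auto)
  finally have "cardinal_quotient \<alpha> c (\<xi> + per_shift j) = prof c j / infsum (prof c) UNIV"
    using C by (simp add: cardinal_quotient_def hat flip: per_shift_def)
  moreover have "\<xi> + per_shift j \<notin> range (\<lambda>k :: int^'n. (2 * pi) *\<^sub>R lattice_pt k)"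
  proof
    assume "\<xi> + per_shift j \<in> range (\<lambda>k :: int^'n. (2 * pi) *\<^sub>R lattice_pt k)"
    then obtain k where "\<xi> + per_shift j = per_shift k"
      by (auto simp: per_shift_def)
    moreover have "per_shift k = per_shift (k - j) + per_shift j"
      by (simp add: per_shift_add[symmetric])
    ultimately have "\<xi> + per_shift (j - k) = 0"
      by (simp add: vec_eq_iff algebra_simps)
    then show False
      using dist_at_pos[of "j - k"] by (simp add: dist_at_def)
  qed
  ultimately show ?thesis
    by (simp add: cardinal_hat_def)
qed

lemma infsum_prof: "c \<ge> 1 \<Longrightarrow> infsum (prof c) UNIV = (\<integral>j. prof c j \<partial>count_space UNIV)"
  using infsetsum_infsum[of "prof c" UNIV] integrable_prof[of c]
  by (simp add: abs_summable_on_def infsetsum_def)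

lemma prof_le_infsum:
  assumes "c \<ge> 1"
  shows "prof c j \<le> infsum (prof c) UNIV"
  using infsum_mono_neutral[of "prof c" "{j}" "prof c" UNIV] summable_prof[OF assms] prof_pos[of c] assms
  by (auto simp: less_imp_le)

lemma cardinal_hat_nonneg: "c \<ge> 1 \<Longrightarrow> 0 \<le> cardinal_hat \<alpha> c (\<xi> + per_shift j)"
  using prof_le_infsum[of c 0] prof_pos[of c 0] prof_pos[of c j]
  by (auto simp: cardinal_hat_eq intro!: divide_nonneg_nonneg)

lemma
  assumes c: "c \<ge> 1"
  shows integrable_cardinal_hat: "integrable (count_space UNIV) (\<lambda>j. cardinal_hat \<alpha> c (\<xi> + per_shift j))"
    and integral_cardinal_hat: "(\<integral>j. cardinal_hat \<alpha> c (\<xi> + per_shift j) \<partial>count_space UNIV) = 1"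
proof -
  have "infsum (prof c) UNIV \<noteq> 0"
    using prof_le_infsum[OF c, of 0] prof_pos[of c 0] c by auto
  then show "(\<integral>j. cardinal_hat \<alpha> c (\<xi> + per_shift j) \<partial>count_space UNIV) = 1"
    by (simp add: cardinal_hat_eq[OF c] infsum_prof[OF c])
  show "integrable (count_space UNIV) (\<lambda>j. cardinal_hat \<alpha> c (\<xi> + per_shift j))"
    unfolding cardinal_hat_eq[OF c] using integrable_prof[OF c] by (rule integrable_divide_zero)
qed

lemma cardinal_hat_shift_le_1:
  assumes c: "c \<ge> 1"
  shows "cardinal_hat \<alpha> c (\<xi> + per_shift j) \<le> 1"
  using prof_le_infsum[OF c, of j] prof_le_infsum[OF c, of 0] prof_pos[of c 0] c
  by (simp add: cardinal_hat_eq[OF c] pos_divide_le_eq)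

lemma cardinal_hat_le_1: "c \<ge> 1 \<Longrightarrow> cardinal_hat \<alpha> c \<xi> \<le> 1"
  using cardinal_hat_shift_le_1[of c 0] by simp

text \<open>The ratios \<open>q\<close> of the off-centre terms to the central one tend to 0 as c
  grows and are dominated uniformly in c \<ge> 1, so their sum tends to 0; the symbol is the
  reciprocal of 1 plus this sum.\<close>

lemma tendsto_cardinal_hat: "((\<lambda>c. cardinal_hat \<alpha> c \<xi>) \<longlongrightarrow> 1) at_top"
proof -
  obtain K where "K \<ge> 0" and K: "\<And>c j. c \<ge> 1 \<Longrightarrow> prof c j / prof c 0 \<le> K * exp (- dist_at j / 2)"
    using ratio_bound by blast
  define q where "q c j = (if j = 0 then 0 else prof c j / prof c 0)" for c j
  have "((\<lambda>c. \<integral>j. q c j \<partial>count_space UNIV) \<longlongrightarrow> (\<integral>j. 0 \<partial>count_space (UNIV :: (int^'n) set))) at_top"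
  proof (rule integral_dominated_convergence_at_top[where w="\<lambda>j. K * exp (- dist_at j / 2)"])
    show "AE j in count_space UNIV. ((\<lambda>c. q c j) \<longlongrightarrow> 0) at_top"
    proof (rule AE_I2)
      fix j :: "int^'n"
      show "((\<lambda>c. q c j) \<longlongrightarrow> 0) at_top"
      proof (cases "j = 0")
        case False
        define b where "b = dist_at j - dist_at 0"
        have "b > 0"
          using dist_at_less[OF False] by (simp add: b_def)
        then have "((\<lambda>c. (dist_at 0 / dist_at j) powr \<nu> * exp (- c * b)) \<longlongrightarrow> 0) at_top"
          by (intro tendsto_mult_right_zero) real_asymp
        then show ?thesis
        proof (rule Lim_null_comparison[rotated])
          show "\<forall>\<^sub>F c in at_top. norm (q c j) \<le> (dist_at 0 / dist_at j) powr \<nu> * exp (- c * b)"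
            using eventually_gt_at_top[of 0]
          proof eventually_elim
            case (elim c)
            then show ?case
              using radial_profile_ratio_le[OF elim dist_at_pos[of 0] dist_at_le[of j], of \<nu>] False
                prof_pos[OF elim, of j] prof_pos[OF elim, of 0]
              by (simp add: q_def prof_def b_def)
          qed
        qed
      qed (simp add: q_def)
    qed
    show "integrable (count_space UNIV) (\<lambda>j. K * exp (- dist_at j / 2))"
      by (intro integrable_mult_right integrable_exp_dist)
    show "\<forall>\<^sub>F c in at_top. AE j in count_space UNIV. norm (q c j) \<le> K * exp (- dist_at j / 2)"
      using eventually_ge_at_top[of 1]
    proof eventually_elim
      case (elim c)
      show ?case
      proof (rule AE_I2)
        fix j
        show "norm (q c j) \<le> K * exp (- dist_at j / 2)"
          using K[OF elim, of j] prof_pos[of c j] prof_pos[of c 0] elim \<open>K \<ge> 0\<close> by (simp add: q_def)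
      qed
    qed
  qed auto
  then have lim: "((\<lambda>c. 1 - (\<integral>j. q c j \<partial>count_space UNIV)) \<longlongrightarrow> 1) at_top"
    using tendsto_diff[OF tendsto_const[of 1]] by fastforce
  show ?thesis
  proof (rule tendsto_sandwich[OF _ _ lim tendsto_const])
    show "\<forall>\<^sub>F c in at_top. 1 - (\<integral>j. q c j \<partial>count_space UNIV) \<le> cardinal_hat \<alpha> c \<xi>"
      using eventually_ge_at_top[of 1]
    proof eventually_elim
      case (elim c)
      define S where "S = infsum (prof c) UNIV / prof c 0"
      have p: "prof c 0 > 0"
        using elim prof_pos[of c 0] by simp
      have S1: "1 \<le> S"
        using prof_le_infsum[OF elim, of 0] p by (simp add: S_def)
      have d: "integrable (count_space UNIV) (indicator {0 :: int^'n} :: _ \<Rightarrow> real)"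
        by (simp add: integrable_indicator_iff)
      have "(\<integral>j. q c j \<partial>count_space UNIV) = (\<integral>j. prof c j / prof c 0 - indicator {0} j \<partial>count_space UNIV)"
        using p by (intro Bochner_Integration.integral_cong) (auto simp: q_def indicator_def)
      also have "\<dots> = S - 1"
        by (subst Bochner_Integration.integral_diff[OF integrable_ratio[OF elim] d])
          (simp add: S_def infsum_prof[OF elim])
      finally have "1 - (\<integral>j. q c j \<partial>count_space UNIV) = 2 - S"
        by simp
      \<comment> \<open>A linear lower bound for the reciprocal lets the squeeze run directly on the
        sum of the ratios.\<close>
      also have "\<dots> \<le> 1 / S"
      proof -
        have "0 \<le> (S - 1)\<^sup>2"
          by simp
        then have "(2 - S) * S \<le> 1"
          by (simp add: power2_eq_square algebra_simps)
        then show ?thesis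
          using S1 by (simp add: pos_le_divide_eq)
      qed
      also have "1 / S = cardinal_hat \<alpha> c \<xi>"
        using cardinal_hat_eq[OF elim, of 0] by (simp add: S_def)
      finally show ?case .
    qed
    show "\<forall>\<^sub>F c in at_top. cardinal_hat \<alpha> c \<xi> \<le> 1"
      using eventually_ge_at_top[of 1] by eventually_elim (rule cardinal_hat_le_1)
  qed
qed

end

text \<open>The default values agree: for real series unordered and absolute convergence coincide,
  and both sides are 0 otherwise. The integral form gives measurability in a parameter.\<close>

lemma infsum_real_eq_integral:
  fixes f :: "'a \<Rightarrow> real"
  shows "infsum f UNIV = (\<integral>x. f x \<partial>count_space UNIV)"
proof (cases "integrable (count_space UNIV) f")
  case True
  then show ?thesis
    using infsetsum_infsum[of f UNIV] by (simp add: abs_summable_on_def infsetsum_def)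
next
  case False
  then have "\<not> f summable_on UNIV"
    using abs_summable_equivalent[of f UNIV] summable_on_iff_abs_summable_on_real[of f UNIV]
    by (simp add: abs_summable_on_def)
  with False show ?thesis
    by (simp add: infsum_not_exists not_integrable_integral_eq)
qed

text \<open>The lattice points, where the value is a \<open>Lim\<close>, form a countable set and so
  do not affect measurability.\<close>

lemma borel_measurable_cardinal_hat [measurable]:
  "(cardinal_hat \<alpha> c :: real^'n \<Rightarrow> real) \<in> borel_measurable borel"
proof -
  interpret C: sigma_finite_measure "count_space (UNIV :: (int^'n) set)"
    by (rule sigma_finite_measure_count_space)
  have [measurable]: "(multiquadric_hat \<alpha> c :: real^'n \<Rightarrow> real) \<in> borel_measurable borel"
    unfolding multiquadric_hat_def by measurable
  have [measurable]: "lattice_pt \<in> count_space UNIV \<rightarrow>\<^sub>M (borel :: (real^'n) measure)"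
    by simp
  have "(cardinal_quotient \<alpha> c :: real^'n \<Rightarrow> real) \<in> borel_measurable borel"
    unfolding cardinal_quotient_def infsum_real_eq_integral by measurable
  then show ?thesis
    by (rule measurable_discrete_difference[where X="range (\<lambda>j :: int^'n. (2 * pi) *\<^sub>R lattice_pt j)"])
      (auto simp: cardinal_hat_def)
qed

section \<open>Convergence of the interpolants\<close>

lemma cis_lattice_per_shift: "cis (lattice_pt k \<bullet> per_shift j) = 1"
proof -
  have "lattice_pt k \<bullet> per_shift j = 2 * pi * real_of_int (\<Sum>i\<in>UNIV. k $ i * j $ i)"
    by (simp add: inner_vec_def sum_distrib_left mult_ac)
  then show ?thesis
    by (simp only: cis_multiple_2pi Ints_of_int)
qed

text \<open>The bound on the \<open>nn_integral\<close> also yields membership in L2, without which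
  \<open>L2_norm\<close> would be infinite.\<close>

lemma L2_norm_le:
  assumes "g \<in> borel_measurable borel" "(\<integral>\<^sup>+x. ennreal ((norm (g x))\<^sup>2) \<partial>lborel) \<le> ennreal E" "0 \<le> E"
  shows "L2_norm g \<le> ennreal (sqrt E)"
proof -
  have g: "in_L2 g"
    using assms le_less_trans[OF assms(2)] by (simp add: in_L2_iff_nn_integral)
  then have "ennreal (\<integral>x. (norm (g x))\<^sup>2 \<partial>lborel) \<le> ennreal E"
    using assms(2) by (subst nn_integral_eq_integral[symmetric]) (auto simp: in_L2_def)
  then have "(\<integral>x. (norm (g x))\<^sup>2 \<partial>lborel) \<le> E"
    using assms(3) by simp
  then show ?thesis
    using g by (simp add: L2_norm_def ennreal_leI)
qed

section \<open>The band-limited function, its samples and its periodised transform\<close>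

locale bandlimited =
  fixes f F :: "real^'n \<Rightarrow> complex"
  assumes fourier: "is_fourier_L2 f F"
    and cont: "continuous_on UNIV f"
    and support: "AE \<xi> in lborel. \<xi> \<notin> cbox (\<chi> i. - pi) (\<chi> i. pi) \<longrightarrow> F \<xi> = 0"
begin

lemma F_L2: "in_L2 F"
  using fourier by (simp add: is_fourier_L2_def)

lemma F_measurable [measurable]: "F \<in> borel_measurable borel"
  using F_L2 by (simp add: in_L2_def)

text \<open>A version of F that vanishes everywhere off the half-open cube, not merely almost
  everywhere, so that its values at shifted points are known exactly.\<close>

definition F0 :: "real^'n \<Rightarrow> complex" where
  "F0 \<xi> = indicator per_cube \<xi> *\<^sub>R F \<xi>"

lemma F0_measurable [measurable]: "F0 \<in> borel_measurable borel"
  unfolding F0_def[abs_def] by measurable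

lemma AE_F0: "AE \<xi> in lborel. F \<xi> = F0 \<xi>"
proof -
  have "AE \<xi> in lborel. \<forall>i. (\<xi> :: real^'n) $ i \<noteq> pi"
    by (intro AE_all_countable[THEN iffD2] allI AE_lborel_nth_neq)
  with support show ?thesis
  proof eventually_elim
    case (elim \<xi>)
    show ?case
    proof (cases "\<xi> \<in> cbox (\<chi> i. - pi) (\<chi> i. pi)")
      case True
      then have "\<xi> \<in> per_cube"
        using elim(2) by (auto simp: per_cube_def mem_box_cart less_le)
      then show ?thesis
        by (simp add: F0_def)
    qed (use elim(1) in \<open>simp add: F0_def\<close>)
  qed
qed

lemma cube_L2_F: "cube_L2 F"
proof
  show "F \<in> borel_measurable cube_measure"
    by (rule borel_measurable_cube) simp
  show "integrable cube_measure (\<lambda>\<xi>. (norm (F \<xi>))\<^sup>2)"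
    using F_L2 integrable_mult_indicator[of per_cube lborel "\<lambda>\<xi>. (norm (F \<xi>))\<^sup>2"]
    by (subst integrable_restrict_space) (auto simp: in_L2_def)
qed

lemma integrable_cube_F: "integrable cube_measure F"
  using integrable_cube_L2_cis[OF cube_L2_F, of 0] by simp

lemma integrable_F0: "integrable lborel F0"
  using integrable_cube_F unfolding F0_def[abs_def] by (subst (asm) integrable_restrict_space) auto

lemma integrable_F: "integrable lborel F"
  using integrable_F0 AE_F0 by (subst integrable_cong_AE[where g=F0]) auto

lemma inversion: "f y = of_real (1 / (2 * pi) ^ CARD('n)) * (\<integral>\<xi>. F0 \<xi> * cis (y \<bullet> \<xi>) \<partial>lborel)"
proof -
  have "(\<integral>\<xi>. F0 \<xi> * cis (y \<bullet> \<xi>) \<partial>lborel) = (\<integral>\<xi>. F \<xi> * cis (y \<bullet> \<xi>) \<partial>lborel)"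
    using AE_F0 by (intro integral_cong_AE) auto
  then show ?thesis
    by (simp add: fourier_inversion_L2[OF fourier cont integrable_F])
qed

lemma fourier_coeff_F: "fourier_coeff F k = f (lattice_pt k)"
  unfolding inversion fourier_coeff_def
  by (subst integral_restrict_space) (auto simp: F0_def)

text \<open>The periodic extension of the restriction of F to the cube, that is, the function whose
  Fourier coefficients are the samples f(k).\<close>

definition Fper :: "real^'n \<Rightarrow> complex" where
  "Fper \<xi> = F (\<xi> - per_shift (per_index \<xi>))"

lemma Fper_measurable [measurable]: "Fper \<in> borel_measurable borel"
proof -
  have "(\<lambda>\<xi>::real^'n. per_shift (per_index \<xi>)) \<in> borel_measurable borel"
  proof (rule borel_measurable_euclidean_space[THEN iffD2], rule ballI)
    fix b :: "real^'n" assume "b \<in> Basis"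
    then obtain i where b: "b = axis i 1"
      by (auto simp: Basis_vec_def)
    have "(\<lambda>\<xi>::real^'n. 2 * pi * real_of_int \<lfloor>(\<xi> $ i + pi) / (2 * pi)\<rfloor>) \<in> borel_measurable borel"
      by measurable
    then show "(\<lambda>\<xi>. per_shift (per_index \<xi>) \<bullet> b) \<in> borel_measurable borel"
      by (simp add: b inner_axis per_index_def)
  qed
  then show ?thesis
    unfolding Fper_def[abs_def] by measurable
qed

lemma Fper_add_shift: "\<xi> \<in> per_cube \<Longrightarrow> Fper (\<xi> + per_shift j) = F \<xi>"
  by (simp add: Fper_def per_index_add_shift)

lemma F0_add_shift: "\<xi> \<in> per_cube \<Longrightarrow> F0 (\<xi> + per_shift j) = (if j = 0 then F \<xi> else 0)"
  using diff_per_shift_in_cube_iff[of "\<xi> + per_shift j" 0]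
  by (auto simp: F0_def per_index_add_shift indicator_def)

end

section \<open>The interpolation error for a fixed shape parameter\<close>

locale cardinal_interpolation = bandlimited f F for f F :: "real^'n \<Rightarrow> complex" +
  fixes \<alpha> c :: real
  assumes alpha: "\<alpha> \<notin> \<nat>" and c: "c \<ge> 1"
begin

abbreviation Lhat :: "real^'n \<Rightarrow> real" where
  "Lhat \<equiv> cardinal_hat \<alpha> c"

lemma good_freqI: "\<xi> \<in> good_freq \<Longrightarrow> good_frequency \<alpha> \<xi>"
  by (simp add: good_frequency_def alpha)

text \<open>The factor by which the modulus of F is multiplied in the error on the translate of the
  cube with index j; see \<open>norm_G_add_shift\<close>.\<close>

definition defect :: "real^'n \<Rightarrow> int^'n \<Rightarrow> real" where
  "defect \<xi> j = \<bar>Lhat (\<xi> + per_shift j) - (if j = 0 then 1 else 0)\<bar>"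

lemma
  assumes "\<xi> \<in> good_freq"
  shows defect_le_1: "defect \<xi> j \<le> 1"
    and nn_integral_defect: "(\<integral>\<^sup>+j. ennreal (defect \<xi> j) \<partial>count_space UNIV) = ennreal (2 * (1 - Lhat \<xi>))"
proof -
  interpret G: good_frequency \<alpha> \<xi>
    by (rule good_freqI[OF assms])
  note nonneg = G.cardinal_hat_nonneg[OF c]
  note le_1 = G.cardinal_hat_le_1[OF c]
  \<comment> \<open>At j = 0 the modulus is 1 - Lhat; written as Lhat plus (1 - 2 Lhat), it lets the
    total be read off from \<open>integral_cardinal_hat\<close>.\<close>
  have eq: "defect \<xi> j = Lhat (\<xi> + per_shift j) + indicator {0} j * (1 - 2 * Lhat \<xi>)" for j
    using nonneg[of j] le_1 by (simp add: defect_def indicator_def)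
  have int_ind: "integrable (count_space UNIV) (\<lambda>j. indicator {0 :: int^'n} j * (1 - 2 * Lhat \<xi>))"
    by (intro integrable_mult_left) (simp add: integrable_indicator_iff)
  have int: "integrable (count_space UNIV) (defect \<xi>)"
    unfolding eq[abs_def] by (intro Bochner_Integration.integrable_add G.integrable_cardinal_hat c int_ind)
  have I: "(\<integral>j. defect \<xi> j \<partial>count_space UNIV) = 2 * (1 - Lhat \<xi>)"
    unfolding eq
    by (subst Bochner_Integration.integral_add[OF G.integrable_cardinal_hat[OF c] int_ind])
      (simp add: G.integral_cardinal_hat[OF c])
  have "(\<integral>\<^sup>+j. ennreal (defect \<xi> j) \<partial>count_space UNIV) = ennreal (\<integral>j. defect \<xi> j \<partial>count_space UNIV)"
    by (rule nn_integral_eq_integral[OF int]) (simp add: defect_def)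
  then show "(\<integral>\<^sup>+j. ennreal (defect \<xi> j) \<partial>count_space UNIV) = ennreal (2 * (1 - Lhat \<xi>))"
    by (simp only: I)
  show "defect \<xi> j \<le> 1"
    using nonneg[of j] G.cardinal_hat_shift_le_1[OF c, of j] by (auto simp: defect_def)
qed

text \<open>The Fourier transform of the interpolation error, by
  \<open>interpolant_diff\<close>.\<close>

definition G :: "real^'n \<Rightarrow> complex" where
  "G \<xi> = of_real (Lhat \<xi>) * Fper \<xi> - F0 \<xi>"

lemma G_measurable [measurable]: "G \<in> borel_measurable borel"
  unfolding G_def[abs_def] by measurable

lemma norm_G_add_shift:
  assumes "\<xi> \<in> per_cube"
  shows "norm (G (\<xi> + per_shift j)) = norm (F \<xi>) * defect \<xi> j"
proof -
  have "G (\<xi> + per_shift j) = F \<xi> * of_real (Lhat (\<xi> + per_shift j) - (if j = 0 then 1 else 0))"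
    using assms by (simp add: G_def Fper_add_shift F0_add_shift algebra_simps)
  then show ?thesis
    by (simp only: norm_mult norm_of_real defect_def)
qed

text \<open>Along the translates of a point of the cube, |G| is |F| times \<open>defect\<close>, and
  \<open>defect\<close> \<le> 1 makes its p-th power at most itself. Every p \<ge> 1 is thereby
  reduced to the sum in \<open>nn_integral_defect\<close>.\<close>

lemma nn_integral_G_le:
  assumes p: "p > 0"
  shows "(\<integral>\<^sup>+\<xi>. ennreal (norm (G \<xi>) ^ p) \<partial>lborel)
    \<le> (\<integral>\<^sup>+\<xi>. ennreal (norm (F \<xi>) ^ p * (2 * (1 - Lhat \<xi>))) \<partial>cube_measure)"
proof -
  have "(\<integral>\<^sup>+\<xi>. ennreal (norm (G \<xi>) ^ p) \<partial>lborel)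
    = (\<integral>\<^sup>+\<xi>. \<integral>\<^sup>+j. ennreal (norm (G (\<xi> + per_shift j)) ^ p) \<partial>count_space UNIV \<partial>cube_measure)"
    by (rule nn_integral_periodize) simp
  also have "\<dots> \<le> (\<integral>\<^sup>+\<xi>. ennreal (norm (F \<xi>) ^ p * (2 * (1 - Lhat \<xi>))) \<partial>cube_measure)"
  proof (rule nn_integral_mono_AE)
    show "AE \<xi> in cube_measure. (\<integral>\<^sup>+j. ennreal (norm (G (\<xi> + per_shift j)) ^ p) \<partial>count_space UNIV)
      \<le> ennreal (norm (F \<xi>) ^ p * (2 * (1 - Lhat \<xi>)))"
      using AE_good_freq AE_space
    proof eventually_elim
      case (elim \<xi>)
      interpret G: good_frequency \<alpha> \<xi>
        by (rule good_freqI[OF elim(1)])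
      have "ennreal (norm (G (\<xi> + per_shift j)) ^ p) \<le> ennreal (norm (F \<xi>) ^ p) * ennreal (defect \<xi> j)" for j
      proof -
        have "0 \<le> defect \<xi> j"
          by (simp add: defect_def)
        moreover have "defect \<xi> j ^ p \<le> defect \<xi> j ^ 1"
          using p \<open>0 \<le> defect \<xi> j\<close> defect_le_1[OF elim(1)] by (intro power_decreasing) auto
        ultimately show ?thesis
          using elim(2) by (simp add: norm_G_add_shift power_mult_distrib ennreal_mult'[symmetric] ennreal_leI mult_left_mono)
      qed
      then have "(\<integral>\<^sup>+j. ennreal (norm (G (\<xi> + per_shift j)) ^ p) \<partial>count_space UNIV)
        \<le> (\<integral>\<^sup>+j. ennreal (norm (F \<xi>) ^ p) * ennreal (defect \<xi> j) \<partial>count_space UNIV)"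
        by (rule nn_integral_mono)
      also have "\<dots> = ennreal (norm (F \<xi>) ^ p) * ennreal (2 * (1 - Lhat \<xi>))"
        by (simp add: nn_integral_cmult nn_integral_defect[OF elim(1)])
      also have "\<dots> = ennreal (norm (F \<xi>) ^ p * (2 * (1 - Lhat \<xi>)))"
        by (simp add: ennreal_mult')
      finally show ?case .
    qed
  qed
  finally show ?thesis .
qed

text \<open>Passes to a Bochner integral, the form in which the limit in c is taken. As
  \<open>ennreal\<close> sends negative numbers to 0, nonnegativity is recorded separately.\<close>

lemma integral_G_le:
  assumes p: "p > 0" and F: "integrable cube_measure (\<lambda>\<xi>. norm (F \<xi>) ^ p)"
  shows "(\<integral>\<^sup>+\<xi>. ennreal (norm (G \<xi>) ^ p) \<partial>lborel)
      \<le> ennreal (\<integral>\<xi>. norm (F \<xi>) ^ p * (2 * (1 - Lhat \<xi>)) \<partial>cube_measure)"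
    and "(\<integral>\<xi>. norm (F \<xi>) ^ p * (2 * (1 - Lhat \<xi>)) \<partial>cube_measure) \<ge> 0" (is "?E \<ge> 0")
proof -
  note [measurable] = borel_measurable_cube[OF F_measurable] borel_measurable_cube[OF borel_measurable_cardinal_hat]
  have bnd: "AE \<xi> in cube_measure. 0 \<le> 1 - Lhat \<xi> \<and> 1 - Lhat \<xi> \<le> 1"
    using AE_good_freq
  proof eventually_elim
    case (elim \<xi>)
    interpret G: good_frequency \<alpha> \<xi>
      by (rule good_freqI[OF elim])
    show ?case
      using G.cardinal_hat_le_1[OF c] G.cardinal_hat_nonneg[OF c, of 0] by simp
  qed
  have int: "integrable cube_measure (\<lambda>\<xi>. norm (F \<xi>) ^ p * (2 * (1 - Lhat \<xi>)))"
  proof (rule Bochner_Integration.integrable_bound[OF integrable_mult_right[OF F, of 2]])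
    show "AE \<xi> in cube_measure. norm (norm (F \<xi>) ^ p * (2 * (1 - Lhat \<xi>))) \<le> norm (2 * norm (F \<xi>) ^ p)"
      using bnd
    proof eventually_elim
      case (elim \<xi>)
      then show ?case
        using mult_left_mono[of "1 - Lhat \<xi>" 1 "norm (F \<xi>) ^ p"] by (simp add: abs_mult) (simp add: algebra_simps)
    qed
  qed measurable
  have nn: "AE \<xi> in cube_measure. 0 \<le> norm (F \<xi>) ^ p * (2 * (1 - Lhat \<xi>))"
    using bnd by eventually_elim simp
  show "?E \<ge> 0"
    by (rule integral_nonneg_AE[OF nn])
  show "(\<integral>\<^sup>+\<xi>. ennreal (norm (G \<xi>) ^ p) \<partial>lborel) \<le> ennreal ?E"
    using nn_integral_G_le[OF p] by (simp only: nn_integral_eq_integral[OF int nn])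
qed

lemma integrable_norm_F: "integrable cube_measure (\<lambda>\<xi>. norm (F \<xi>) ^ 1)"
  using integrable_cube_F by simp

lemma integrable_G: "integrable lborel G"
proof (rule integrableI_bounded)
  have "(\<integral>\<^sup>+\<xi>. ennreal (norm (G \<xi>)) \<partial>lborel)
      \<le> ennreal (\<integral>\<xi>. norm (F \<xi>) ^ 1 * (2 * (1 - Lhat \<xi>)) \<partial>cube_measure)"
    using integral_G_le(1)[OF _ integrable_norm_F] by simp
  also have "\<dots> < \<infinity>"
    by simp
  finally show "(\<integral>\<^sup>+\<xi>. ennreal (norm (G \<xi>)) \<partial>lborel) < \<infinity>" .
qed simp

lemma integrable_LFper: "integrable lborel (\<lambda>\<xi>. of_real (Lhat \<xi>) * Fper \<xi>)"
  using Bochner_Integration.integrable_add[OF integrable_G integrable_F0] by (simp add: G_def)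

text \<open>The translates are nonnegative with sum 1, so the integral is the volume of the cube.
  This makes \<open>cardinal_fun\<close> a genuine inverse Fourier transform.\<close>

lemma integrable_Lhat: "integrable lborel Lhat"
proof (rule integrableI_bounded)
  have "(\<integral>\<^sup>+\<xi>. ennreal (norm (Lhat \<xi>)) \<partial>lborel)
    = (\<integral>\<^sup>+\<xi>. \<integral>\<^sup>+j. ennreal (norm (Lhat (\<xi> + per_shift j))) \<partial>count_space UNIV \<partial>cube_measure)"
    by (rule nn_integral_periodize) simp
  also have "\<dots> = (\<integral>\<^sup>+\<xi>. 1 \<partial>(cube_measure :: (real^'n) measure))"
  proof (rule nn_integral_cong_AE)
    show "AE \<xi> in cube_measure. (\<integral>\<^sup>+j. ennreal (norm (Lhat (\<xi> + per_shift j))) \<partial>count_space UNIV) = 1"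
      using AE_good_freq
    proof eventually_elim
      case (elim \<xi>)
      interpret G: good_frequency \<alpha> \<xi>
        by (rule good_freqI[OF elim])
      have "(\<integral>\<^sup>+j. ennreal (norm (Lhat (\<xi> + per_shift j))) \<partial>count_space UNIV)
        = (\<integral>\<^sup>+j. ennreal (Lhat (\<xi> + per_shift j)) \<partial>count_space UNIV)"
        using G.cardinal_hat_nonneg[OF c] by simp
      also have "\<dots> = 1"
        using G.cardinal_hat_nonneg[OF c]
        by (subst nn_integral_eq_integral[OF G.integrable_cardinal_hat[OF c]])
          (auto simp: G.integral_cardinal_hat[OF c])
      finally show ?case .
    qed
  qed
  also have "\<dots> < \<infinity>"
    using cube.finite_emeasure_space by (simp add: less_top[symmetric])
  finally show "(\<integral>\<^sup>+\<xi>. ennreal (norm (Lhat \<xi>)) \<partial>lborel) < \<infinity>" .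
qed simp

text \<open>The periodisation of \<xi> \<mapsto> Lhat \<xi> * cis (x \<bullet> \<xi>). Its Fourier
  coefficients are the values of the cardinal function that the series pairs with the samples
  f(k).\<close>

definition H :: "real^'n \<Rightarrow> real^'n \<Rightarrow> complex" where
  "H x \<xi> = (\<integral>j. of_real (Lhat (\<xi> + per_shift j)) * cis (x \<bullet> (\<xi> + per_shift j)) \<partial>count_space UNIV)"

lemma H_measurable [measurable]: "H x \<in> borel_measurable borel"
proof -
  interpret C: sigma_finite_measure "count_space (UNIV :: (int^'n) set)"
    by (rule sigma_finite_measure_count_space)
  have [measurable]: "per_shift \<in> count_space UNIV \<rightarrow>\<^sub>M (borel :: (real^'n) measure)"
    by simp
  show ?thesis
    unfolding H_def[abs_def] by measurable
qed

lemma norm_H_le: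
  assumes "\<xi> \<in> good_freq"
  shows "norm (H x \<xi>) \<le> 1"
proof -
  interpret G: good_frequency \<alpha> \<xi>
    by (rule good_freqI[OF assms])
  have "norm (H x \<xi>) \<le> (\<integral>j. norm (of_real (Lhat (\<xi> + per_shift j)) * cis (x \<bullet> (\<xi> + per_shift j))) \<partial>count_space UNIV)"
    unfolding H_def by (rule integral_norm_bound)
  also have "\<dots> = (\<integral>j. Lhat (\<xi> + per_shift j) \<partial>count_space UNIV)"
    using G.cardinal_hat_nonneg[OF c] by (simp add: norm_mult)
  finally show ?thesis
    by (simp add: G.integral_cardinal_hat[OF c])
qed

text \<open>The character of a lattice point does not see the periods 2 \<pi> j, so it can be pulled
  out of the sum over j.\<close>

lemma cardinal_fun_shift:
  "cardinal_fun \<alpha> c (x - lattice_pt k) = fourier_coeff (H x) (- k)"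
proof -
  have int: "integrable lborel (\<lambda>\<xi>. of_real (Lhat \<xi>) * cis ((x - lattice_pt k) \<bullet> \<xi>))"
    by (rule Bochner_Integration.integrable_bound[OF integrable_Lhat]) (auto simp: norm_mult)
  have "(\<integral>\<xi>. of_real (Lhat \<xi>) * cis ((x - lattice_pt k) \<bullet> \<xi>) \<partial>lborel)
    = (\<integral>\<xi>. \<integral>j. of_real (Lhat (\<xi> + per_shift j)) * cis ((x - lattice_pt k) \<bullet> (\<xi> + per_shift j)) \<partial>count_space UNIV \<partial>cube_measure)"
    by (rule integral_periodize[OF int])
  also have "\<dots> = (\<integral>\<xi>. H x \<xi> * cis (lattice_pt (- k) \<bullet> \<xi>) \<partial>cube_measure)"
  proof (intro Bochner_Integration.integral_cong refl)
    fix \<xi>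
    have "cis ((x - lattice_pt k) \<bullet> (\<xi> + per_shift j)) = cis (x \<bullet> (\<xi> + per_shift j)) * cis (lattice_pt (- k) \<bullet> \<xi>)" for j
    proof -
      have "(x - lattice_pt k) \<bullet> (\<xi> + per_shift j)
        = x \<bullet> (\<xi> + per_shift j) + lattice_pt (- k) \<bullet> \<xi> + lattice_pt (- k) \<bullet> per_shift j"
        by (simp add: lattice_pt_uminus inner_diff_left inner_add_right)
      then show ?thesis
        by (simp only: cis_mult[symmetric] cis_lattice_per_shift mult_1_right)
    qed
    then show "(\<integral>j. of_real (Lhat (\<xi> + per_shift j)) * cis ((x - lattice_pt k) \<bullet> (\<xi> + per_shift j)) \<partial>count_space UNIV)
      = H x \<xi> * cis (lattice_pt (- k) \<bullet> \<xi>)"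
      by (simp add: H_def mult.assoc[symmetric])
  qed
  finally show ?thesis
    unfolding cardinal_fun_def fourier_coeff_def exp_i_eq_cis by simp
qed

lemma interpolant_eq:
  "cardinal_interpolant \<alpha> c f x = of_real (1 / (2 * pi) ^ CARD('n)) * (\<integral>\<xi>. F \<xi> * H x \<xi> \<partial>cube_measure)"
proof -
  \<comment> \<open>\<open>norm_H_le\<close> holds at good frequencies only, while
    \<open>bounded_meas\<close> asks for a bound everywhere; \<open>H'\<close> repairs this on a
    null set.\<close>
  define H' where "H' \<xi> = (if norm (H x \<xi>) \<le> 1 then H x \<xi> else 0)" for \<xi>
  have [measurable]: "H' \<in> borel_measurable borel"
    unfolding H'_def[abs_def] by measurable
  have "bounded_meas H'"
    unfolding bounded_meas_def by (auto intro!: exI[of _ 1] simp: H'_def)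
  then have "parseval_pair F H'"
    by (rule parseval_pair_bounded[OF cube_L2_F])
  moreover have "AE \<xi> in cube_measure. H' \<xi> = H x \<xi>"
    using AE_good_freq by eventually_elim (simp add: H'_def norm_H_le)
  ultimately have "parseval_pair F (H x)"
    by (rule parseval_pair_cong_AE) (auto intro: borel_measurable_cube)
  then have "((\<lambda>k. f (lattice_pt k) * cardinal_fun \<alpha> c (x - lattice_pt k))
     has_sum of_real (1 / (2 * pi) ^ CARD('n)) * (\<integral>\<xi>. F \<xi> * H x \<xi> \<partial>cube_measure)) UNIV"
    unfolding parseval_pair_def by (simp only: fourier_coeff_F cardinal_fun_shift)
  then show ?thesis
    unfolding cardinal_interpolant_def by (rule infsumI)
qed

text \<open>Running the periodisation backwards turns the integral of F times \<open>H x\<close>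
  over the cube into one over the whole space, with \<open>Fper\<close> in place of F; inversion for
  f contributes the term \<open>F0\<close>.\<close>

lemma interpolant_diff:
  "cardinal_interpolant \<alpha> c f x - f x = of_real (1 / (2 * pi) ^ CARD('n)) * (\<integral>\<xi>. G \<xi> * cis (x \<bullet> \<xi>) \<partial>lborel)"
proof -
  have int: "integrable lborel (\<lambda>\<xi>. of_real (Lhat \<xi>) * Fper \<xi> * cis (x \<bullet> \<xi>))"
    by (rule Bochner_Integration.integrable_bound[OF integrable_LFper]) (auto simp: norm_mult)
  have int0: "integrable lborel (\<lambda>\<xi>. F0 \<xi> * cis (x \<bullet> \<xi>))"
    by (rule Bochner_Integration.integrable_bound[OF integrable_F0]) (auto simp: norm_mult)
  have "(\<integral>\<xi>. of_real (Lhat \<xi>) * Fper \<xi> * cis (x \<bullet> \<xi>) \<partial>lborel)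
    = (\<integral>\<xi>. \<integral>j. of_real (Lhat (\<xi> + per_shift j)) * Fper (\<xi> + per_shift j) * cis (x \<bullet> (\<xi> + per_shift j))
        \<partial>count_space UNIV \<partial>cube_measure)"
    by (rule integral_periodize[OF int])
  also have "\<dots> = (\<integral>\<xi>. F \<xi> * H x \<xi> \<partial>cube_measure)"
  proof (intro Bochner_Integration.integral_cong refl)
    fix \<xi> :: "real^'n" assume "\<xi> \<in> space cube_measure"
    then have \<xi>: "\<xi> \<in> per_cube"
      by simp
    have "(\<integral>j. of_real (Lhat (\<xi> + per_shift j)) * Fper (\<xi> + per_shift j) * cis (x \<bullet> (\<xi> + per_shift j)) \<partial>count_space UNIV)
      = (\<integral>j. F \<xi> * (of_real (Lhat (\<xi> + per_shift j)) * cis (x \<bullet> (\<xi> + per_shift j))) \<partial>count_space UNIV)"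
      by (simp add: Fper_add_shift[OF \<xi>] mult_ac)
    then show "(\<integral>j. of_real (Lhat (\<xi> + per_shift j)) * Fper (\<xi> + per_shift j) * cis (x \<bullet> (\<xi> + per_shift j)) \<partial>count_space UNIV)
      = F \<xi> * H x \<xi>"
      by (simp add: H_def)
  qed
  finally have "cardinal_interpolant \<alpha> c f x
    = of_real (1 / (2 * pi) ^ CARD('n)) * (\<integral>\<xi>. of_real (Lhat \<xi>) * Fper \<xi> * cis (x \<bullet> \<xi>) \<partial>lborel)"
    by (simp add: interpolant_eq)
  then have "cardinal_interpolant \<alpha> c f x - f x = of_real (1 / (2 * pi) ^ CARD('n)) *
     ((\<integral>\<xi>. of_real (Lhat \<xi>) * Fper \<xi> * cis (x \<bullet> \<xi>) \<partial>lborel) - (\<integral>\<xi>. F0 \<xi> * cis (x \<bullet> \<xi>) \<partial>lborel))"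
    by (simp only: inversion right_diff_distrib)
  also have "(\<integral>\<xi>. of_real (Lhat \<xi>) * Fper \<xi> * cis (x \<bullet> \<xi>) \<partial>lborel) - (\<integral>\<xi>. F0 \<xi> * cis (x \<bullet> \<xi>) \<partial>lborel)
     = (\<integral>\<xi>. G \<xi> * cis (x \<bullet> \<xi>) \<partial>lborel)"
    by (subst Bochner_Integration.integral_diff[OF int int0, symmetric]) (simp add: G_def left_diff_distrib)
  finally show ?thesis .
qed

lemma norm_interpolant_diff_le:
  "norm (cardinal_interpolant \<alpha> c f x - f x)
    \<le> 1 / (2 * pi) ^ CARD('n) * (\<integral>\<xi>. norm (F \<xi>) ^ 1 * (2 * (1 - Lhat \<xi>)) \<partial>cube_measure)"
proof -
  have "ennreal (norm (\<integral>\<xi>. G \<xi> * cis (x \<bullet> \<xi>) \<partial>lborel)) \<le> (\<integral>\<^sup>+\<xi>. ennreal (norm (G \<xi> * cis (x \<bullet> \<xi>))) \<partial>lborel)"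
    by (rule integral_norm_bound_ennreal, rule Bochner_Integration.integrable_bound[OF integrable_G])
      (auto simp: norm_mult)
  also have "\<dots> = (\<integral>\<^sup>+\<xi>. ennreal (norm (G \<xi>) ^ 1) \<partial>lborel)"
    by (simp add: norm_mult)
  also have "\<dots> \<le> ennreal (\<integral>\<xi>. norm (F \<xi>) ^ 1 * (2 * (1 - Lhat \<xi>)) \<partial>cube_measure)"
    by (rule integral_G_le(1)[OF _ integrable_norm_F]) simp
  finally have "norm (\<integral>\<xi>. G \<xi> * cis (x \<bullet> \<xi>) \<partial>lborel) \<le> (\<integral>\<xi>. norm (F \<xi>) ^ 1 * (2 * (1 - Lhat \<xi>)) \<partial>cube_measure)"
    using integral_G_le(2)[OF _ integrable_norm_F] by simp
  then show ?thesis
    unfolding interpolant_diff by (simp add: norm_mult norm_divide norm_power divide_right_mono)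
qed

text \<open>The normalisation (2 \<pi>)^(-d) of the inverse transform enters squared, and one of the
  two factors is cancelled by the constant of the Plancherel inequality.\<close>

lemma L2_norm_interpolant_diff_le:
  "L2_norm (\<lambda>x. cardinal_interpolant \<alpha> c f x - f x)
    \<le> ennreal (sqrt (1 / (2 * pi) ^ CARD('n) * (\<integral>\<xi>. (norm (F \<xi>))\<^sup>2 * (2 * (1 - Lhat \<xi>)) \<partial>cube_measure)))"
proof (rule L2_norm_le)
  have F2: "integrable cube_measure (\<lambda>\<xi>. (norm (F \<xi>))\<^sup>2)"
    using cube_L2_F by simp
  define E where "E = (\<integral>\<xi>. (norm (F \<xi>))\<^sup>2 * (2 * (1 - Lhat \<xi>)) \<partial>cube_measure)"
  define \<omega> where "\<omega> = 1 / (2 * pi) ^ CARD('n)"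
  have \<omega>: "\<omega> > 0" "\<omega> * (2 * pi) ^ CARD('n) = 1"
    by (auto simp: \<omega>_def)
  have E: "E \<ge> 0"
    unfolding E_def by (rule integral_G_le(2)[OF _ F2]) simp
  then show "0 \<le> 1 / (2 * pi) ^ CARD('n) * (\<integral>\<xi>. (norm (F \<xi>))\<^sup>2 * (2 * (1 - Lhat \<xi>)) \<partial>cube_measure)"
    by (simp add: E_def)
  show "(\<lambda>x. cardinal_interpolant \<alpha> c f x - f x) \<in> borel_measurable borel"
    unfolding interpolant_diff by measurable
  have "(\<integral>\<^sup>+x. ennreal ((norm (cardinal_interpolant \<alpha> c f x - f x))\<^sup>2) \<partial>lborel)
    = (\<integral>\<^sup>+x. ennreal (\<omega>\<^sup>2) * ennreal ((norm (\<integral>\<xi>. G \<xi> * cis (x \<bullet> \<xi>) \<partial>lborel))\<^sup>2) \<partial>lborel)"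
    unfolding interpolant_diff \<omega>_def[symmetric] using \<omega>(1)
    by (simp add: norm_mult power_mult_distrib ennreal_mult)
  also have "\<dots> = ennreal (\<omega>\<^sup>2) * (\<integral>\<^sup>+x. ennreal ((norm (\<integral>\<xi>. G \<xi> * cis (x \<bullet> \<xi>) \<partial>lborel))\<^sup>2) \<partial>lborel)"
    by (rule nn_integral_cmult) measurable
  also have "\<dots> \<le> ennreal (\<omega>\<^sup>2) * (ennreal ((2 * pi) ^ CARD('n)) * ennreal E)"
    unfolding E_def
    by (intro mult_left_mono order_trans[OF nn_integral_Plancherel_le[OF integrable_G]] integral_G_le(1)[OF _ F2]) auto
  also have "\<dots> = ennreal (\<omega> * (\<omega> * (2 * pi) ^ CARD('n)) * E)"
    using E \<omega>(1) by (simp add: ennreal_mult'[symmetric] power2_eq_square mult_ac)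
  also have "\<dots> = ennreal (1 / (2 * pi) ^ CARD('n) * (\<integral>\<xi>. (norm (F \<xi>))\<^sup>2 * (2 * (1 - Lhat \<xi>)) \<partial>cube_measure))"
    unfolding \<omega>(2) by (simp add: E_def \<omega>_def)
  finally show "(\<integral>\<^sup>+x. ennreal ((norm (cardinal_interpolant \<alpha> c f x - f x))\<^sup>2) \<partial>lborel) \<le> \<dots>" .
qed

end

section \<open>The limit of large shape parameters\<close>

context bandlimited
begin

lemma tendsto_error_bound:
  assumes alpha: "\<alpha> \<notin> \<nat>" and F: "integrable cube_measure (\<lambda>\<xi>. norm (F \<xi>) ^ p)"
  shows "((\<lambda>c. 1 / (2 * pi) ^ CARD('n) * (\<integral>\<xi>. norm (F \<xi>) ^ p * (2 * (1 - cardinal_hat \<alpha> c \<xi>)) \<partial>cube_measure)) \<longlongrightarrow> 0) at_top"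
proof -
  note [measurable] = borel_measurable_cube[OF F_measurable] borel_measurable_cube[OF borel_measurable_cardinal_hat]
  have "((\<lambda>c. \<integral>\<xi>. norm (F \<xi>) ^ p * (2 * (1 - cardinal_hat \<alpha> c \<xi>)) \<partial>cube_measure)
     \<longlongrightarrow> (\<integral>\<xi>. 0 \<partial>(cube_measure :: (real^'n) measure))) at_top"
  proof (rule integral_dominated_convergence_at_top[where w="\<lambda>\<xi>. 2 * norm (F \<xi>) ^ p"])
    show "integrable cube_measure (\<lambda>\<xi>. 2 * norm (F \<xi>) ^ p)"
      by (rule integrable_mult_right[OF F])
    show "AE \<xi> in cube_measure. ((\<lambda>c. norm (F \<xi>) ^ p * (2 * (1 - cardinal_hat \<alpha> c \<xi>))) \<longlongrightarrow> 0) at_top"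
      using AE_good_freq
    proof eventually_elim
      case (elim \<xi>)
      then interpret G: good_frequency \<alpha> \<xi>
        by (simp add: good_frequency_def alpha)
      have "((\<lambda>c. norm (F \<xi>) ^ p * (2 * (1 - cardinal_hat \<alpha> c \<xi>))) \<longlongrightarrow> norm (F \<xi>) ^ p * (2 * (1 - 1))) at_top"
        by (intro tendsto_intros G.tendsto_cardinal_hat)
      then show ?case
        by simp
    qed
    show "\<forall>\<^sub>F c in at_top. AE \<xi> in cube_measure. norm (norm (F \<xi>) ^ p * (2 * (1 - cardinal_hat \<alpha> c \<xi>))) \<le> 2 * norm (F \<xi>) ^ p"
      using eventually_ge_at_top[of 1]
    proof eventually_elim
      case (elim c)
      show ?case
        using AE_good_freq
      proof eventually_elim
        fix \<xi> :: "real^'n" assume "\<xi> \<in> good_freq"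
        then interpret G: good_frequency \<alpha> \<xi>
          by (simp add: good_frequency_def alpha)
        have "\<bar>2 - 2 * cardinal_hat \<alpha> c \<xi>\<bar> \<le> 2"
          using G.cardinal_hat_le_1[OF elim] G.cardinal_hat_nonneg[OF elim, of 0] by simp
        from mult_left_mono[OF this, of "norm (F \<xi>) ^ p"]
        show "norm (norm (F \<xi>) ^ p * (2 * (1 - cardinal_hat \<alpha> c \<xi>))) \<le> 2 * norm (F \<xi>) ^ p"
          by (simp add: abs_mult mult.commute[of 2])
      qed
    qed
  qed auto
  from tendsto_mult[OF tendsto_const this, of "1 / (2 * pi) ^ CARD('n)"] show ?thesis
    by simp
qed

end

theorem theorem7:
  fixes \<alpha> :: real and f :: "real ^ 'n \<Rightarrow> complex"
  assumes "\<alpha> \<notin> \<nat>"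
    and "f \<in> paley_wiener"
  shows "((\<lambda>c. L2_norm (\<lambda>x. cardinal_interpolant \<alpha> c f x - f x)) \<longlongrightarrow> 0) at_top
    \<and> uniform_limit UNIV (\<lambda>c x. cardinal_interpolant \<alpha> c f x) f at_top"
proof
  obtain F where F: "is_fourier_L2 f F" "continuous_on UNIV f"
    "AE \<xi> in lborel. \<xi> \<notin> cbox (\<chi> i. - pi) (\<chi> i. pi) \<longrightarrow> F \<xi> = 0"
    using assms(2) by (auto simp: paley_wiener_def)
  interpret bandlimited f F
    by unfold_locales (fact F)+
  have CI: "cardinal_interpolation f F \<alpha> c" if "c \<ge> 1" for c
    using that assms(1) by unfold_locales
  have "((\<lambda>c. ennreal (sqrt (1 / (2 * pi) ^ CARD('n) *
      (\<integral>\<xi>. (norm (F \<xi>))\<^sup>2 * (2 * (1 - cardinal_hat \<alpha> c \<xi>)) \<partial>cube_measure)))) \<longlongrightarrow> ennreal (sqrt 0)) at_top"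
    using cube_L2_F by (intro tendsto_ennrealI tendsto_real_sqrt tendsto_error_bound assms(1)) auto
  then have lim: "((\<lambda>c. ennreal (sqrt (1 / (2 * pi) ^ CARD('n) *
      (\<integral>\<xi>. (norm (F \<xi>))\<^sup>2 * (2 * (1 - cardinal_hat \<alpha> c \<xi>)) \<partial>cube_measure)))) \<longlongrightarrow> 0) at_top"
    by simp
  show "((\<lambda>c. L2_norm (\<lambda>x. cardinal_interpolant \<alpha> c f x - f x)) \<longlongrightarrow> 0) at_top"
  proof (rule tendsto_sandwich[OF _ _ tendsto_const lim])
    show "\<forall>\<^sub>F c in at_top. L2_norm (\<lambda>x. cardinal_interpolant \<alpha> c f x - f x) \<le>
      ennreal (sqrt (1 / (2 * pi) ^ CARD('n) * (\<integral>\<xi>. (norm (F \<xi>))\<^sup>2 * (2 * (1 - cardinal_hat \<alpha> c \<xi>)) \<partial>cube_measure)))"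
      using eventually_ge_at_top[of 1]
      by eventually_elim (rule cardinal_interpolation.L2_norm_interpolant_diff_le[OF CI])
  qed simp
  show "uniform_limit UNIV (\<lambda>c x. cardinal_interpolant \<alpha> c f x) f at_top"
  proof (rule uniform_limitI)
    fix e :: real assume "e > 0"
    have "integrable cube_measure (\<lambda>\<xi>. norm (F \<xi>) ^ 1)"
      using integrable_cube_F by simp
    from order_tendstoD(2)[OF tendsto_error_bound[OF assms(1) this] \<open>e > 0\<close>] eventually_ge_at_top[of 1]
    show "\<forall>\<^sub>F c in at_top. \<forall>x\<in>UNIV. dist (cardinal_interpolant \<alpha> c f x) (f x) < e"
      by eventually_elim
        (auto simp: dist_norm intro: le_less_trans[OF cardinal_interpolation.norm_interpolant_diff_le[OF CI]])
  qed
qed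

end
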